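(* Let $d\ge 1$, $\alpha\in(0,2)$, and let $f:\mathbb{R}^d\times\mathbb{R}^d\to[0,\infty]$ be a Borel function such that: (A.1) there is a constant $M>0$ with $f(x,y)\le M|y-x|^{-\alpha-d}$ for all $x,y\in\mathbb{R}^d$, $y\ne x$; (A.2) $f(x,x+h)=f(x,x-h)$ for all $x,h\in\mathbb{R}^d$, or $\alpha<1$; (A.3) $f(x,y)=f(y,x)$ for all $x,y\in\mathbb{R}^d$; (A.4) there is $a>0$ such that $\inf_{x\in\mathbb{R}^d}\int_{|y-x|>\varepsilon}f(x,y)\,dy\ge a\varepsilon^{-\alpha}$ for all $\varepsilon>0$; (A.5) the function $x\mapsto f(x,y)$ is continuous on $\mathbb{R}^d\setminus\{y\}$ for every $y\in\mathbb{R}^d$; (A.6) the operator $\mathcal{A}$ (with domain $C^2_c(\mathbb{R}^d)$), regarded as an operator on $C_\infty(\mathbb{R}^d)$, is closable and its closure $\bar{\mathcal{A}}$ is the generator of a strongly continuous contraction semigroup of operators $\{P_t,\ t\ge 0\}$ on $C_\infty(\mathbb{R}^d)$. Then there is $p:(0,\infty)\times\mathbb{R}^d\times\mathbb{R}^d\to[0,\infty)$ such that $$P_t\varphi(x)=\int_{\mathbb{R}^d}\varphi(y)\,p(t,x,y)\,dy,\quad x\in\mathbb{R}^d,\ t>0,\ \varphi\in C_\infty(\mathbb{R}^d),$$ and $$p(t,x,y)\le C\min\left(t^{-d/\alpha},\frac{t}{|y-x|^{\alpha+d}}\right),\quad x,y\in\mathbb{R}^d,\ t>0,$$ for some constant $C>0$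 depending only on $\alpha,M,a,d$.
   Context: $C_\infty(\mathbb{R}^d)$ is the space of continuous real functions on $\mathbb{R}^d$ vanishing at infinity, with the supremum norm; $C^2_c(\mathbb{R}^d)$ is the set of twice continuously differentiable functions with compact support. The operator $\mathcal{A}$ is defined, for $\varphi\in C_c^2(\mathbb{R}^d)$, by $$\mathcal{A}\varphi(x)=\lim_{\varepsilon\downarrow0}\int_{|y-x|>\varepsilon}(\varphi(y)-\varphi(x))f(x,y)\,dy,$$ the limit existing under (A.1) and (A.2); equivalently $$\mathcal{A}\varphi(x)=\int_{\mathbb{R}^d}\left(\varphi(x+h)-\varphi(x)-h\cdot\nabla\varphi(x)\mathbf{1}_{|h|<1}\right)f(x,x+h)\,dh+\frac12\int_{|h|<1}h\cdot\nabla\varphi(x)\,(f(x,x+h)-f(x,x-h))\,dh.$$ Under (A.1), (A.2), (A.5), $\mathcal{A}$ maps $C_c^2(\mathbb{R}^d)$ into $C_\infty(\mathbb{R}^d)$. For $x=y$, the minimum $\min(t^{-d/\alpha},t|y-x|^{-\alpha-d})$ is understood as $t^{-d/\alpha}$. *)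

theory Defs
  imports "HOL-Analysis.Analysis"
begin

section \<open>The Banach space of continuous functions vanishing at infinity\<close>

typedef (overloaded) 'a c_infty =
  "{\<phi> :: 'a::euclidean_space \<Rightarrow> real. continuous_on UNIV \<phi> \<and> (\<phi> \<longlongrightarrow> 0) at_infinity}"
  morphisms apply_c_infty C_infty
  by (rule exI[of _ "\<lambda>_. 0"]) simp

setup_lifting type_definition_c_infty

lemma c_infty_eqI: "(\<And>x. apply_c_infty \<phi> x = apply_c_infty \<psi> x) \<Longrightarrow> \<phi> = \<psi>"
  by transfer auto

lemma continuous_on_apply_c_infty: "continuous_on S (apply_c_infty \<phi>)"
  using apply_c_infty[of \<phi>] by (auto intro: continuous_on_subset)

lemma tendsto_apply_c_infty: "(apply_c_infty \<phi> \<longlongrightarrow> 0) at_infinity"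
  using apply_c_infty[of \<phi>] by auto

lemma bounded_apply_c_infty: "bounded (range (apply_c_infty \<phi>))"
proof -
  have "\<forall>\<^sub>F x in at_infinity. dist (apply_c_infty \<phi> x) 0 < 1"
    by (rule tendstoD[OF tendsto_apply_c_infty]) simp
  then obtain b where b: "\<And>x. b \<le> norm x \<Longrightarrow> \<bar>apply_c_infty \<phi> x\<bar> < 1"
    by (auto simp: eventually_at_infinity)
  have "compact (apply_c_infty \<phi> ` cball 0 b)"
    by (intro compact_continuous_image continuous_on_apply_c_infty) simp
  then obtain B where B: "\<And>x. norm x \<le> b \<Longrightarrow> \<bar>apply_c_infty \<phi> x\<bar> \<le> B"
    by (force dest!: compact_imp_bounded simp: bounded_iff)
  have "\<bar>apply_c_infty \<phi> x\<bar> \<le> max B 1" for x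
    using b[of x] B[of x] by linarith
  then show ?thesis
    by (auto simp: bounded_iff)
qed

instantiation c_infty :: (euclidean_space) real_vector
begin

lift_definition zero_c_infty :: "'a c_infty" is "\<lambda>_. 0"
  by simp

lift_definition plus_c_infty :: "'a c_infty \<Rightarrow> 'a c_infty \<Rightarrow> 'a c_infty"
  is "\<lambda>\<phi> \<psi> x. \<phi> x + \<psi> x"
  by (auto intro: continuous_intros tendsto_add_zero)

lift_definition uminus_c_infty :: "'a c_infty \<Rightarrow> 'a c_infty" is "\<lambda>\<phi> x. - \<phi> x"
  by (auto intro!: continuous_intros dest: tendsto_minus)

lift_definition minus_c_infty :: "'a c_infty \<Rightarrow> 'a c_infty \<Rightarrow> 'a c_infty"
  is "\<lambda>\<phi> \<psi> x. \<phi> x - \<psi> x"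
  by (auto intro!: continuous_intros dest: tendsto_diff)

lift_definition scaleR_c_infty :: "real \<Rightarrow> 'a c_infty \<Rightarrow> 'a c_infty" is "\<lambda>r \<phi> x. r * \<phi> x"
  by (auto intro!: continuous_intros tendsto_mult_right_zero)

instance
  by standard (transfer; simp add: fun_eq_iff algebra_simps)+

end

instantiation c_infty :: (euclidean_space) real_normed_vector
begin

lift_definition norm_c_infty :: "'a c_infty \<Rightarrow> real" is "\<lambda>\<phi>. SUP x. \<bar>\<phi> x\<bar>" .

definition dist_c_infty :: "'a c_infty \<Rightarrow> 'a c_infty \<Rightarrow> real"
  where "dist_c_infty \<phi> \<psi> = norm (\<phi> - \<psi>)"

definition sgn_c_infty :: "'a c_infty \<Rightarrow> 'a c_infty"
  where "sgn_c_infty \<phi> = \<phi> /\<^sub>R norm \<phi>"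

definition uniformity_c_infty :: "('a c_infty \<times> 'a c_infty) filter"
  where "uniformity_c_infty = (INF e\<in>{0 <..}. principal {(\<phi>, \<psi>). dist \<phi> \<psi> < e})"

definition open_c_infty :: "'a c_infty set \<Rightarrow> bool"
  where "open_c_infty S = (\<forall>\<phi>\<in>S. \<forall>\<^sub>F (\<phi>', \<psi>) in uniformity. \<phi>' = \<phi> \<longrightarrow> \<psi> \<in> S)"

lemma abs_apply_c_infty_le_norm: "\<bar>apply_c_infty \<phi> x\<bar> \<le> norm \<phi>"
proof -
  have "bdd_above (range (\<lambda>x. \<bar>apply_c_infty \<phi> x\<bar>))"
    using bounded_apply_c_infty[of \<phi>] by (auto simp: bounded_iff bdd_above_def)
  then show ?thesis
    unfolding norm_c_infty.rep_eq by (rule cSUP_upper[rotated]) simp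
qed

lemma norm_c_infty_le: "(\<And>x. \<bar>apply_c_infty \<phi> x\<bar> \<le> b) \<Longrightarrow> norm \<phi> \<le> b"
  unfolding norm_c_infty.rep_eq by (rule cSUP_least) auto

instance
proof
  fix \<phi> \<psi> :: "'a c_infty" and r :: real
  show "norm \<phi> = 0 \<longleftrightarrow> \<phi> = 0"
  proof
    assume "norm \<phi> = 0"
    then have "apply_c_infty \<phi> x = 0" for x
      using abs_apply_c_infty_le_norm[of \<phi> x] by simp
    then show "\<phi> = 0"
      by (intro c_infty_eqI) (simp add: zero_c_infty.rep_eq)
  next
    assume "\<phi> = 0"
    then show "norm \<phi> = 0"
      by (simp add: norm_c_infty.rep_eq zero_c_infty.rep_eq)
  qed
  show "norm (\<phi> + \<psi>) \<le> norm \<phi> + norm \<psi>"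
  proof (rule norm_c_infty_le)
    fix x
    show "\<bar>apply_c_infty (\<phi> + \<psi>) x\<bar> \<le> norm \<phi> + norm \<psi>"
      using abs_apply_c_infty_le_norm[of \<phi> x] abs_apply_c_infty_le_norm[of \<psi> x]
      by (simp add: plus_c_infty.rep_eq)
  qed
  have scale_le: "norm (s *\<^sub>R \<eta>) \<le> \<bar>s\<bar> * norm \<eta>" for s and \<eta> :: "'a c_infty"
    by (rule norm_c_infty_le)
      (simp add: scaleR_c_infty.rep_eq abs_mult mult_left_mono abs_apply_c_infty_le_norm)
  show "norm (r *\<^sub>R \<phi>) = \<bar>r\<bar> * norm \<phi>"
  proof (cases "r = 0")
    case True
    then show ?thesis
      by (simp add: norm_c_infty.rep_eq scaleR_c_infty.rep_eq zero_c_infty.rep_eq)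
  next
    case False
    then have "norm \<phi> = norm (inverse r *\<^sub>R (r *\<^sub>R \<phi>))"
      by simp
    also have "\<dots> \<le> \<bar>inverse r\<bar> * norm (r *\<^sub>R \<phi>)"
      by (rule scale_le)
    finally have "\<bar>r\<bar> * norm \<phi> \<le> norm (r *\<^sub>R \<phi>)"
      using False by (simp add: field_simps)
    with scale_le[of r \<phi>] show ?thesis
      by simp
  qed
qed (rule dist_c_infty_def sgn_c_infty_def uniformity_c_infty_def open_c_infty_def)+

end

instance c_infty :: (euclidean_space) banach
proof
  fix X :: "nat \<Rightarrow> 'a c_infty"
  assume "Cauchy X"
  have Cauchy_at: "uniformly_Cauchy_on UNIV (\<lambda>n x. apply_c_infty (X n) x)"
    unfolding uniformly_Cauchy_on_def
  proof (intro allI impI)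
    fix e :: real
    assume "e > 0"
    then obtain N where N: "\<And>m n. m \<ge> N \<Longrightarrow> n \<ge> N \<Longrightarrow> norm (X m - X n) < e"
      using \<open>Cauchy X\<close> unfolding Cauchy_def dist_norm by metis
    have "dist (apply_c_infty (X m) x) (apply_c_infty (X n) x) < e"
      if "m \<ge> N" "n \<ge> N" for m n x
      using abs_apply_c_infty_le_norm[of "X m - X n" x] N[OF that]
      by (simp add: dist_real_def minus_c_infty.rep_eq)
    then show "\<exists>N. \<forall>x\<in>UNIV. \<forall>m\<ge>N. \<forall>n\<ge>N.
        dist (apply_c_infty (X m) x) (apply_c_infty (X n) x) < e"
      by blast
  qed
  then obtain g where g: "uniform_limit UNIV (\<lambda>n. apply_c_infty (X n)) g sequentially"
    using Cauchy_uniformly_convergent[OF Cauchy_at] by (auto simp: uniformly_convergent_on_def)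
  have "continuous_on UNIV g"
    by (rule uniform_limit_theorem[OF _ g]) (simp_all add: continuous_on_apply_c_infty)
  moreover have "(g \<longlongrightarrow> 0) at_infinity"
  proof (rule tendstoI)
    fix e :: real
    assume "e > 0"
    then obtain n where n: "\<And>x. dist (apply_c_infty (X n) x) (g x) < e / 2"
      using uniform_limitD[OF g, of "e / 2"] by (auto simp: eventually_sequentially)
    have "\<forall>\<^sub>F x in at_infinity. dist (apply_c_infty (X n) x) 0 < e / 2"
      using \<open>e > 0\<close> by (intro tendstoD[OF tendsto_apply_c_infty]) simp
    then show "\<forall>\<^sub>F x in at_infinity. dist (g x) 0 < e"
    proof eventually_elim
      case (elim x)
      then show ?case
        using n[of x] unfolding dist_real_def by linarith
    qed
  qed
  ultimately have g_eq: "apply_c_infty (C_infty g) = g"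
    by (simp add: C_infty_inverse)
  have "X \<longlonglongrightarrow> C_infty g"
  proof (rule metric_LIMSEQ_I)
    fix e :: real
    assume "e > 0"
    then obtain N where N: "\<And>n x. n \<ge> N \<Longrightarrow> dist (apply_c_infty (X n) x) (g x) < e / 2"
      using uniform_limitD[OF g, of "e / 2"] by (auto simp: eventually_sequentially)
    have "norm (X n - C_infty g) \<le> e / 2" if "n \<ge> N" for n
    proof (rule norm_c_infty_le)
      fix x
      show "\<bar>apply_c_infty (X n - C_infty g) x\<bar> \<le> e / 2"
        using N[OF that, of x] by (simp add: minus_c_infty.rep_eq g_eq dist_real_def)
    qed
    then have "dist (X n) (C_infty g) < e" if "n \<ge> N" for n
      using \<open>e > 0\<close> that by (fastforce simp: dist_norm)
    then show "\<exists>N. \<forall>n\<ge>N. dist (X n) (C_infty g) < e"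
      by blast
  qed
  then show "convergent X"
    by (rule convergentI)
qed


section \<open>Contraction semigroups, generators and closable operators\<close>

text \<open>
  The index type is \<open>real\<close>, but only the operators \<open>P t\<close> with \<open>t \<ge> 0\<close> are constrained. An
  unbounded operator on \<open>'b\<close> is represented by its graph, a subset of \<open>'b \<times> 'b\<close>.
\<close>

definition contraction_semigroup :: "(real \<Rightarrow> 'b::banach \<Rightarrow>\<^sub>L 'b) \<Rightarrow> bool"
  where "contraction_semigroup P \<longleftrightarrow>
    P 0 = id_blinfun \<and>
    (\<forall>s\<ge>0. \<forall>t\<ge>0. P (s + t) = P s o\<^sub>L P t) \<and>
    (\<forall>t\<ge>0. norm (P t) \<le> 1) \<and>
    (\<forall>u. ((\<lambda>t. P t u) \<longlongrightarrow> u) (at_right 0))"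

definition generator :: "(real \<Rightarrow> 'b::banach \<Rightarrow>\<^sub>L 'b) \<Rightarrow> ('b \<times> 'b) set"
  where "generator P = {(u, v). ((\<lambda>t. (P t u - u) /\<^sub>R t) \<longlongrightarrow> v) (at_right 0)}"

definition closable :: "('b::banach \<times> 'b) set \<Rightarrow> bool"
  where "closable G \<longleftrightarrow> single_valued (closure G)"


section \<open>The nonlocal operator\<close>

definition C2_c :: "('a::euclidean_space \<Rightarrow> real) set"
  where "C2_c = {\<phi>.
    (\<exists>(\<phi>' :: 'a \<Rightarrow> 'a \<Rightarrow>\<^sub>L real) (\<phi>'' :: 'a \<Rightarrow> 'a \<Rightarrow>\<^sub>L 'a \<Rightarrow>\<^sub>L real).
      (\<forall>x. (\<phi> has_derivative blinfun_apply (\<phi>' x)) (at x)) \<and>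
      (\<forall>x. (\<phi>' has_derivative blinfun_apply (\<phi>'' x)) (at x)) \<and>
      continuous_on UNIV \<phi>'') \<and>
    compact (closure {x. \<phi> x \<noteq> 0})}"

text \<open>
  The kernel takes values in \<open>[0,\<infinity>]\<close>. The conversion \<open>enn2real\<close> sends \<open>\<infinity>\<close> to \<open>0\<close>, but for
  kernels with \<open>f x y \<le> M |y - x| powr (- \<alpha> - d)\<close> off the diagonal the value \<open>\<infinity>\<close> can only
  occur at \<open>y = x\<close>, which is outside the domain of integration.
\<close>

definition nonlocal_op ::
  "('a::euclidean_space \<Rightarrow> 'a \<Rightarrow> ennreal) \<Rightarrow> ('a \<Rightarrow> real) \<Rightarrow> 'a \<Rightarrow> real"
  where "nonlocal_op f \<phi> x = Lim (at_right 0)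
    (\<lambda>\<epsilon>. LINT y:{y. norm (y - x) > \<epsilon>}|lborel. (\<phi> y - \<phi> x) * enn2real (f x y))"

definition nonlocal_graph ::
  "('a::euclidean_space \<Rightarrow> 'a \<Rightarrow> ennreal) \<Rightarrow> ('a c_infty \<times> 'a c_infty) set"
  where "nonlocal_graph f =
    {(\<phi>, \<psi>). apply_c_infty \<phi> \<in> C2_c \<and> apply_c_infty \<psi> = nonlocal_op f (apply_c_infty \<phi>)}"

end

theory Submission
  imports Defs
begin

text \<open>
  All estimates come from the maximum principle. Let \<open>A\<^sub>\<epsilon>\<close> be the bounded operator with the
  jumps shorter than \<open>\<epsilon>\<close> removed and \<open>J\<^sub>\<epsilon>\<^sub>,\<^sub>h = (1 - h A\<^sub>\<epsilon>)\<^sup>-\<^sup>1\<close>. These resolvents are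
  positive, symmetric and contract both the supremum norm and the \<open>L\<^sup>1\<close> norm, and the powers
  \<open>J\<^sub>\<epsilon>\<^sub>,\<^sub>h\<^sup>n\<close> with \<open>h = t / n\<close> converge strongly to \<open>P t\<close>, first for \<open>\<epsilon> \<rightarrow> 0\<close> and then for
  \<open>n \<rightarrow> \<infinity>\<close>.

  On the diagonal: at a maximum point of \<open>v\<close> the generator is at most
  \<open>M r\<^sup>-\<^sup>\<alpha>\<^sup>-\<^sup>d \<parallel>v\<parallel>\<^sub>1 - a r\<^sup>-\<^sup>\<alpha> sup v\<close> for every \<open>r\<close>, which forces
  \<open>sup P t u \<le> C t\<^sup>-\<^sup>d\<^sup>/\<^sup>\<alpha> \<parallel>u\<parallel>\<^sub>1\<close>. Off the diagonal: if \<open>0 \<le> g \<le> S\<close> vanishes on the ball of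
  radius \<open>r\<close> about \<open>x\<close>, jumps longer than \<open>\<rho> = r / K\<close> raise \<open>P t g\<close> at rate at most
  \<open>M \<rho>\<^sup>-\<^sup>\<alpha>\<^sup>-\<^sup>d \<parallel>g\<parallel>\<^sub>1\<close>, while a sum of hyperbolic cosines is a barrier for the shorter jumps.
  The semigroup property and symmetry combine both bounds into
  \<open>P t \<phi> x \<le> C t R\<^sup>-\<^sup>\<alpha>\<^sup>-\<^sup>d \<parallel>\<phi>\<parallel>\<^sub>1\<close> for \<open>\<phi> \<ge> 0\<close> vanishing on the ball of radius \<open>R\<close> about
  \<open>x\<close>, and the density of \<open>\<phi> \<mapsto> P t \<phi> x\<close> is a Radon-Nikodym derivative.
\<close>


section \<open>Radial integrals\<close>

text \<open>A maximum principle needs an attained maximum and a generator that is an integral there.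
  Elements of the domain of the closure need not admit such a formula, so every estimate is made for
  an implicit Euler step \<open>v - h *\<^sub>R Gen k v = u\<close> with a bounded jump operator:
  the formula then holds at the new function \<open>v\<close>. The resulting bounds do not contain
  \<epsilon> and contain h only through the elapsed time n h, so they survive the double limit. The
  far estimate for one time interval contains both the L1 norm and the supremum norm of the initial
  function. Only after half of the time has elapsed does the diagonal estimate turn the supremum
  into t^(-d/\<alpha>) times the L1 norm. This is why the off-diagonal bound takes two half steps,
  and why symmetry enters: the part of the intermediate function that lies near x is out of reach of
  the far estimate until the semigroup is moved to the other factor. All constants are explicit
  expressions in d, \<alpha>, M and a, which makes C independent of f and P.\<close>

definition radial_const :: "'a::euclidean_space itself \<Rightarrow> real \<Rightarrow> real"
  where "radial_const _ \<beta> = unit_ball_vol (real DIM('a)) * 2 ^ DIM('a) / (1 - 2 powr (- \<beta>))"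

lemma radial_const_pos: "\<beta> > 0 \<Longrightarrow> radial_const TYPE('a::euclidean_space) \<beta> > 0"
  by (simp add: radial_const_def powr_less_one)

text \<open>The function is dominated by the sum over j of \<open>c j\<close> times the indicator of
  the ball of radius \<open>R j\<close>; by \<open>scale\<close> the integrals of these terms form a
  geometric series with ratio \<open>2 powr - \<beta>\<close>. The factor 2^d in
  \<open>radial_const\<close> is the price for evaluating the singular factor at the inner radius of
  a dyadic shell while integrating over the outer ball.\<close>

lemma shell_sum_le:
  fixes g :: "'a::euclidean_space \<Rightarrow> real" and x :: 'a and \<beta> s :: real
  assumes "\<beta> > 0" and [measurable]: "g \<in> borel_measurable borel"
    and R: "\<And>j. R j > 0"
    and scale: "\<And>j. c j * R j ^ DIM('a) = 2 ^ DIM('a) * s * (2 powr - \<beta>) ^ j"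
    and c: "\<And>j. c j \<ge> 0" and "s \<ge> 0"
    and g: "\<And>y. g y > 0 \<Longrightarrow> \<exists>j::nat. norm (y - x) \<le> R j \<and> g y \<le> c j"
  shows "(\<integral>\<^sup>+ y. ennreal (g y) \<partial>lborel) \<le> ennreal (radial_const TYPE('a) \<beta> * s)"
proof -
  have cb: "cball x (R j) \<in> sets borel" for j
    by simp
  have "ennreal (g y) \<le> (\<Sum>j. ennreal (c j) * indicator (cball x (R j)) y)" for y
  proof (cases "g y > 0")
    case True
    then obtain j where j: "norm (y - x) \<le> R j" "g y \<le> c j"
      using g by blast
    then have "ennreal (g y) \<le> ennreal (c j) * indicator (cball x (R j)) y"
      by (simp add: indicator_def dist_norm norm_minus_commute ennreal_leI)
    also have "\<dots> = (\<Sum>i\<in>{j}. ennreal (c i) * indicator (cball x (R i)) y)"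
      by (subst sum.insert) (simp_all del: mult_eq_0_iff)
    also have "\<dots> \<le> (\<Sum>i. ennreal (c i) * indicator (cball x (R i)) y)"
      by (intro sum_le_suminf) auto
    finally show ?thesis .
  qed (simp add: ennreal_neg)
  then have "(\<integral>\<^sup>+ y. ennreal (g y) \<partial>lborel) \<le> (\<integral>\<^sup>+ y. (\<Sum>j. ennreal (c j) * indicator (cball x (R j)) y) \<partial>lborel)"
    by (intro nn_integral_mono) auto
  also have "\<dots> = (\<Sum>j. \<integral>\<^sup>+ y. ennreal (c j) * indicator (cball x (R j)) y \<partial>lborel)"
    by (intro nn_integral_suminf) (use cb in measurable)
  also have "\<dots> = (\<Sum>j. ennreal (unit_ball_vol (real DIM('a)) * (2 ^ DIM('a) * s) * (2 powr - \<beta>) ^ j))"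
  proof (intro suminf_cong)
    fix j
    have "(\<integral>\<^sup>+ y. ennreal (c j) * indicator (cball x (R j)) y \<partial>lborel)
        = ennreal (c j) * ennreal (unit_ball_vol (real DIM('a)) * R j ^ DIM('a))"
      using R[of j] by (subst nn_integral_cmult_indicator) (auto simp: emeasure_cball less_imp_le)
    also have "\<dots> = ennreal (unit_ball_vol (real DIM('a)) * (c j * R j ^ DIM('a)))"
      using c[of j] R[of j] by (subst ennreal_mult'[symmetric]) (auto simp: mult_ac)
    finally show "(\<integral>\<^sup>+ y. ennreal (c j) * indicator (cball x (R j)) y \<partial>lborel) =
       ennreal (unit_ball_vol (real DIM('a)) * (2 ^ DIM('a) * s) * (2 powr - \<beta>) ^ j)"
      by (simp only: scale mult.assoc)
  qed
  also have "\<dots> = ennreal (\<Sum>j. unit_ball_vol (real DIM('a)) * (2 ^ DIM('a) * s) * (2 powr - \<beta>) ^ j)"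
    using assms(1) \<open>s \<ge> 0\<close>
    by (intro suminf_ennreal2 summable_mult summable_geometric) (auto simp: powr_less_one)
  also have "(\<Sum>j. unit_ball_vol (real DIM('a)) * (2 ^ DIM('a) * s) * (2 powr - \<beta>) ^ j)
      = radial_const TYPE('a) \<beta> * s"
    using assms(1)
    by (subst suminf_mult, intro summable_geometric)
      (auto simp: powr_less_one suminf_geometric radial_const_def)
  finally show ?thesis .
qed

lemma power_powr_swap: "((2::real) ^ j) powr \<beta> = (2 powr \<beta>) ^ j"
  by (simp add: powr_power powr_powr mult.commute flip: powr_realpow)

lemma nn_integral_tail_le:
  fixes x :: "'a::euclidean_space" and \<beta> r :: real
  assumes "\<beta> > 0" "r > 0"
  shows "(\<integral>\<^sup>+ y. ennreal (indicator {y. norm (y - x) > r} y * norm (y - x) powr (- \<beta> - DIM('a))) \<partial>lborel)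
      \<le> ennreal (radial_const TYPE('a) \<beta> * r powr (- \<beta>))"
proof (rule shell_sum_le[OF assms(1), where R="\<lambda>j. 2 ^ Suc j * r" and c="\<lambda>j. (2 ^ j * r) powr (- \<beta> - DIM('a))"])
  fix j
  have "(2 ^ j * r) powr (- \<beta> - DIM('a)) * (2 ^ Suc j * r) ^ DIM('a)
     = (2 ^ j * r) powr (- \<beta> - DIM('a)) * (2 ^ j * r) powr DIM('a) * 2 ^ DIM('a)"
    using assms by (simp add: powr_realpow power_mult_distrib)
  also have "(2 ^ j * r) powr (- \<beta> - DIM('a)) * (2 ^ j * r) powr DIM('a) = (2 ^ j * r) powr (- \<beta>)"
    by (subst powr_add[symmetric]) simp
  also have "\<dots> = (2 powr (- \<beta>)) ^ j * r powr (- \<beta>)"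
    using assms by (simp add: powr_mult power_powr_swap)
  finally show "(2 ^ j * r) powr (- \<beta> - DIM('a)) * (2 ^ Suc j * r) ^ DIM('a) =
      2 ^ DIM('a) * r powr - \<beta> * (2 powr - \<beta>) ^ j" by (simp add: mult_ac)
next
  fix y
  assume "0 < indicator {y. norm (y - x) > r} y * norm (y - x) powr (- \<beta> - DIM('a))"
  then have *: "norm (y - x) > r" by (cases "norm (y - x) > r") auto
  define P where "P j \<longleftrightarrow> norm (y - x) \<le> 2 ^ Suc j * r" for j
  obtain n :: nat where "norm (y - x) / r < 2 ^ n"
    using real_arch_pow[of 2] by auto
  then have "norm (y - x) \<le> 2 ^ n * r"
    using assms by (simp add: field_simps)
  also have "\<dots> \<le> 2 ^ Suc n * r"
    using assms by simp
  finally have Pn: "P n" unfolding P_def .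
  \<comment> \<open>The least index identifies the dyadic shell: minimality supplies the lower bound
    on the distance.\<close>
  define j where "j = (LEAST j. P j)"
  have "P j" unfolding j_def using Pn by (rule LeastI[of P])
  moreover have "2 ^ j * r \<le> norm (y - x)"
  proof (cases j)
    case (Suc i)
    then have "\<not> P i" unfolding j_def by (metis lessI not_less_Least)
    then show ?thesis using Suc by (simp add: P_def)
  qed (use * in simp)
  ultimately show "\<exists>j. norm (y - x) \<le> 2 ^ Suc j * r \<and>
      indicator {y. norm (y - x) > r} y * norm (y - x) powr (- \<beta> - DIM('a)) \<le> (2 ^ j * r) powr (- \<beta> - DIM('a))"
    using assms * unfolding P_def
    by (intro exI[of _ j]) (auto simp: intro!: powr_mono2')
qed (use assms in auto)

lemma nn_integral_center_le:
  fixes x :: "'a::euclidean_space" and \<beta> r :: real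
  assumes "\<beta> > 0" "r > 0"
  shows "(\<integral>\<^sup>+ y. ennreal (indicator {y. norm (y - x) \<le> r} y * norm (y - x) powr (\<beta> - DIM('a))) \<partial>lborel)
      \<le> ennreal (radial_const TYPE('a) \<beta> * r powr \<beta>)"
proof (rule shell_sum_le[OF assms(1), where R="\<lambda>j. r / 2 ^ j"
      and c="\<lambda>j. (r / 2 ^ Suc j) powr (- real DIM('a)) * (r / 2 ^ j) powr \<beta>"])
  fix j
  have "(r / 2 ^ Suc j) powr (- real DIM('a)) * (r / 2 ^ j) ^ DIM('a)
     = (r / 2 ^ Suc j) powr (- real DIM('a)) * (r / 2 ^ Suc j) powr DIM('a) * 2 ^ DIM('a)"
    using assms by (simp add: powr_realpow power_mult_distrib power_divide)
  also have "\<dots> = 2 ^ DIM('a)"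
    using assms by (subst powr_add[symmetric]) simp
  finally have 1: "(r / 2 ^ Suc j) powr (- real DIM('a)) * (r / 2 ^ j) ^ DIM('a) = 2 ^ DIM('a)" .
  have 2: "(r / 2 ^ j) powr \<beta> = r powr \<beta> * (2 powr (- \<beta>)) ^ j"
    using assms by (simp add: powr_divide power_powr_swap powr_minus power_inverse field_simps)
  show "(r / 2 ^ Suc j) powr (- real DIM('a)) * (r / 2 ^ j) powr \<beta> * (r / 2 ^ j) ^ DIM('a)
     = 2 ^ DIM('a) * r powr \<beta> * (2 powr - \<beta>) ^ j"
    by (simp only: 2 1[symmetric] ac_simps)
next
  fix y
  assume "0 < indicator {y. norm (y - x) \<le> r} y * norm (y - x) powr (\<beta> - DIM('a))"
  \<comment> \<open>At y = x the integrand is 0, since \<open>0 powr z = 0\<close> for every z, so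
    positivity excludes the centre.\<close>
  then have *: "norm (y - x) \<le> r" "norm (y - x) > 0"
    by (cases "norm (y - x) \<le> r"; cases "y = x"; simp)+
  define P where "P j \<longleftrightarrow> r / 2 ^ Suc j \<le> norm (y - x)" for j
  obtain n :: nat where "r / norm (y - x) < 2 ^ n"
    using real_arch_pow[of 2] by auto
  then have "r / 2 ^ n \<le> norm (y - x)"
    using * by (simp add: field_simps)
  moreover have "r / 2 ^ Suc n \<le> r / 2 ^ n"
    using assms by (simp add: field_simps)
  ultimately have Pn: "P n" unfolding P_def by linarith
  define j where "j = (LEAST j. P j)"
  have Pj: "P j" unfolding j_def using Pn by (rule LeastI[of P])
  have le: "norm (y - x) \<le> r / 2 ^ j"
  proof (cases j)
    case (Suc i)
    then have "\<not> P i" unfolding j_def by (metis lessI not_less_Least)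
    then show ?thesis using Suc by (simp add: P_def)
  qed (use * in simp)
  \<comment> \<open>The exponent \<beta> - d may have either sign. The factor with exponent -d is
    bounded at the inner radius of the shell, the factor with exponent \<beta> at the outer
    one.\<close>
  have "norm (y - x) powr (\<beta> - DIM('a)) = norm (y - x) powr (- real DIM('a)) * norm (y - x) powr \<beta>"
    by (simp add: powr_add[symmetric])
  also have "\<dots> \<le> (r / 2 ^ Suc j) powr (- real DIM('a)) * (r / 2 ^ j) powr \<beta>"
    using Pj le * assms unfolding P_def by (intro mult_mono powr_mono2' powr_mono2) auto
  finally show "\<exists>j. norm (y - x) \<le> r / 2 ^ j \<and>
      indicator {y. norm (y - x) \<le> r} y * norm (y - x) powr (\<beta> - DIM('a)) \<le> (r / 2 ^ Suc j) powr (- real DIM('a)) * (r / 2 ^ j) powr \<beta>"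
    using le * by (intro exI[of _ j]) auto
qed (use assms in auto)


section \<open>Bounded jump operators\<close>

lemma lborel_translate:
  fixes f :: "'a::euclidean_space \<Rightarrow> real"
  assumes [measurable]: "f \<in> borel_measurable borel"
  shows "(LINT y|lborel. f y) = (LINT h|lborel. f (x + h))"
proof -
  have "(LINT y|lborel. f y) = (LINT y|distr lborel borel ((+) x). f y)"
    by (simp add: lborel_distr_plus)
  also have "\<dots> = (LINT h|lborel. f (x + h))"
    by (subst integral_distr) auto
  finally show ?thesis .
qed

lemma lborel_distr_reflect: "distr lborel borel (\<lambda>h::'a::euclidean_space. - h) = lborel"
  using lborel_affine[of "-1" "0::'a"] by (simp add: density_1)

lemma lborel_reflect:
  fixes f :: "'a::euclidean_space \<Rightarrow> real"
  assumes [measurable]: "f \<in> borel_measurable borel"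
  shows "(LINT h|lborel. f (- h)) = (LINT h|lborel. f h)"
proof -
  have "(LINT h|lborel. f h) = (LINT h|distr lborel borel (\<lambda>h::'a. - h). f h)"
    by (simp add: lborel_distr_reflect)
  also have "\<dots> = (LINT h|lborel. f (- h))"
    by (subst integral_distr) auto
  finally show ?thesis ..
qed

text \<open>Complements of balls with integer radii form a countable base at infinity, so sequences
  decide the limit; dominated convergence can then be applied along each of them.\<close>

lemma tendsto_at_infinityI_seq:
  fixes F :: "'a::real_normed_vector \<Rightarrow> 'b::metric_space"
  assumes "\<And>X. filterlim X at_infinity sequentially \<Longrightarrow> (\<lambda>n. F (X n)) \<longlonglongrightarrow> l"
  shows "(F \<longlongrightarrow> l) at_infinity"
proof (rule ccontr)
  assume "\<not> ?thesis"
  then obtain e where "e > 0" and e: "\<And>b. \<exists>x. norm x \<ge> b \<and> dist (F x) l \<ge> e"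
    by (auto simp: tendsto_iff eventually_at_infinity not_less)
  then obtain X where X: "\<And>n::nat. norm (X n) \<ge> real n" "\<And>n. dist (F (X n)) l \<ge> e"
    using choice[of "\<lambda>n x. norm x \<ge> real n \<and> dist (F x) l \<ge> e"] by blast
  have "filterlim (\<lambda>n. norm (X n)) at_top sequentially"
    using X(1) by (intro filterlim_at_top_mono[OF filterlim_real_sequentially]) auto
  then have "filterlim X at_infinity sequentially"
    by (simp add: filterlim_at_infinity_conv_norm_at_top)
  from assms[OF this] have "eventually (\<lambda>n. dist (F (X n)) l < e) sequentially"
    using \<open>e > 0\<close> by (simp add: tendsto_iff)
  with X(2) show False
    by (auto simp: eventually_sequentially not_less[symmetric])
qed

lemma measurable_apply_c_infty [measurable]: "apply_c_infty v \<in> borel_measurable borel"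
  by (simp add: borel_measurable_continuous_onI continuous_on_apply_c_infty)

lemma apply_c_infty_C_infty:
  "continuous_on UNIV \<phi> \<Longrightarrow> (\<phi> \<longlongrightarrow> 0) at_infinity \<Longrightarrow> apply_c_infty (C_infty \<phi>) = \<phi>"
  by (simp add: C_infty_inverse)

text \<open>A positive superlevel set of z is contained in one of v, which is bounded because v
  vanishes at infinity. Only an upper bound of z by v is asked for, so z may tend to minus infinity,
  as it may after subtraction of a growing barrier.\<close>

lemma pos_max_attained:
  assumes "continuous_on UNIV z" and le: "\<And>x. z x \<le> apply_c_infty v x" and pos: "z x1 > 0"
  obtains x0 where "z x0 > 0" "\<And>y. z y \<le> z x0"
proof -
  define S where "S = {x. z x \<ge> z x1}"
  have "eventually (\<lambda>x. dist (apply_c_infty v x) 0 < z x1) at_infinity"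
    by (rule tendstoD[OF tendsto_apply_c_infty pos])
  then obtain b where b: "\<And>x. norm x \<ge> b \<Longrightarrow> apply_c_infty v x < z x1"
    unfolding eventually_at_infinity dist_real_def by fastforce
  have "norm x \<le> b" if "x \<in> S" for x
    using b[of x] le[of x] that unfolding S_def by force
  then have "bounded S" by (auto simp: bounded_iff)
  moreover have "closed S"
    unfolding S_def using assms(1) by (intro closed_Collect_le) auto
  ultimately have "compact S" by (simp add: compact_eq_bounded_closed)
  moreover have "x1 \<in> S" by (simp add: S_def)
  ultimately obtain x0 where x0: "x0 \<in> S" "\<And>y. y \<in> S \<Longrightarrow> z y \<le> z x0"
    using continuous_attains_sup[of S z] assms(1) continuous_on_subset by blast
  then have "z x1 \<le> z x0" by (simp add: S_def)
  have "z y \<le> z x0" for y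
    using x0(2)[of y] \<open>z x1 \<le> z x0\<close> unfolding S_def by force
  moreover have "z x0 > 0" using x0(1) pos by (simp add: S_def)
  ultimately show ?thesis using that by blast
qed

definition gen :: "('a::euclidean_space \<Rightarrow> 'a \<Rightarrow> real) \<Rightarrow> ('a \<Rightarrow> real) \<Rightarrow> 'a \<Rightarrow> real"
  where "gen k v x = (LINT y|lborel. (v y - v x) * k x y)"

text \<open>\<open>C_infty\<close> is meaningful only on continuous functions vanishing at infinity;
  that \<open>gen k\<close> produces such functions is the content of
  \<open>apply_Gen\<close>.\<close>

definition Gen :: "('a::euclidean_space \<Rightarrow> 'a \<Rightarrow> real) \<Rightarrow> 'a c_infty \<Rightarrow> 'a c_infty"
  where "Gen k v = C_infty (gen k (apply_c_infty v))"

text \<open>The bound \<open>k_le\<close> does not involve \<epsilon> and carries the final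
  estimates; \<open>k_near\<close> makes the jump rate finite. Continuity in x is asked for almost
  every y only, because truncation is discontinuous where |y - x| = \<epsilon>.\<close>

locale jump_kernel =
  fixes k :: "'a::euclidean_space \<Rightarrow> 'a \<Rightarrow> real" and \<alpha> M \<epsilon> :: real
  assumes alpha: "0 < \<alpha>" "\<alpha> < 2" and M: "M > 0" and eps: "\<epsilon> > 0"
    and k_measurable: "(\<lambda>(x, y). k x y) \<in> borel_measurable (borel \<Otimes>\<^sub>M borel)"
    and k_nonneg: "k x y \<ge> 0"
    and k_sym: "k x y = k y x"
    and k_le: "k x y \<le> M * norm (y - x) powr (- \<alpha> - DIM('a))"
    and k_near: "norm (y - x) \<le> \<epsilon> \<Longrightarrow> k x y = 0"
    and k_cont: "AE y in lborel. isCont (\<lambda>x. k x y) x"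
begin

lemma k_measurable2 [measurable (raw)]:
  assumes [measurable]: "g \<in> borel_measurable N" "h \<in> borel_measurable N"
  shows "(\<lambda>z. k (g z) (h z)) \<in> borel_measurable N"
proof -
  have "(\<lambda>z. (\<lambda>(x, y). k x y) (g z, h z)) \<in> borel_measurable N"
    by (rule measurable_compose[OF _ k_measurable]) measurable
  then show ?thesis by simp
qed

definition total_rate :: real
  where "total_rate = M * (radial_const TYPE('a) \<alpha> * \<epsilon> powr (- \<alpha>))"

lemma total_rate_nonneg: "total_rate \<ge> 0"
  using M radial_const_pos[OF alpha(1), where 'a='a] by (simp add: total_rate_def)

lemma k_le_indicator:
  "k x y \<le> M * (indicator {y. norm (y - x) > \<epsilon>} y * norm (y - x) powr (- \<alpha> - DIM('a)))"
  using k_le[of x y] k_near[of y x] by (cases "norm (y - x) \<le> \<epsilon>") auto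

lemma nn_integral_k_le: "(\<integral>\<^sup>+ y. ennreal (k x y) \<partial>lborel) \<le> ennreal total_rate"
proof -
  have "(\<integral>\<^sup>+ y. ennreal (k x y) \<partial>lborel)
      \<le> (\<integral>\<^sup>+ y. ennreal M * ennreal (indicator {y. norm (y - x) > \<epsilon>} y * norm (y - x) powr (- \<alpha> - DIM('a))) \<partial>lborel)"
    using M k_le_indicator
    by (intro nn_integral_mono) (simp add: ennreal_mult'[symmetric] ennreal_leI del: of_bool_eq_0_iff)
  also have "\<dots> = ennreal M * (\<integral>\<^sup>+ y. ennreal (indicator {y. norm (y - x) > \<epsilon>} y * norm (y - x) powr (- \<alpha> - DIM('a))) \<partial>lborel)"
    by (rule nn_integral_cmult) measurable
  also have "\<dots> \<le> ennreal M * ennreal (radial_const TYPE('a) \<alpha> * \<epsilon> powr (- \<alpha>))"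
    using alpha eps by (intro mult_left_mono nn_integral_tail_le) auto
  finally show ?thesis
    using M by (simp add: total_rate_def ennreal_mult'[symmetric])
qed

lemma integrable_k: "integrable lborel (k x)"
  using nn_integral_k_le[of x] k_nonneg
  by (intro integrableI_bounded) (auto simp: less_top[symmetric] top_unique)

lemma integrable_bounded_k:
  assumes [measurable]: "F \<in> borel_measurable borel" and F: "\<And>y. \<bar>F y\<bar> \<le> B"
  shows "integrable lborel (\<lambda>y. F y * k x y)"
proof (rule Bochner_Integration.integrable_bound[OF integrable_mult_right[OF integrable_k, of B]])
  show "AE y in lborel. norm (F y * k x y) \<le> norm (B * k x y)"
    using F k_nonneg abs_ge_self[of B] order_trans
    by (intro AE_I2) (fastforce simp: abs_mult intro!: mult_right_mono)
qed measurable

text \<open>Dominated convergence along a sequence \<open>X n\<close> tending to x. Truncation keeps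
  y farther than \<epsilon> from \<open>X n\<close>, hence farther than \<epsilon>/2 from x once |X
  n - x| < \<epsilon>/2. On that region |y - X n| is at least |y - x|/2, which gives a common
  integrable majorant.\<close>

lemma gen_continuous: "continuous_on UNIV (gen k (apply_c_infty v))"
proof -
  have "gen k (apply_c_infty v) \<midarrow>x\<rightarrow> gen k (apply_c_infty v) x" for x
    unfolding tendsto_at_iff_sequentially comp_def
  proof (intro allI impI)
    fix X :: "nat \<Rightarrow> 'a"
    assume X: "X \<longlonglongrightarrow> x"
    then have "eventually (\<lambda>n. dist (X n) x < \<epsilon> / 2) sequentially"
      using eps by (intro tendstoD) auto
    then obtain N where N: "\<And>n. n \<ge> N \<Longrightarrow> norm (X n - x) < \<epsilon> / 2"
      by (auto simp: eventually_sequentially dist_norm)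
    define w where "w y = indicator {y. norm (y - x) > \<epsilon> / 2} y * norm (y - x) powr (- \<alpha> - DIM('a))" for y
    have "(\<lambda>n. gen k (apply_c_infty v) (X (n + N))) \<longlonglongrightarrow> gen k (apply_c_infty v) x"
      unfolding gen_def
    proof (rule integral_dominated_convergence[where w="\<lambda>y. (2 * norm v * M * 2 powr (\<alpha> + DIM('a))) * w y"])
      have "(\<integral>\<^sup>+ y. ennreal (w y) \<partial>lborel) < \<infinity>"
        using nn_integral_tail_le[OF alpha(1), of "\<epsilon> / 2" x] eps unfolding w_def
        by (auto simp: less_top[symmetric] top_unique)
      moreover have [measurable]: "w \<in> borel_measurable borel"
        unfolding w_def by measurable
      ultimately have "integrable lborel w"
        by (intro integrableI_bounded) (auto simp: w_def)
      then show "integrable lborel (\<lambda>y. (2 * norm v * M * 2 powr (\<alpha> + DIM('a))) * w y)"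
        by simp
    next
      show "AE y in lborel. (\<lambda>n. (apply_c_infty v y - apply_c_infty v (X (n + N))) * k (X (n + N)) y)
         \<longlonglongrightarrow> (apply_c_infty v y - apply_c_infty v x) * k x y"
        using k_cont[of x]
      proof eventually_elim
        case (elim y)
        have XN: "(\<lambda>n. X (n + N)) \<longlonglongrightarrow> x"
          using X by (rule LIMSEQ_ignore_initial_segment)
        have "isCont (apply_c_infty v) x"
          using continuous_on_apply_c_infty[of UNIV v] by (simp add: continuous_on_eq_continuous_at)
        from isCont_tendsto_compose[OF this XN] isCont_tendsto_compose[OF elim XN]
        show ?case by (intro tendsto_intros)
      qed
    next
      fix n
      show "AE y in lborel. norm ((apply_c_infty v y - apply_c_infty v (X (n + N))) * k (X (n + N)) y)
        \<le> (2 * norm v * M * 2 powr (\<alpha> + DIM('a))) * w y"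
      proof (rule AE_I2)
        fix y
        have "k (X (n + N)) y \<le> M * 2 powr (\<alpha> + DIM('a)) * w y"
        proof (cases "norm (y - X (n + N)) \<le> \<epsilon>")
          case True
          then show ?thesis using k_near M by (simp add: w_def)
        next
          case False
          have "norm (y - x) \<le> norm (y - X (n + N)) + norm (X (n + N) - x)"
            using norm_triangle_ineq[of "y - X (n + N)" "X (n + N) - x"] by simp
          moreover have "norm (y - X (n + N)) \<le> norm (y - x) + norm (X (n + N) - x)"
            using norm_triangle_ineq4[of "y - x" "X (n + N) - x"] by simp
          ultimately have *: "norm (y - x) / 2 \<le> norm (y - X (n + N))" "norm (y - x) > \<epsilon> / 2"
            using N[of "n + N"] False by simp_all
          then have "norm (y - X (n + N)) powr (- \<alpha> - DIM('a)) \<le> (norm (y - x) / 2) powr (- \<alpha> - DIM('a))"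
            using alpha eps by (intro powr_mono2') auto
          also have "\<dots> = norm (y - x) powr (- \<alpha> - DIM('a)) * 2 powr (\<alpha> + DIM('a))"
            by (simp add: powr_divide powr_diff powr_add powr_minus field_simps)
          finally have "M * norm (y - X (n + N)) powr (- \<alpha> - DIM('a)) \<le> M * 2 powr (\<alpha> + DIM('a)) * w y"
            using * M by (simp add: w_def mult_ac)
          then show ?thesis using k_le[of "X (n + N)" y] by linarith
        qed
        moreover have "\<bar>apply_c_infty v y - apply_c_infty v (X (n + N))\<bar> \<le> 2 * norm v"
          using abs_apply_c_infty_le_norm[of v y] abs_apply_c_infty_le_norm[of v "X (n + N)"] by linarith
        ultimately have "\<bar>apply_c_infty v y - apply_c_infty v (X (n + N))\<bar> * k (X (n + N)) y
            \<le> (2 * norm v) * (M * 2 powr (\<alpha> + DIM('a)) * w y)"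
          using k_nonneg by (intro mult_mono) auto
        then show "norm ((apply_c_infty v y - apply_c_infty v (X (n + N))) * k (X (n + N)) y)
          \<le> (2 * norm v * M * 2 powr (\<alpha> + DIM('a))) * w y"
          using k_nonneg by (simp add: abs_mult mult_ac)
      qed
    qed measurable
    then show "(\<lambda>n. gen k (apply_c_infty v) (X n)) \<longlonglongrightarrow> gen k (apply_c_infty v) x"
      by (rule LIMSEQ_offset)
  qed
  then show ?thesis
    by (simp add: continuous_on_eq_continuous_at isCont_def)
qed

text \<open>In the variable h = y - x the kernel has an integrable majorant independent of x. The
  kernel itself need not converge as x tends to infinity; it is enough that the increments of v tend
  to 0 for each h.\<close>

lemma gen_tendsto_0: "(gen k (apply_c_infty v) \<longlongrightarrow> 0) at_infinity"
proof (rule tendsto_at_infinityI_seq)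
  fix X :: "nat \<Rightarrow> 'a"
  assume X: "filterlim X at_infinity sequentially"
  define w where "w h = indicator {h. norm (h - 0) > \<epsilon>} h * norm (h - 0 :: 'a) powr (- \<alpha> - DIM('a))" for h
  have w_nonneg: "w h \<ge> 0" for h by (simp add: w_def)
  have k_w: "k x (x + h) \<le> M * w h" for x h
    using k_le_indicator[of x "x + h"] by (simp add: w_def indicator_def)
  have "(\<lambda>n. LINT h|lborel. (apply_c_infty v (X n + h) - apply_c_infty v (X n)) * k (X n) (X n + h))
      \<longlonglongrightarrow> (LINT h::'a|lborel. (0::real))"
  proof (rule integral_dominated_convergence[where w="\<lambda>h. (2 * norm v * M) * w h"])
    have "(\<integral>\<^sup>+ y. ennreal (w y) \<partial>lborel) < \<infinity>"
      using nn_integral_tail_le[OF alpha(1) eps, of "0 :: 'a"] unfolding w_def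
      by (auto simp: less_top[symmetric] top_unique)
    moreover have [measurable]: "w \<in> borel_measurable borel"
      unfolding w_def by measurable
    ultimately have "integrable lborel w"
      by (intro integrableI_bounded) (auto simp: w_def)
    then show "integrable lborel (\<lambda>y. (2 * norm v * M) * w y)"
      by simp
  next
    show "AE h in lborel. (\<lambda>n. (apply_c_infty v (X n + h) - apply_c_infty v (X n)) * k (X n) (X n + h)) \<longlonglongrightarrow> 0"
    proof (rule AE_I2)
      fix h
      have 1: "(\<lambda>n. apply_c_infty v (X n)) \<longlonglongrightarrow> 0"
        by (rule filterlim_compose[OF tendsto_apply_c_infty X])
      have "filterlim (\<lambda>n. X n + h) at_infinity sequentially"
        using tendsto_add_filterlim_at_infinity[OF tendsto_const[of h] X] by (simp add: add.commute)
      then have 2: "(\<lambda>n. apply_c_infty v (X n + h)) \<longlonglongrightarrow> 0"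
        by (rule filterlim_compose[OF tendsto_apply_c_infty])
      have "(\<lambda>n. (\<bar>apply_c_infty v (X n + h)\<bar> + \<bar>apply_c_infty v (X n)\<bar>) * (M * w h)) \<longlonglongrightarrow> (\<bar>0\<bar> + \<bar>0\<bar>) * (M * w h)"
        by (intro tendsto_intros 1 2)
      then have 3: "(\<lambda>n. (\<bar>apply_c_infty v (X n + h)\<bar> + \<bar>apply_c_infty v (X n)\<bar>) * (M * w h)) \<longlonglongrightarrow> 0"
        by simp
      show "(\<lambda>n. (apply_c_infty v (X n + h) - apply_c_infty v (X n)) * k (X n) (X n + h)) \<longlonglongrightarrow> 0"
      proof (rule tendsto_0_le[OF 3, where K=1], rule always_eventually, rule allI)
        fix n
        have "\<bar>apply_c_infty v (X n + h) - apply_c_infty v (X n)\<bar> * k (X n) (X n + h)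
          \<le> (\<bar>apply_c_infty v (X n + h)\<bar> + \<bar>apply_c_infty v (X n)\<bar>) * (M * w h)"
          using k_nonneg k_w by (intro mult_mono) auto
        then show "norm ((apply_c_infty v (X n + h) - apply_c_infty v (X n)) * k (X n) (X n + h))
           \<le> norm ((\<bar>apply_c_infty v (X n + h)\<bar> + \<bar>apply_c_infty v (X n)\<bar>) * (M * w h)) * 1"
          using k_nonneg M by (simp add: abs_mult w_nonneg)
      qed
    qed
  next
    fix n
    show "AE h in lborel. norm ((apply_c_infty v (X n + h) - apply_c_infty v (X n)) * k (X n) (X n + h)) \<le> (2 * norm v * M) * w h"
    proof (rule AE_I2)
      fix h
      have "\<bar>apply_c_infty v (X n + h) - apply_c_infty v (X n)\<bar> \<le> 2 * norm v"
        using abs_apply_c_infty_le_norm[of v "X n + h"] abs_apply_c_infty_le_norm[of v "X n"] by linarith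
      then have "\<bar>apply_c_infty v (X n + h) - apply_c_infty v (X n)\<bar> * k (X n) (X n + h) \<le> (2 * norm v) * (M * w h)"
        using k_nonneg k_w by (intro mult_mono) auto
      then show "norm ((apply_c_infty v (X n + h) - apply_c_infty v (X n)) * k (X n) (X n + h)) \<le> (2 * norm v * M) * w h"
        using k_nonneg by (simp add: abs_mult mult_ac)
    qed
  qed measurable
  moreover have "gen k (apply_c_infty v) (X n)
      = (LINT h|lborel. (apply_c_infty v (X n + h) - apply_c_infty v (X n)) * k (X n) (X n + h))" for n
    unfolding gen_def by (rule lborel_translate) measurable
  ultimately show "(\<lambda>n. gen k (apply_c_infty v) (X n)) \<longlonglongrightarrow> 0"
    by simp
qed

lemma apply_Gen: "apply_c_infty (Gen k v) = gen k (apply_c_infty v)"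
  unfolding Gen_def by (intro apply_c_infty_C_infty gen_continuous gen_tendsto_0)

lemma integrable_gen: "integrable lborel (\<lambda>y. (apply_c_infty v y - apply_c_infty v x) * k x y)"
proof (rule integrable_bounded_k[where B="2 * norm v"])
  show "\<bar>apply_c_infty v y - apply_c_infty v x\<bar> \<le> 2 * norm v" for y
    using abs_apply_c_infty_le_norm[of v y] abs_apply_c_infty_le_norm[of v x] by linarith
qed measurable

lemma Gen_diff: "Gen k (v - w) = Gen k v - Gen k w"
proof (rule c_infty_eqI)
  fix x
  have "gen k (apply_c_infty (v - w)) x = (LINT y|lborel. (apply_c_infty v y - apply_c_infty v x) * k x y
      - (apply_c_infty w y - apply_c_infty w x) * k x y)"
    unfolding gen_def by (intro Bochner_Integration.integral_cong) (auto simp: minus_c_infty.rep_eq algebra_simps)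
  also have "\<dots> = gen k (apply_c_infty v) x - gen k (apply_c_infty w) x"
    unfolding gen_def by (intro Bochner_Integration.integral_diff integrable_gen)
  finally show "apply_c_infty (Gen k (v - w)) x = apply_c_infty (Gen k v - Gen k w) x"
    by (simp add: apply_Gen minus_c_infty.rep_eq)
qed

end


section \<open>Resolvents of bounded jump operators\<close>

text \<open>\<open>ennreal\<close> truncates at 0, so this is the L1 norm for nonnegative functions,
  which is the case that matters; the value \<infinity> is allowed.\<close>

definition mass :: "'a::euclidean_space c_infty \<Rightarrow> ennreal"
  where "mass u = (\<integral>\<^sup>+ x. ennreal (apply_c_infty u x) \<partial>lborel)"

lemma tendsto_apply_c_infty_at:
  assumes "(v \<longlongrightarrow> l) F"
  shows "((\<lambda>n. apply_c_infty (v n) x) \<longlongrightarrow> apply_c_infty l x) F"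
proof -
  have "((\<lambda>n. norm (v n - l)) \<longlongrightarrow> 0) F"
    using assms by (intro tendsto_norm_zero LIM_zero)
  then have "((\<lambda>n. apply_c_infty (v n) x - apply_c_infty l x) \<longlongrightarrow> 0) F"
    by (rule tendsto_0_le[where K=1])
      (use abs_apply_c_infty_le_norm[of "v n - l" x for n] in \<open>simp add: minus_c_infty.rep_eq\<close>)
  then show ?thesis by (rule LIM_zero_cancel)
qed

text \<open>Fatou's lemma: uniform convergence does not preserve the integral, but it keeps an upper
  bound on it. Closedness serves twice, for the fixed point behind the resolvent and for the passage
  from resolvent powers to the semigroup.\<close>

lemma closed_mass_le: "closed {v. (\<forall>x. 0 \<le> apply_c_infty v x) \<and> mass v \<le> N}"
  unfolding closed_sequential_limits
proof safe
  fix v :: "nat \<Rightarrow> 'a c_infty" and l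
  assume v: "\<forall>n. v n \<in> {v. (\<forall>x. 0 \<le> apply_c_infty v x) \<and> mass v \<le> N}" and "v \<longlonglongrightarrow> l"
  then have lim: "(\<lambda>n. apply_c_infty (v n) x) \<longlonglongrightarrow> apply_c_infty l x" for x
    by (intro tendsto_apply_c_infty_at)
  show "0 \<le> apply_c_infty l x" for x
    using v by (intro LIMSEQ_le_const[OF lim]) auto
  have "(\<lambda>n. ennreal (apply_c_infty (v n) x)) \<longlonglongrightarrow> ennreal (apply_c_infty l x)" for x
    by (intro tendsto_ennrealI lim)
  then have "mass l = (\<integral>\<^sup>+ x. liminf (\<lambda>n. ennreal (apply_c_infty (v n) x)) \<partial>lborel)"
    unfolding mass_def by (intro nn_integral_cong lim_imp_Liminf[symmetric]) simp
  also have "\<dots> \<le> liminf (\<lambda>n. mass (v n))"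
    unfolding mass_def by (rule nn_integral_liminf) measurable
  also have "\<dots> \<le> N"
    using v by (intro Liminf_le) (auto intro!: always_eventually)
  finally show "mass l \<le> N" .
qed

lemma gen_nonpos_at_max:
  assumes "\<And>y. F y \<le> F x" "\<And>x y. k x y \<ge> 0"
  shows "gen k F x \<le> 0"
proof -
  have "0 \<le> (LINT y|lborel. - ((F y - F x) * k x y))"
    using assms by (intro Bochner_Integration.integral_nonneg) (simp add: mult_nonpos_nonneg)
  then show ?thesis by (simp add: gen_def)
qed

definition res :: "('a::euclidean_space \<Rightarrow> 'a \<Rightarrow> real) \<Rightarrow> real \<Rightarrow> 'a c_infty \<Rightarrow> 'a c_infty"
  where "res k h g = (THE v. v - h *\<^sub>R Gen k v = g)"

context jump_kernel
begin

lemma Gen_0 [simp]: "Gen k 0 = 0"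
  using Gen_diff[of 0 0] by simp

lemma Gen_uminus: "Gen k (- v) = - Gen k v"
  using Gen_diff[of 0 v] by simp

text \<open>The maximum principle for one implicit step: at a positive maximum of v - c the
  generator of v is nonpositive, so v is there at most \<open>v - h *\<^sub>R Gen k v\<close>, hence
  at most c.\<close>

lemma resolvent_le:
  assumes "h > 0" "c \<ge> 0" and g: "\<And>x. apply_c_infty (v - h *\<^sub>R Gen k v) x \<le> c"
  shows "apply_c_infty v x \<le> c"
proof (rule ccontr)
  assume "\<not> ?thesis"
  then have pos: "apply_c_infty v x - c > 0" by simp
  obtain x0 where x0: "apply_c_infty v x0 - c > 0" "\<And>y. apply_c_infty v y - c \<le> apply_c_infty v x0 - c"
    by (rule pos_max_attained[of "\<lambda>x. apply_c_infty v x - c" v x])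
      (use assms pos in \<open>auto intro!: continuous_intros continuous_on_apply_c_infty\<close>)
  then have "gen k (apply_c_infty v) x0 \<le> 0"
    using k_nonneg by (intro gen_nonpos_at_max) auto
  then have "h * gen k (apply_c_infty v) x0 \<le> 0"
    using \<open>h > 0\<close> by (simp add: mult_nonneg_nonpos)
  with g[of x0] x0(1) show False
    by (simp add: minus_c_infty.rep_eq scaleR_c_infty.rep_eq apply_Gen)
qed

lemma resolvent_norm_le:
  assumes "h > 0"
  shows "norm v \<le> norm (v - h *\<^sub>R Gen k v)"
proof (rule norm_c_infty_le)
  fix x
  let ?g = "v - h *\<^sub>R Gen k v"
  have "apply_c_infty v x \<le> norm ?g"
    by (rule resolvent_le[OF assms]) (auto intro: order_trans[OF abs_ge_self abs_apply_c_infty_le_norm])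
  moreover have "apply_c_infty (- v) x \<le> norm ?g"
  proof (rule resolvent_le[OF assms])
    fix x
    have "apply_c_infty (- v - h *\<^sub>R Gen k (- v)) x = - apply_c_infty ?g x"
      by (simp add: Gen_uminus minus_c_infty.rep_eq uminus_c_infty.rep_eq scaleR_c_infty.rep_eq)
    then show "apply_c_infty (- v - h *\<^sub>R Gen k (- v)) x \<le> norm ?g"
      using abs_apply_c_infty_le_norm[of ?g x] by linarith
  qed simp
  ultimately show "\<bar>apply_c_infty v x\<bar> \<le> norm ?g" by (simp add: uminus_c_infty.rep_eq)
qed

definition rate :: "'a \<Rightarrow> real" where "rate x = (LINT y|lborel. k x y)"

lemma nn_integral_k: "(\<integral>\<^sup>+ y. ennreal (k x y) \<partial>lborel) = ennreal (rate x)"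
  unfolding rate_def using k_nonneg by (intro nn_integral_eq_integral integrable_k) auto

lemma rate_nonneg: "rate x \<ge> 0"
  unfolding rate_def using k_nonneg by simp

lemma rate_le: "rate x \<le> total_rate"
  using nn_integral_k_le[of x] total_rate_nonneg by (simp add: nn_integral_k)

lemma measurable_rate [measurable]: "rate \<in> borel_measurable borel"
  unfolding rate_def by measurable

lemma integrable_apply_k: "integrable lborel (\<lambda>y. apply_c_infty u y * k x y)"
  by (rule integrable_bounded_k[where B="norm u"]) (auto simp: abs_apply_c_infty_le_norm)

lemma gen_eq: "gen k (apply_c_infty u) x = (LINT y|lborel. apply_c_infty u y * k x y) - apply_c_infty u x * rate x"
proof -
  have "gen k (apply_c_infty u) x = (LINT y|lborel. apply_c_infty u y * k x y - apply_c_infty u x * k x y)"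
    by (simp add: gen_def left_diff_distrib)
  also have "\<dots> = (LINT y|lborel. apply_c_infty u y * k x y) - (LINT y|lborel. apply_c_infty u x * k x y)"
    by (intro Bochner_Integration.integral_diff integrable_apply_k) (simp add: integrable_k)
  finally show ?thesis by (simp add: rate_def)
qed

lemma nn_integral_apply_k:
  assumes "\<And>x. apply_c_infty u x \<ge> 0"
  shows "(\<integral>\<^sup>+ y. ennreal (apply_c_infty u y) * ennreal (k x y) \<partial>lborel)
    = ennreal (LINT y|lborel. apply_c_infty u y * k x y)"
proof -
  have "(\<integral>\<^sup>+ y. ennreal (apply_c_infty u y) * ennreal (k x y) \<partial>lborel)
      = (\<integral>\<^sup>+ y. ennreal (apply_c_infty u y * k x y) \<partial>lborel)"
    using assms k_nonneg by (simp add: ennreal_mult')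
  also have "\<dots> = ennreal (LINT y|lborel. apply_c_infty u y * k x y)"
    using assms k_nonneg by (intro nn_integral_eq_integral integrable_apply_k) auto
  finally show ?thesis .
qed

text \<open>The added multiple of the identity compensates the loss term: the coefficient of
  \<open>apply_c_infty u x\<close> becomes \<open>total_rate - rate x\<close>, which is nonnegative.
  This is the uniformization of a bounded jump process.\<close>

definition shift :: "'a c_infty \<Rightarrow> 'a c_infty"
  where "shift u = Gen k u + total_rate *\<^sub>R u"

lemma apply_shift: "apply_c_infty (shift u) x =
    (LINT y|lborel. apply_c_infty u y * k x y) + (total_rate - rate x) * apply_c_infty u x"
  by (simp add: shift_def plus_c_infty.rep_eq scaleR_c_infty.rep_eq apply_Gen gen_eq algebra_simps)

lemma shift_diff: "shift (u - v) = shift u - shift v"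
  by (simp add: shift_def Gen_diff algebra_simps)

lemma norm_shift_le: "norm (shift u) \<le> total_rate * norm u"
proof (rule norm_c_infty_le)
  fix x
  have "\<bar>LINT y|lborel. apply_c_infty u y * k x y\<bar> \<le> (LINT y|lborel. norm u * k x y)"
    using abs_apply_c_infty_le_norm[of u] k_nonneg integrable_k
    by (intro order_trans[OF integral_abs_bound] integral_mono integrable_abs integrable_apply_k)
      (auto simp: abs_mult intro: mult_right_mono)
  also have "\<dots> = norm u * rate x" by (simp add: rate_def)
  finally have "\<bar>LINT y|lborel. apply_c_infty u y * k x y\<bar> \<le> norm u * rate x" .
  moreover have "\<bar>(total_rate - rate x) * apply_c_infty u x\<bar> \<le> (total_rate - rate x) * norm u"
    using rate_le[of x] by (simp add: abs_mult mult_left_mono abs_apply_c_infty_le_norm)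
  ultimately show "\<bar>apply_c_infty (shift u) x\<bar> \<le> total_rate * norm u"
    unfolding apply_shift by (simp add: algebra_simps)
qed

lemma shift_nonneg:
  assumes "\<And>x. apply_c_infty u x \<ge> 0"
  shows "apply_c_infty (shift u) x \<ge> 0"
  unfolding apply_shift using assms k_nonneg rate_le[of x] by simp

text \<open>Tonelli's theorem and the symmetry of the kernel; in \<open>ennreal\<close> the exchange
  raises no question of integrability.\<close>

lemma nn_integral_swap_k:
  assumes [measurable]: "F \<in> borel_measurable borel" "G \<in> borel_measurable borel"
  shows "(\<integral>\<^sup>+ x. \<integral>\<^sup>+ y. F x * G y * ennreal (k x y) \<partial>lborel \<partial>lborel)
    = (\<integral>\<^sup>+ x. \<integral>\<^sup>+ y. G x * F y * ennreal (k x y) \<partial>lborel \<partial>lborel)"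
  by (subst lborel_pair.Fubini') (auto simp: k_sym mult_ac)

lemma nn_integral_weight_k:
  assumes [measurable]: "G \<in> borel_measurable borel"
  shows "(\<integral>\<^sup>+ x. \<integral>\<^sup>+ y. G y * ennreal (k x y) \<partial>lborel \<partial>lborel) = (\<integral>\<^sup>+ x. G x * ennreal (rate x) \<partial>lborel)"
proof -
  have "(\<integral>\<^sup>+ x. \<integral>\<^sup>+ y. G y * ennreal (k x y) \<partial>lborel \<partial>lborel)
      = (\<integral>\<^sup>+ x. \<integral>\<^sup>+ y. G x * ennreal (k x y) \<partial>lborel \<partial>lborel)"
    using nn_integral_swap_k[of "\<lambda>_. 1" G] by simp
  then show ?thesis by (simp add: nn_integral_cmult nn_integral_k)
qed

text \<open>By symmetry the gain integrates to the integral of u against \<open>rate\<close>,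
  exactly what the loss term takes away. The generator conserves mass, and only the added multiple
  of the identity remains.\<close>

lemma mass_shift:
  assumes "\<And>x. apply_c_infty u x \<ge> 0"
  shows "mass (shift u) = ennreal total_rate * mass u"
proof -
  have "mass (shift u) = (\<integral>\<^sup>+ x. (\<integral>\<^sup>+ y. ennreal (apply_c_infty u y) * ennreal (k x y) \<partial>lborel)
      + ennreal ((total_rate - rate x) * apply_c_infty u x) \<partial>lborel)"
    unfolding mass_def apply_shift nn_integral_apply_k[OF assms]
    using assms k_nonneg rate_le by (intro nn_integral_cong ennreal_plus) auto
  also have "\<dots> = (\<integral>\<^sup>+ x. ennreal (apply_c_infty u x) * ennreal (rate x) \<partial>lborel)
      + (\<integral>\<^sup>+ x. ennreal ((total_rate - rate x) * apply_c_infty u x) \<partial>lborel)"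
    by (subst nn_integral_add) (auto simp: nn_integral_weight_k)
  also have "\<dots> = (\<integral>\<^sup>+ x. ennreal (apply_c_infty u x) * ennreal (rate x)
      + ennreal ((total_rate - rate x) * apply_c_infty u x) \<partial>lborel)"
    by (subst nn_integral_add) auto
  also have "\<dots> = (\<integral>\<^sup>+ x. ennreal total_rate * ennreal (apply_c_infty u x) \<partial>lborel)"
  proof (intro nn_integral_cong)
    fix x
    have "ennreal (apply_c_infty u x) * ennreal (rate x) + ennreal ((total_rate - rate x) * apply_c_infty u x)
       = ennreal (apply_c_infty u x * rate x + (total_rate - rate x) * apply_c_infty u x)"
      using assms rate_nonneg[of x] rate_le[of x] by (simp add: ennreal_mult')
    also have "apply_c_infty u x * rate x + (total_rate - rate x) * apply_c_infty u x = total_rate * apply_c_infty u x"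
      by (simp add: algebra_simps)
    finally show "ennreal (apply_c_infty u x) * ennreal (rate x) + ennreal ((total_rate - rate x) * apply_c_infty u x)
       = ennreal total_rate * ennreal (apply_c_infty u x)"
      using total_rate_nonneg by (simp add: ennreal_mult')
  qed
  finally show ?thesis by (simp add: mass_def nn_integral_cmult)
qed

text \<open>The resolvent equation is a fixed point equation for a contraction, because
  \<open>shift\<close> is a positive operator of norm at most \<open>total_rate\<close>.\<close>

lemma resolvent_exists:
  assumes "h > 0" "closed s" "s \<noteq> {}"
    and s: "\<And>v. v \<in> s \<Longrightarrow> (g + h *\<^sub>R shift v) /\<^sub>R (1 + h * total_rate) \<in> s"
  obtains v where "v \<in> s" "v - h *\<^sub>R Gen k v = g"
proof -
  define \<Phi> where "\<Phi> v = (g + h *\<^sub>R shift v) /\<^sub>R (1 + h * total_rate)" for v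
  have pos: "1 + h * total_rate > 0"
    using assms(1) total_rate_nonneg by (simp add: add_pos_nonneg)
  have c_nonneg: "0 \<le> h * total_rate / (1 + h * total_rate)"
    using assms(1) pos total_rate_nonneg by (intro divide_nonneg_pos mult_nonneg_nonneg) auto
  have lip: "dist (\<Phi> v) (\<Phi> w) \<le> (h * total_rate / (1 + h * total_rate)) * dist v w" for v w
  proof -
    have "\<Phi> v - \<Phi> w = (h / (1 + h * total_rate)) *\<^sub>R shift (v - w)"
      by (simp add: \<Phi>_def shift_diff algebra_simps divide_inverse_commute)
    then have "dist (\<Phi> v) (\<Phi> w) = (h / (1 + h * total_rate)) * norm (shift (v - w))"
      using assms(1) pos by (simp add: dist_norm)
    also have "\<dots> \<le> (h / (1 + h * total_rate)) * (total_rate * norm (v - w))"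
      using assms(1) pos by (intro mult_left_mono norm_shift_le) auto
    finally show ?thesis by (simp add: dist_norm mult_ac)
  qed
  \<comment> \<open>With L = \<open>total_rate\<close> the Lipschitz factor h L / (1 + h L) is below
    1 for every h > 0. Iterating inside \<open>s\<close> places the fixed point in
    \<open>s\<close>.\<close>
  have "\<exists>!v. v \<in> s \<and> \<Phi> v = v"
    using pos c_nonneg lip s
    by (intro Banach_fix[of s "h * total_rate / (1 + h * total_rate)"] assms)
      (auto simp: \<Phi>_def complete_eq_closed assms)
  then obtain v where v: "v \<in> s" "\<Phi> v = v" by blast
  have "(1 + h * total_rate) *\<^sub>R v = (1 + h * total_rate) *\<^sub>R \<Phi> v"
    by (simp add: v)
  also have "\<dots> = g + h *\<^sub>R shift v"
    using pos by (simp add: \<Phi>_def)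
  finally have "v - h *\<^sub>R Gen k v = g"
    by (simp add: shift_def algebra_simps)
  with v(1) that show ?thesis by blast
qed

lemma res_unique:
  assumes "h > 0" "v - h *\<^sub>R Gen k v = g"
  shows "res k h g = v"
  unfolding res_def
proof (rule the_equality)
  fix w
  assume "w - h *\<^sub>R Gen k w = g"
  have "(w - v) - h *\<^sub>R Gen k (w - v) = (w - h *\<^sub>R Gen k w) - (v - h *\<^sub>R Gen k v)"
    by (simp add: Gen_diff algebra_simps)
  also have "\<dots> = 0"
    using assms(2) \<open>w - h *\<^sub>R Gen k w = g\<close> by simp
  finally have "(w - v) - h *\<^sub>R Gen k (w - v) = 0" .
  then show "w = v"
    using resolvent_norm_le[OF assms(1), of "w - v"] by simp
qed (rule assms)

lemma res_eq:
  assumes "h > 0"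
  shows "res k h g - h *\<^sub>R Gen k (res k h g) = g"
proof -
  obtain v where "v - h *\<^sub>R Gen k v = g"
    by (rule resolvent_exists[OF assms, of UNIV g]) auto
  with res_unique[OF assms this] show ?thesis by simp
qed

lemma res_contraction:
  assumes "h > 0"
  shows "norm (res k h g - res k h g') \<le> norm (g - g')"
proof -
  have "(res k h g - res k h g') - h *\<^sub>R Gen k (res k h g - res k h g')
      = (res k h g - h *\<^sub>R Gen k (res k h g)) - (res k h g' - h *\<^sub>R Gen k (res k h g'))"
    by (simp add: Gen_diff algebra_simps)
  also have "\<dots> = g - g'" using res_eq[OF assms] by simp
  finally show ?thesis
    using resolvent_norm_le[OF assms, of "res k h g - res k h g'"] by simp
qed

lemma res_nonneg:
  assumes "h > 0" "\<And>x. apply_c_infty g x \<ge> 0"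
  shows "apply_c_infty (res k h g) x \<ge> 0"
proof -
  have *: "- res k h g - h *\<^sub>R Gen k (- res k h g) = - g"
    using res_eq[OF assms(1), of g] by (simp add: Gen_uminus algebra_simps)
  have "apply_c_infty (- res k h g) x \<le> 0"
    by (rule resolvent_le[OF assms(1)], simp, subst *) (use assms in \<open>simp add: uminus_c_infty.rep_eq\<close>)
  then show ?thesis by (simp add: uminus_c_infty.rep_eq)
qed

text \<open>The fixed point is sought among nonnegative functions of mass at most N, a closed set.
  With L = \<open>total_rate\<close>, one iteration turns the bound N into (N + h L N) / (1 + h L) =
  N, and uniqueness identifies the fixed point with the resolvent.\<close>

lemma res_mass_le:
  assumes "h > 0" "\<And>x. apply_c_infty g x \<ge> 0" "mass g \<le> ennreal N" "N \<ge> 0"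
  shows "mass (res k h g) \<le> ennreal N"
proof -
  define s :: "'a c_infty set" where "s = {v. (\<forall>x. 0 \<le> apply_c_infty v x) \<and> mass v \<le> ennreal N}"
  have "closed s" unfolding s_def by (rule closed_mass_le)
  moreover have "g \<in> s" using assms by (simp add: s_def)
  moreover have "(g + h *\<^sub>R shift v) /\<^sub>R (1 + h * total_rate) \<in> s" if "v \<in> s" for v
  proof -
    have v: "\<And>x. apply_c_infty v x \<ge> 0" "mass v \<le> ennreal N" using that by (auto simp: s_def)
    have pos: "1 + h * total_rate > 0"
      using assms(1) total_rate_nonneg by (simp add: add_pos_nonneg)
    have "mass ((g + h *\<^sub>R shift v) /\<^sub>R (1 + h * total_rate))
       = (\<integral>\<^sup>+ x. ennreal (1 / (1 + h * total_rate)) * (ennreal (apply_c_infty g x)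
         + ennreal h * ennreal (apply_c_infty (shift v) x)) \<partial>lborel)"
      unfolding mass_def using assms pos shift_nonneg[OF v(1)]
      by (intro nn_integral_cong)
        (simp add: plus_c_infty.rep_eq scaleR_c_infty.rep_eq ennreal_mult'[symmetric] ennreal_plus[symmetric]
          divide_inverse_commute del: ennreal_plus)
    also have "\<dots> = ennreal (1 / (1 + h * total_rate)) * (mass g + ennreal h * mass (shift v))"
      by (simp add: nn_integral_cmult nn_integral_add mass_def)
    also have "\<dots> \<le> ennreal (1 / (1 + h * total_rate)) * (ennreal N + ennreal h * (ennreal total_rate * ennreal N))"
      using assms v(2) by (intro mult_left_mono add_mono) (auto simp: mass_shift[OF v(1)] intro!: mult_left_mono)
    also have "\<dots> = ennreal ((1 / (1 + h * total_rate)) * (N + h * (total_rate * N)))"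
      using assms total_rate_nonneg pos
      by (simp add: ennreal_mult'[symmetric] ennreal_plus[symmetric] del: ennreal_plus)
    also have "(1 / (1 + h * total_rate)) * (N + h * (total_rate * N)) = N"
      using pos by (simp add: field_simps)
    finally have "mass ((g + h *\<^sub>R shift v) /\<^sub>R (1 + h * total_rate)) \<le> ennreal N" .
    moreover have "0 \<le> apply_c_infty ((g + h *\<^sub>R shift v) /\<^sub>R (1 + h * total_rate)) x" for x
      using assms pos shift_nonneg[OF v(1)] by (simp add: plus_c_infty.rep_eq scaleR_c_infty.rep_eq)
    ultimately show ?thesis by (simp add: s_def)
  qed
  ultimately obtain v where "v \<in> s" "v - h *\<^sub>R Gen k v = g"
    using resolvent_exists[OF assms(1), of s g] by blast
  then show ?thesis using res_unique[OF assms(1)] by (auto simp: s_def)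
qed

text \<open>The resolvent equation for u is tested with \<open>res k h w\<close>, the one for w with
  \<open>res k h u\<close>. The left sides agree, and by symmetry of the kernel so do the gain terms
  \<open>D\<close>; cancelling them leaves the claim. Moving the loss term to the left keeps every
  term nonnegative.\<close>

lemma res_symmetric:
  assumes "h > 0" and u: "\<And>x. apply_c_infty u x \<ge> 0" "mass u < \<infinity>" and w: "\<And>x. apply_c_infty w x \<ge> 0"
  shows "(\<integral>\<^sup>+ x. ennreal (apply_c_infty (res k h u) x) * ennreal (apply_c_infty w x) \<partial>lborel)
    = (\<integral>\<^sup>+ x. ennreal (apply_c_infty u x) * ennreal (apply_c_infty (res k h w) x) \<partial>lborel)"
proof -
  define v v' where "v = apply_c_infty (res k h u)" and "v' = apply_c_infty (res k h w)"
  have v: "v x \<ge> 0" "v' x \<ge> 0" for x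
    using assms unfolding v_def v'_def by (auto intro: res_nonneg)
  have [measurable]: "v \<in> borel_measurable borel" "v' \<in> borel_measurable borel"
    unfolding v_def v'_def by measurable
  have eq: "ennreal (apply_c_infty (res k h g) x) * (1 + ennreal (h * rate x))
    = ennreal (apply_c_infty g x) + ennreal h * (\<integral>\<^sup>+ y. ennreal (apply_c_infty (res k h g) y) * ennreal (k x y) \<partial>lborel)"
    if g: "\<And>x. apply_c_infty g x \<ge> 0" for g x
  proof -
    let ?r = "apply_c_infty (res k h g)"
    have "?r x - h * gen k ?r x = apply_c_infty g x"
      using arg_cong[OF res_eq[OF assms(1), of g], of "\<lambda>u. apply_c_infty u x"]
      by (simp add: minus_c_infty.rep_eq scaleR_c_infty.rep_eq apply_Gen)
    then have *: "?r x * (1 + h * rate x) = apply_c_infty g x + h * (LINT y|lborel. ?r y * k x y)"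
      by (simp add: gen_eq algebra_simps)
    have r: "?r y \<ge> 0" for y using res_nonneg[OF assms(1) g] .
    have "ennreal (?r x) * (1 + ennreal (h * rate x)) = ennreal (?r x * (1 + h * rate x))"
      using r assms(1) rate_nonneg[of x] by (subst ennreal_mult') (auto simp: ennreal_plus[symmetric] simp del: ennreal_plus simp flip: ennreal_1)
    also have "\<dots> = ennreal (apply_c_infty g x) + ennreal h * ennreal (LINT y|lborel. ?r y * k x y)"
      using * r k_nonneg assms(1) g by (simp add: ennreal_mult'[symmetric] ennreal_plus[symmetric] del: ennreal_plus)
    finally show ?thesis by (simp add: nn_integral_apply_k[OF r])
  qed
  define D where "D = (\<integral>\<^sup>+ x. \<integral>\<^sup>+ y. ennreal (v' x) * ennreal (v y) * ennreal (k x y) \<partial>lborel \<partial>lborel)"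
  have split: "(\<integral>\<^sup>+ x. (F x + ennreal h * (\<integral>\<^sup>+ y. V y * ennreal (k x y) \<partial>lborel)) * W x \<partial>lborel)
     = (\<integral>\<^sup>+ x. F x * W x \<partial>lborel)
       + ennreal h * (\<integral>\<^sup>+ x. \<integral>\<^sup>+ y. W x * V y * ennreal (k x y) \<partial>lborel \<partial>lborel)"
    if [measurable]: "F \<in> borel_measurable borel" "V \<in> borel_measurable borel" "W \<in> borel_measurable borel"
    for F V W :: "'a \<Rightarrow> ennreal"
  proof -
    have "(\<integral>\<^sup>+ x. (F x + ennreal h * (\<integral>\<^sup>+ y. V y * ennreal (k x y) \<partial>lborel)) * W x \<partial>lborel)
       = (\<integral>\<^sup>+ x. F x * W x + ennreal h * (W x * (\<integral>\<^sup>+ y. V y * ennreal (k x y) \<partial>lborel)) \<partial>lborel)"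
      by (intro nn_integral_cong) (simp add: algebra_simps)
    also have "\<dots> = (\<integral>\<^sup>+ x. F x * W x \<partial>lborel)
       + (\<integral>\<^sup>+ x. ennreal h * (W x * (\<integral>\<^sup>+ y. V y * ennreal (k x y) \<partial>lborel)) \<partial>lborel)"
      by (rule nn_integral_add) measurable
    also have "(\<integral>\<^sup>+ x. ennreal h * (W x * (\<integral>\<^sup>+ y. V y * ennreal (k x y) \<partial>lborel)) \<partial>lborel)
       = ennreal h * (\<integral>\<^sup>+ x. W x * (\<integral>\<^sup>+ y. V y * ennreal (k x y) \<partial>lborel) \<partial>lborel)"
      by (rule nn_integral_cmult) measurable
    also have "(\<integral>\<^sup>+ x. W x * (\<integral>\<^sup>+ y. V y * ennreal (k x y) \<partial>lborel) \<partial>lborel)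
       = (\<integral>\<^sup>+ x. \<integral>\<^sup>+ y. W x * V y * ennreal (k x y) \<partial>lborel \<partial>lborel)"
      unfolding mult.assoc by (intro nn_integral_cong nn_integral_cmult[symmetric]) measurable
    finally show ?thesis .
  qed
  have 1: "(\<integral>\<^sup>+ x. ennreal (v x) * (1 + ennreal (h * rate x)) * ennreal (v' x) \<partial>lborel)
     = (\<integral>\<^sup>+ x. ennreal (apply_c_infty u x) * ennreal (v' x) \<partial>lborel) + ennreal h * D"
    unfolding v_def eq[OF u(1)] D_def by (rule split) measurable
  have "(\<integral>\<^sup>+ x. ennreal (v' x) * (1 + ennreal (h * rate x)) * ennreal (v x) \<partial>lborel)
     = (\<integral>\<^sup>+ x. ennreal (apply_c_infty w x) * ennreal (v x) \<partial>lborel)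
      + ennreal h * (\<integral>\<^sup>+ x. \<integral>\<^sup>+ y. ennreal (v x) * ennreal (v' y) * ennreal (k x y) \<partial>lborel \<partial>lborel)"
    unfolding v'_def eq[OF w(1)] by (rule split) measurable
  also have "(\<integral>\<^sup>+ x. \<integral>\<^sup>+ y. ennreal (v x) * ennreal (v' y) * ennreal (k x y) \<partial>lborel \<partial>lborel) = D"
    unfolding D_def by (rule nn_integral_swap_k) measurable
  finally have 2: "(\<integral>\<^sup>+ x. ennreal (v x) * (1 + ennreal (h * rate x)) * ennreal (v' x) \<partial>lborel)
     = (\<integral>\<^sup>+ x. ennreal (v x) * ennreal (apply_c_infty w x) \<partial>lborel) + ennreal h * D"
    by (simp add: mult_ac)
  \<comment> \<open>Cancelling \<open>ennreal h * D\<close> requires it to be finite: one factor is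
    bounded, the other has finite mass, and the rate is bounded.\<close>
  have "D \<le> (\<integral>\<^sup>+ x. \<integral>\<^sup>+ y. (ennreal (norm (res k h w)) * ennreal (v y)) * ennreal (k x y) \<partial>lborel \<partial>lborel)"
    unfolding D_def v'_def
    by (intro nn_integral_mono mult_right_mono ennreal_leI)
      (auto intro: order_trans[OF abs_ge_self abs_apply_c_infty_le_norm])
  also have "\<dots> = (\<integral>\<^sup>+ x. (ennreal (norm (res k h w)) * ennreal (v x)) * ennreal (rate x) \<partial>lborel)"
    by (rule nn_integral_weight_k) measurable
  also have "\<dots> \<le> (\<integral>\<^sup>+ x. (ennreal (norm (res k h w)) * ennreal (v x)) * ennreal total_rate \<partial>lborel)"
    by (intro nn_integral_mono mult_left_mono ennreal_leI rate_le) auto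
  also have "\<dots> = ennreal (norm (res k h w)) * mass (res k h u) * ennreal total_rate"
    by (simp add: nn_integral_cmult nn_integral_multc mass_def v_def)
  also have "\<dots> < \<infinity>"
  proof -
    have "mass u = ennreal (enn2real (mass u))" using u(2) by simp
    then have "mass (res k h u) \<le> ennreal (enn2real (mass u))"
      using assms by (intro res_mass_le) auto
    then have "mass (res k h u) < \<infinity>" by (auto simp: less_top[symmetric] top_unique)
    then show ?thesis by (auto simp: ennreal_mult_less_top)
  qed
  finally have "ennreal h * D \<noteq> \<infinity>" by (auto simp: ennreal_mult_eq_top_iff)
  with 1 2 show ?thesis
    unfolding v_def v'_def by (simp add: add.commute[of _ "ennreal h * D"] ennreal_add_left_cancel)
qed

end


section \<open>The hyperbolic cosine barrier\<close>

text \<open>A non-integrable f has integral 0 by convention, and B \<ge> 0 covers that case; so a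
  one-sided bound on f is enough, which suits barriers that are not controlled from below.\<close>

lemma integral_le_nn_integral:
  fixes f g :: "'b \<Rightarrow> real"
  assumes [measurable]: "g \<in> borel_measurable M"
    and g: "\<And>x. g x \<ge> 0" "(\<integral>\<^sup>+ x. ennreal (g x) \<partial>M) \<le> ennreal B" "B \<ge> 0"
    and fg: "\<And>x. f x \<le> g x"
  shows "(LINT x|M. f x) \<le> B"
proof (cases "integrable M f")
  case True
  have g_int: "integrable M g"
    using g by (intro integrableI_bounded) (auto simp: less_top[symmetric] top_unique)
  have "(LINT x|M. f x) \<le> (LINT x|M. g x)"
    by (intro integral_mono True g_int fg)
  also have "\<dots> \<le> B"
  proof -
    have "ennreal (LINT x|M. g x) = (\<integral>\<^sup>+ x. ennreal (g x) \<partial>M)"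
      using g by (intro nn_integral_eq_integral[symmetric] g_int) auto
    with g show ?thesis by (metis ennreal_le_iff)
  qed
  finally show ?thesis .
qed (use assms in \<open>simp add: not_integrable_integral_eq\<close>)

text \<open>The point is the integrability of |h|^(p - \<alpha> - d) near 0 for p > \<alpha>. It
  serves the barrier and the comparison of two truncations, with p = 1 for first differences and,
  after symmetrization, p = 2.\<close>

lemma small_jumps_le:
  fixes q G :: "'a::euclidean_space \<Rightarrow> real" and p \<alpha> \<rho> D M :: real
  assumes "p > \<alpha>" "\<rho> > 0" "D \<ge> 0" "M \<ge> 0"
    and q: "\<And>h. q h \<ge> 0" "\<And>h. q h \<le> M * norm h powr (- \<alpha> - DIM('a))" "\<And>h. norm h > \<rho> \<Longrightarrow> q h = 0"
    and G: "\<And>h. norm h \<le> \<rho> \<Longrightarrow> G h \<le> D * norm h powr p"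
  shows "(LINT h|lborel. G h * q h) \<le> M * D * radial_const TYPE('a) (p - \<alpha>) * \<rho> powr (p - \<alpha>)"
proof -
  let ?I = "\<lambda>h::'a. indicator {h. norm (h - 0) \<le> \<rho>} h * norm (h - 0) powr (p - \<alpha> - DIM('a))"
  have "(\<integral>\<^sup>+ h. ennreal (M * D * ?I h) \<partial>lborel) = ennreal (M * D) * (\<integral>\<^sup>+ h. ennreal (?I h) \<partial>lborel)"
    using assms by (subst nn_integral_cmult[symmetric]) (auto simp: ennreal_mult'[symmetric])
  also have "\<dots> \<le> ennreal (M * D) * ennreal (radial_const TYPE('a) (p - \<alpha>) * \<rho> powr (p - \<alpha>))"
    using assms by (intro mult_left_mono nn_integral_center_le) auto
  also have "\<dots> = ennreal (M * D * radial_const TYPE('a) (p - \<alpha>) * \<rho> powr (p - \<alpha>))"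
    using assms by (simp add: ennreal_mult'[symmetric] mult_ac)
  finally show ?thesis
  proof (intro integral_le_nn_integral[where g="\<lambda>h. M * D * ?I h"])
    fix h :: 'a
    show "G h * q h \<le> M * D * ?I h"
    proof (cases "norm h \<le> \<rho>")
      case True
      have "G h * q h \<le> (D * norm h powr p) * (M * norm h powr (- \<alpha> - DIM('a)))"
        using G[OF True] q[of h] assms by (intro mult_mono) auto
      also have "\<dots> = M * D * (norm h powr p * norm h powr (- \<alpha> - DIM('a)))"
        by (simp add: mult_ac)
      also have "norm h powr p * norm h powr (- \<alpha> - DIM('a)) = norm h powr (p - \<alpha> - DIM('a))"
        by (simp add: powr_add[symmetric] algebra_simps)
      finally show ?thesis using True by simp
    qed (simp add: q)
  next
    show "0 \<le> M * D * radial_const TYPE('a) (p - \<alpha>) * \<rho> powr (p - \<alpha>)"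
      using assms radial_const_pos[of "p - \<alpha>", where 'a='a] by (simp add: less_imp_le)
  qed (use assms in auto)
qed

text \<open>Against an even kernel G may be replaced by its even part, so only second differences
  enter. This is how evenness of the jump kernel takes the place of \<alpha> < 1.\<close>

lemma small_jumps_symmetric_le:
  fixes q G :: "'a::euclidean_space \<Rightarrow> real" and p \<alpha> \<rho> D M :: real
  assumes "p > \<alpha>" "\<rho> > 0" "D \<ge> 0" "M \<ge> 0"
    and q: "\<And>h. q h \<ge> 0" "\<And>h. q h \<le> M * norm h powr (- \<alpha> - DIM('a))" "\<And>h. norm h > \<rho> \<Longrightarrow> q h = 0"
    and [measurable]: "q \<in> borel_measurable borel" "G \<in> borel_measurable borel"
    and sym: "\<And>h. q (- h) = q h"
    and G: "\<And>h. norm h \<le> \<rho> \<Longrightarrow> G h + G (- h) \<le> 2 * D * norm h powr p"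
  shows "(LINT h|lborel. G h * q h) \<le> M * D * radial_const TYPE('a) (p - \<alpha>) * \<rho> powr (p - \<alpha>)"
proof (cases "integrable lborel (\<lambda>h. G h * q h)")
  case True
  have refl: "(LINT h|lborel. G (- h) * q h) = (LINT h|lborel. G h * q h)"
    using lborel_reflect[of "\<lambda>h. G h * q h"] by (simp add: sym)
  have "integrable (distr lborel borel (\<lambda>h::'a. - h)) (\<lambda>h. G h * q h)"
    using True by (simp add: lborel_distr_reflect)
  then have True': "integrable lborel (\<lambda>h. G (- h) * q h)"
    by (subst (asm) integrable_distr_eq) (auto simp: sym)
  have "(LINT h|lborel. G h * q h) = (LINT h|lborel. G h * q h + G (- h) * q h) / 2"
    using True True' by (subst Bochner_Integration.integral_add) (auto simp: refl)
  also have "\<dots> = (LINT h|lborel. (G h + G (- h)) / 2 * q h)"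
    by (simp add: algebra_simps flip: Bochner_Integration.integral_divide_zero)
  also have "\<dots> \<le> M * D * radial_const TYPE('a) (p - \<alpha>) * \<rho> powr (p - \<alpha>)"
    using G by (intro small_jumps_le assms) (fastforce simp: field_simps)+
  finally show ?thesis .
next
  case False
  then show ?thesis
    using assms radial_const_pos[of "p - \<alpha>", where 'a='a] by (simp add: not_integrable_integral_eq less_imp_le)
qed

lemma abs_sinh_le: "\<bar>sinh x\<bar> \<le> \<bar>x\<bar> * exp \<bar>x :: real\<bar>"
proof -
  have *: "sinh x \<le> x * exp x" if "x \<ge> 0" for x :: real
  proof -
    have "1 + (- (2 * x)) \<le> exp (- (2 * x))" by (rule exp_ge_add_one_self)
    then have "exp x * (1 - exp (- (2 * x))) \<le> exp x * (2 * x)"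
      by (intro mult_left_mono) auto
    also have "exp x * (1 - exp (- (2 * x))) = exp x - exp (- x)"
      by (simp add: right_diff_distrib flip: exp_add)
    finally show ?thesis by (simp add: sinh_def mult_ac)
  qed
  show ?thesis
  proof (cases "x \<ge> 0")
    case True
    then show ?thesis using *[of x] by simp
  next
    case False
    then show ?thesis using *[of "- x"] by simp
  qed
qed

lemma cosh_minus_one_le: "cosh x - 1 \<le> x\<^sup>2 / 2 * exp \<bar>x :: real\<bar>"
proof -
  have "cosh x = cosh (2 * (x / 2))" by simp
  also have "\<dots> = 2 * (sinh (x / 2))\<^sup>2 + 1"
    by (simp only: cosh_double cosh_square_eq)
  finally have "cosh x - 1 = 2 * \<bar>sinh (x / 2)\<bar>\<^sup>2" by simp
  also have "\<dots> \<le> 2 * (\<bar>x / 2\<bar> * exp \<bar>x / 2\<bar>)\<^sup>2"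
    by (intro mult_left_mono power_mono abs_sinh_le) auto
  also have "\<dots> = x\<^sup>2 / 2 * exp \<bar>x\<bar>"
    by (simp add: power_mult_distrib power_divide exp_double[symmetric])
  finally show ?thesis .
qed

lemma exp_minus_one_le: "exp x - 1 \<le> x * exp (x :: real)"
proof -
  have "1 + (- x) \<le> exp (- x)" by (rule exp_ge_add_one_self)
  then have "exp x * (1 - x) \<le> exp x * exp (- x)" by (intro mult_left_mono) auto
  then show ?thesis by (simp add: algebra_simps flip: exp_add)
qed

text \<open>A smooth substitute for exp (\<kappa> |z|): its second differences are controlled by the
  function itself, whereas exp (\<kappa> |z|) has a kink at 0, where second differences are only of
  first order.\<close>

definition cosh_weight :: "real \<Rightarrow> 'a::euclidean_space \<Rightarrow> real"
  where "cosh_weight \<kappa> z = (\<Sum>b\<in>Basis. cosh (\<kappa> * (z \<bullet> b)))"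

lemma continuous_cosh_weight [continuous_intros]:
  "continuous_on A g \<Longrightarrow> continuous_on A (\<lambda>x. cosh_weight \<kappa> (g x))"
  unfolding cosh_weight_def by (intro continuous_intros)

lemma cosh_weight_nonneg: "cosh_weight \<kappa> z \<ge> 0"
  by (simp add: cosh_weight_def sum_nonneg)

lemma cosh_weight_0: "cosh_weight \<kappa> (0 :: 'a::euclidean_space) = DIM('a)"
  by (simp add: cosh_weight_def)

text \<open>The l1 norm dominates the Euclidean norm, so some coordinate is at least r/d in absolute
  value; hence the division by d in the exponent.\<close>

lemma cosh_weight_ge:
  fixes z :: "'a::euclidean_space"
  assumes "norm z \<ge> r" "\<kappa> \<ge> 0"
  shows "2 * cosh_weight \<kappa> z \<ge> exp (\<kappa> * r / DIM('a))"
proof -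
  have "\<exists>b\<in>Basis. \<bar>z \<bullet> b\<bar> \<ge> r / DIM('a)"
  proof (rule ccontr)
    assume "\<not> ?thesis"
    then have "(\<Sum>b\<in>Basis. \<bar>z \<bullet> b\<bar>) < (\<Sum>b\<in>(Basis::'a set). r / DIM('a))"
      by (intro sum_strict_mono) (auto simp: not_le)
    also have "\<dots> = r" by simp
    finally show False using norm_le_l1[of z] assms by linarith
  qed
  then obtain b where b: "b \<in> Basis" "\<bar>z \<bullet> b\<bar> \<ge> r / DIM('a)" by blast
  have "exp (\<kappa> * r / DIM('a)) \<le> exp \<bar>\<kappa> * (z \<bullet> b)\<bar>"
    using b(2) mult_left_mono[OF b(2) assms(2)] assms(2) by (simp add: abs_mult)
  also have "\<dots> \<le> 2 * cosh (\<kappa> * (z \<bullet> b))"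
    by (cases "\<kappa> * (z \<bullet> b) \<ge> 0") (simp_all add: cosh_def field_simps)
  also have "\<dots> \<le> 2 * cosh_weight \<kappa> z"
    unfolding cosh_weight_def using b(1) by (intro mult_left_mono member_le_sum) auto
  finally show ?thesis .
qed

lemma cosh_weight_diff_le:
  fixes z h :: "'a::euclidean_space"
  assumes "norm h \<le> \<rho>" "\<kappa> \<ge> 0"
  shows "cosh_weight \<kappa> (z + h) - cosh_weight \<kappa> z \<le> (\<kappa> * exp (\<kappa> * \<rho>) * cosh_weight \<kappa> z) * norm h"
    and "cosh_weight \<kappa> (z + h) + cosh_weight \<kappa> (z - h) - 2 * cosh_weight \<kappa> z
      \<le> (\<kappa>\<^sup>2 * exp (\<kappa> * \<rho>) * cosh_weight \<kappa> z) * (norm h)\<^sup>2"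
proof -
  have 0: "\<bar>\<kappa> * (h \<bullet> b)\<bar> \<le> \<kappa> * norm h" "\<kappa> * norm h \<le> \<kappa> * \<rho>" if "b \<in> Basis" for b
    using assms Basis_le_norm[OF that, of h] by (auto simp: abs_mult intro: mult_left_mono)
  have "cosh (\<kappa> * ((z + h) \<bullet> b)) - cosh (\<kappa> * (z \<bullet> b)) \<le> (\<kappa> * norm h * exp (\<kappa> * \<rho>)) * cosh (\<kappa> * (z \<bullet> b))"
    if "b \<in> Basis" for b
  proof -
    let ?s = "\<kappa> * (z \<bullet> b)" and ?t = "\<kappa> * (h \<bullet> b)"
    have "cosh (\<kappa> * ((z + h) \<bullet> b)) - cosh ?s = cosh ?s * (cosh ?t - 1) + sinh ?s * sinh ?t"
      by (simp add: inner_add_left distrib_left cosh_add algebra_simps)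
    also have "sinh ?s * sinh ?t \<le> cosh ?s * \<bar>sinh ?t\<bar>"
    proof -
      have "\<bar>sinh ?s\<bar> \<le> cosh ?s"
        using cosh_plus_sinh[of ?s] cosh_minus_sinh[of ?s] exp_gt_zero[of ?s] exp_gt_zero[of "- ?s"] by linarith
      then have "\<bar>sinh ?s\<bar> * \<bar>sinh ?t\<bar> \<le> cosh ?s * \<bar>sinh ?t\<bar>"
        by (intro mult_right_mono) auto
      then show ?thesis by (simp add: abs_mult[symmetric])
    qed
    also have "cosh ?s * (cosh ?t - 1) + cosh ?s * \<bar>sinh ?t\<bar> = cosh ?s * (exp \<bar>?t\<bar> - 1)"
    proof -
      have "exp \<bar>?t\<bar> = cosh ?t + \<bar>sinh ?t\<bar>"
        using cosh_plus_sinh[of "\<bar>?t\<bar>"] by (simp add: sinh_real_abs)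
      then show ?thesis by (simp add: algebra_simps)
    qed
    also have "\<dots> \<le> cosh ?s * (\<bar>?t\<bar> * exp \<bar>?t\<bar>)"
      by (intro mult_left_mono exp_minus_one_le) auto
    also have "\<dots> \<le> cosh ?s * (\<kappa> * norm h * exp (\<kappa> * \<rho>))"
      using 0[OF that] assms by (intro mult_left_mono mult_mono) auto
    finally show ?thesis by (simp add: mult_ac)
  qed
  then have "(\<Sum>b\<in>Basis. cosh (\<kappa> * ((z + h) \<bullet> b)) - cosh (\<kappa> * (z \<bullet> b)))
      \<le> (\<Sum>b\<in>Basis. (\<kappa> * norm h * exp (\<kappa> * \<rho>)) * cosh (\<kappa> * (z \<bullet> b)))"
    by (intro sum_mono)
  then show "cosh_weight \<kappa> (z + h) - cosh_weight \<kappa> z \<le> (\<kappa> * exp (\<kappa> * \<rho>) * cosh_weight \<kappa> z) * norm h"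
    by (simp add: cosh_weight_def sum_subtractf sum_distrib_left[symmetric] mult_ac)
  have "cosh (\<kappa> * ((z + h) \<bullet> b)) + cosh (\<kappa> * ((z - h) \<bullet> b)) - 2 * cosh (\<kappa> * (z \<bullet> b))
    \<le> ((\<kappa> * norm h)\<^sup>2 * exp (\<kappa> * \<rho>)) * cosh (\<kappa> * (z \<bullet> b))"
    if "b \<in> Basis" for b
  proof -
    let ?s = "\<kappa> * (z \<bullet> b)" and ?t = "\<kappa> * (h \<bullet> b)"
    have "cosh (\<kappa> * ((z + h) \<bullet> b)) + cosh (\<kappa> * ((z - h) \<bullet> b)) - 2 * cosh ?s = 2 * cosh ?s * (cosh ?t - 1)"
      by (simp add: inner_add_left inner_diff_left distrib_left right_diff_distrib cosh_add cosh_diff algebra_simps)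
    also have "\<dots> \<le> 2 * cosh ?s * (?t\<^sup>2 / 2 * exp \<bar>?t\<bar>)"
      by (intro mult_left_mono cosh_minus_one_le) auto
    also have "\<dots> = cosh ?s * (\<bar>?t\<bar>\<^sup>2 * exp \<bar>?t\<bar>)" by simp
    also have "\<dots> \<le> cosh ?s * ((\<kappa> * norm h)\<^sup>2 * exp (\<kappa> * \<rho>))"
      using 0[OF that] assms by (intro mult_left_mono mult_mono power_mono) auto
    finally show ?thesis by (simp add: mult_ac)
  qed
  then have "(\<Sum>b\<in>Basis. cosh (\<kappa> * ((z + h) \<bullet> b)) + cosh (\<kappa> * ((z - h) \<bullet> b)) - 2 * cosh (\<kappa> * (z \<bullet> b)))
      \<le> (\<Sum>b\<in>Basis. ((\<kappa> * norm h)\<^sup>2 * exp (\<kappa> * \<rho>)) * cosh (\<kappa> * (z \<bullet> b)))"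
    by (intro sum_mono)
  then show "cosh_weight \<kappa> (z + h) + cosh_weight \<kappa> (z - h) - 2 * cosh_weight \<kappa> z
      \<le> (\<kappa>\<^sup>2 * exp (\<kappa> * \<rho>) * cosh_weight \<kappa> z) * (norm h)\<^sup>2"
    by (simp add: cosh_weight_def sum_subtractf sum.distrib sum_distrib_left[symmetric] power_mult_distrib mult_ac)
qed

text \<open>One summand for each alternative: second differences lead to 2 - \<alpha>, first
  differences to 1 - \<alpha>. The sum is independent of which alternative holds, and the test
  \<alpha> < 1 excludes nonpositive arguments of \<open>radial_const\<close>.\<close>

definition truncation_const :: "'a::euclidean_space itself \<Rightarrow> real \<Rightarrow> real \<Rightarrow> real"
  where "truncation_const T \<alpha> M =
    M * (radial_const T (2 - \<alpha>) + (if \<alpha> < 1 then radial_const T (1 - \<alpha>) else 0))"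

context jump_kernel
begin

text \<open>Short jumps act on the barrier at most like multiplication by a constant of order
  \<rho>^(-\<alpha>), because its differences are bounded by the barrier itself. The polynomial
  factor in \<kappa> \<rho> is absorbed by a second exp (\<kappa> \<rho>), so that \<kappa> enters
  only through exp (2 \<kappa> \<rho>).\<close>

lemma cosh_weight_generator_le:
  assumes dir: "(\<forall>x h. k x (x + h) = k x (x - h)) \<or> \<alpha> < 1" and "\<rho> > 0" "\<kappa> \<ge> 0"
  shows "(LINT y|lborel. (cosh_weight \<kappa> (y - z) - cosh_weight \<kappa> (x - z)) * (k x y * indicator {y. norm (y - x) \<le> \<rho>} y))
    \<le> (truncation_const TYPE('a) \<alpha> M * exp (2 * \<kappa> * \<rho>) * \<rho> powr (- \<alpha>)) * cosh_weight \<kappa> (x - z)"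
proof -
  define W where "W = cosh_weight \<kappa> (x - z)"
  define q where "q h = k x (x + h) * indicator {h. norm h \<le> \<rho>} h" for h
  define G where "G h = cosh_weight \<kappa> (x - z + h) - W" for h
  have W: "W \<ge> 0" by (simp add: W_def cosh_weight_nonneg)
  have [measurable]: "cosh_weight \<kappa> \<in> borel_measurable (borel :: 'a measure)"
    by (intro borel_measurable_continuous_onI continuous_intros)
  have [measurable]: "q \<in> borel_measurable borel" "G \<in> borel_measurable borel"
    unfolding q_def G_def by measurable
  have q: "q h \<ge> 0" "q h \<le> M * norm h powr (- \<alpha> - DIM('a))" "norm h > \<rho> \<Longrightarrow> q h = 0" for h
    using k_nonneg k_le[of x "x + h"] M by (auto simp: q_def indicator_def)
  have "(LINT y|lborel. (cosh_weight \<kappa> (y - z) - cosh_weight \<kappa> (x - z)) * (k x y * indicator {y. norm (y - x) \<le> \<rho>} y))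
     = (LINT h|lborel. G h * q h)"
    by (subst lborel_translate[of _ x]) (auto simp: G_def q_def W_def indicator_def algebra_simps intro!: Bochner_Integration.integral_cong)
  also have "\<dots> \<le> (truncation_const TYPE('a) \<alpha> M * exp (2 * \<kappa> * \<rho>) * \<rho> powr (- \<alpha>)) * W"
  proof (cases "\<forall>x h. k x (x + h) = k x (x - h)")
    case True
    have "(LINT h|lborel. G h * q h)
        \<le> M * (\<kappa>\<^sup>2 / 2 * exp (\<kappa> * \<rho>) * W) * radial_const TYPE('a) (2 - \<alpha>) * \<rho> powr (2 - \<alpha>)"
    proof (rule small_jumps_symmetric_le)
      show "q (- h) = q h" for h using True by (simp add: q_def indicator_def)
      show "G h + G (- h) \<le> 2 * (\<kappa>\<^sup>2 / 2 * exp (\<kappa> * \<rho>) * W) * norm h powr 2" if "norm h \<le> \<rho>" for h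
        using cosh_weight_diff_le(2)[OF that assms(3), of "x - z"] by (simp add: G_def W_def powr_numeral)
    qed (use alpha assms M W q in auto)
    also have "\<dots> = M * W * radial_const TYPE('a) (2 - \<alpha>) * \<rho> powr (- \<alpha>) * (((\<kappa> * \<rho>)\<^sup>2 / 2) * exp (\<kappa> * \<rho>))"
      using assms by (simp add: powr_diff powr_minus powr_numeral power_mult_distrib field_simps)
    also have "\<dots> \<le> M * W * radial_const TYPE('a) (2 - \<alpha>) * \<rho> powr (- \<alpha>) * (exp (\<kappa> * \<rho>) * exp (\<kappa> * \<rho>))"
    proof -
      have "(\<kappa> * \<rho>)\<^sup>2 / 2 \<le> exp (\<kappa> * \<rho>)"
        using exp_lower_Taylor_quadratic[of "\<kappa> * \<rho>"] assms by (smt (verit) mult_nonneg_nonneg)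
      then show ?thesis
        using M W radial_const_pos[of "2 - \<alpha>", where 'a='a] alpha by (intro mult_left_mono mult_right_mono) (auto simp: less_imp_le)
    qed
    also have "\<dots> = M * radial_const TYPE('a) (2 - \<alpha>) * (exp (2 * \<kappa> * \<rho>) * \<rho> powr (- \<alpha>) * W)"
      by (simp add: mult_ac mult_2 flip: exp_add)
    also have "\<dots> \<le> truncation_const TYPE('a) \<alpha> M * (exp (2 * \<kappa> * \<rho>) * \<rho> powr (- \<alpha>) * W)"
      unfolding truncation_const_def using M W radial_const_pos[of "1 - \<alpha>", where 'a='a]
      by (intro mult_right_mono mult_left_mono) auto
    finally show ?thesis by (simp add: mult_ac)
  next
    case False
    with dir have "\<alpha> < 1" by blast
    have "(LINT h|lborel. G h * q h)
        \<le> M * (\<kappa> * exp (\<kappa> * \<rho>) * W) * radial_const TYPE('a) (1 - \<alpha>) * \<rho> powr (1 - \<alpha>)"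
    proof (rule small_jumps_le)
      show "G h \<le> (\<kappa> * exp (\<kappa> * \<rho>) * W) * norm h powr 1" if "norm h \<le> \<rho>" for h
        using cosh_weight_diff_le(1)[OF that assms(3), of "x - z"] by (simp add: G_def W_def)
    qed (use \<open>\<alpha> < 1\<close> assms M W q in auto)
    also have "\<dots> = M * W * radial_const TYPE('a) (1 - \<alpha>) * \<rho> powr (- \<alpha>) * ((\<kappa> * \<rho>) * exp (\<kappa> * \<rho>))"
      using assms by (simp add: powr_diff powr_minus field_simps)
    also have "\<dots> \<le> M * W * radial_const TYPE('a) (1 - \<alpha>) * \<rho> powr (- \<alpha>) * (exp (\<kappa> * \<rho>) * exp (\<kappa> * \<rho>))"
    proof -
      have "\<kappa> * \<rho> \<le> exp (\<kappa> * \<rho>)"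
        using exp_ge_add_one_self[of "\<kappa> * \<rho>"] by linarith
      then show ?thesis
        using M W radial_const_pos[of "1 - \<alpha>", where 'a='a] \<open>\<alpha> < 1\<close> by (intro mult_left_mono mult_right_mono) (auto simp: less_imp_le)
    qed
    also have "\<dots> = M * radial_const TYPE('a) (1 - \<alpha>) * (exp (2 * \<kappa> * \<rho>) * \<rho> powr (- \<alpha>) * W)"
      by (simp add: mult_ac mult_2 flip: exp_add)
    also have "\<dots> \<le> truncation_const TYPE('a) \<alpha> M * (exp (2 * \<kappa> * \<rho>) * \<rho> powr (- \<alpha>) * W)"
      unfolding truncation_const_def using M W \<open>\<alpha> < 1\<close> alpha radial_const_pos[of "2 - \<alpha>", where 'a='a]
      by (intro mult_right_mono mult_left_mono) auto
    finally show ?thesis by (simp add: mult_ac)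
  qed
  finally show ?thesis by (simp add: W_def)
qed

end


section \<open>Maximum principle estimates for powers of resolvents\<close>

text \<open>C1 s^(-\<beta>) is a supersolution of the implicit scheme for m' = M r^(-\<alpha>-d) - a
  r^(-\<alpha>) m with r^\<alpha> = c0 (s + h) and \<beta> = d/\<alpha>. The choice c0 = a/(3
  \<beta>) makes the loss rate 3 \<beta>/(s + h): two thirds pay for the decrease of the barrier,
  whose discrete version costs at most a factor 2 by \<open>small\<close>, and one third pays for
  the gain, which is C1 \<beta> (s + h)^(-1-\<beta>) by the choice of C1.\<close>

lemma powr_barrier_step:
  fixes s h \<beta> a c0 :: real
  assumes "s > 0" "h > 0" "\<beta> > 0" "a > 0" "M > 0"
    and c0: "c0 = a / (3 * \<beta>)" and C1: "C1 = M * c0 powr (- 1 - \<beta>) / \<beta>"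
    and small: "(1 + h / s) powr (\<beta> + 1) \<le> 2"
  shows "C1 * s powr (- \<beta>) + h * (M * (c0 * (s + h)) powr (- 1 - \<beta>))
     \<le> C1 * (s + h) powr (- \<beta>) * (1 + h * (a / (c0 * (s + h))))"
proof -
  define P where "P = (s + h) powr (- 1 - \<beta>)"
  have c0_pos: "c0 > 0" and C1_pos: "C1 > 0" using assms by (simp_all add: c0 C1)
  have "((\<lambda>x. x powr (- \<beta>)) has_real_derivative (- \<beta> * x powr (- \<beta> - 1))) (at x)" if "x > 0" for x
    using that by (auto intro!: derivative_eq_intros)
  then obtain \<xi> where \<xi>: "s < \<xi>" "\<xi> < s + h"
    "(s + h) powr (- \<beta>) - s powr (- \<beta>) = (s + h - s) * (- \<beta> * \<xi> powr (- \<beta> - 1))"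
    using MVT2[of s "s + h" "\<lambda>x. x powr (- \<beta>)" "\<lambda>x. - \<beta> * x powr (- \<beta> - 1)"] assms by auto
  have "\<xi> powr (- \<beta> - 1) \<le> s powr (- \<beta> - 1)"
    using \<xi> assms by (intro powr_mono2') auto
  also have "s powr (- \<beta> - 1) = (1 + h / s) powr (\<beta> + 1) * P"
  proof -
    have "1 + h / s = (s + h) / s" using assms by (simp add: field_simps)
    then have "(1 + h / s) powr (\<beta> + 1) * P = (s + h) powr (\<beta> + 1) / s powr (\<beta> + 1) * (1 / (s + h) powr (\<beta> + 1))"
      using assms powr_minus_divide[of "s + h" "\<beta> + 1"] by (simp add: P_def powr_divide algebra_simps)
    also have "\<dots> = 1 / s powr (\<beta> + 1)" using assms by simp
    also have "\<dots> = s powr (- \<beta> - 1)" using powr_minus_divide[of s "\<beta> + 1"] by simp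
    finally show ?thesis ..
  qed
  also have "\<dots> \<le> 2 * P"
    using small by (intro mult_right_mono) (simp_all add: P_def)
  finally have "\<beta> * h * \<xi> powr (- \<beta> - 1) \<le> \<beta> * h * (2 * P)"
    using assms by (intro mult_left_mono) auto
  with \<xi>(3) have "s powr (- \<beta>) \<le> (s + h) powr (- \<beta>) + 2 * \<beta> * h * P"
    by (simp add: algebra_simps)
  then have 1: "C1 * s powr (- \<beta>) \<le> C1 * ((s + h) powr (- \<beta>) + 2 * \<beta> * h * P)"
    using C1_pos by (intro mult_left_mono) auto
  have 2: "M * (c0 * (s + h)) powr (- 1 - \<beta>) = C1 * \<beta> * P"
    unfolding C1 P_def using powr_mult[of c0 "s + h" "- 1 - \<beta>"] \<open>\<beta> > 0\<close> by simp
  have 3: "(s + h) powr (- \<beta>) * (a / (c0 * (s + h))) = 3 * \<beta> * P"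
  proof -
    have "a / (c0 * (s + h)) = 3 * \<beta> / (s + h)"
      unfolding c0 using \<open>\<beta> > 0\<close> \<open>a > 0\<close> by simp
    moreover have "P = (s + h) powr (- \<beta>) / (s + h)"
    proof -
      have "P = (s + h) powr (- \<beta> - 1)"
        unfolding P_def by (rule arg_cong) simp
      then show ?thesis
        using powr_diff[of "s + h" "- \<beta>" 1] \<open>s > 0\<close> \<open>h > 0\<close> by simp
    qed
    ultimately show ?thesis by simp
  qed
  have "C1 * (s + h) powr (- \<beta>) * (1 + h * (a / (c0 * (s + h))))
      = C1 * ((s + h) powr (- \<beta>) + h * ((s + h) powr (- \<beta>) * (a / (c0 * (s + h)))))"
    by (simp add: algebra_simps)
  also have "\<dots> = C1 * ((s + h) powr (- \<beta>) + 2 * \<beta> * h * P) + h * (C1 * \<beta> * P)"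
    unfolding 3 by (simp add: algebra_simps)
  finally show ?thesis
    unfolding 2 using 1 by linarith
qed

context jump_kernel
begin

text \<open>Beyond distance r the kernel is at most M r^(-\<alpha>-d), and what is left is the mass
  of v.\<close>

lemma far_gain_le:
  assumes v: "\<And>x. apply_c_infty v x \<ge> 0" "mass v \<le> ennreal N" and "N \<ge> 0" "r > 0"
  shows "(LINT y|lborel. apply_c_infty v y * (k x y * indicator {y. norm (y - x) > r} y))
    \<le> M * r powr (- \<alpha> - DIM('a)) * N"
proof (rule integral_le_nn_integral[where g="\<lambda>y. M * r powr (- \<alpha> - DIM('a)) * apply_c_infty v y"])
  show "(\<integral>\<^sup>+ y. ennreal (M * r powr (- \<alpha> - DIM('a)) * apply_c_infty v y) \<partial>lborel)
     \<le> ennreal (M * r powr (- \<alpha> - DIM('a)) * N)"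
  proof -
    have "(\<integral>\<^sup>+ y. ennreal (M * r powr (- \<alpha> - DIM('a)) * apply_c_infty v y) \<partial>lborel)
      = ennreal (M * r powr (- \<alpha> - DIM('a))) * mass v"
      unfolding mass_def using M v by (subst nn_integral_cmult[symmetric]) (auto simp: ennreal_mult')
    also have "\<dots> \<le> ennreal (M * r powr (- \<alpha> - DIM('a))) * ennreal N"
      using v by (intro mult_left_mono) auto
    finally show ?thesis using M \<open>N \<ge> 0\<close> by (simp add: ennreal_mult')
  qed
next
  fix y
  have "k x y * indicator {y. norm (y - x) > r} y \<le> M * r powr (- \<alpha> - DIM('a))"
  proof (cases "norm (y - x) > r")
    case True
    have "k x y \<le> M * norm (y - x) powr (- \<alpha> - DIM('a))" by (rule k_le)
    also have "\<dots> \<le> M * r powr (- \<alpha> - DIM('a))"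
      using True M alpha \<open>r > 0\<close> by (intro mult_left_mono powr_mono2') auto
    finally show ?thesis using True by simp
  qed (use M in simp)
  then show "apply_c_infty v y * (k x y * indicator {y. norm (y - x) > r} y)
      \<le> M * r powr (- \<alpha> - DIM('a)) * apply_c_infty v y"
    using v by (simp add: mult_left_mono mult.commute)
qed (use M v \<open>N \<ge> 0\<close> in auto)

text \<open>At a maximum point of \<open>v\<close> all jumps contribute negatively to the generator, so the jumps
  shorter than \<open>r\<close> may be dropped; the longer ones gain at most \<open>M r\<^sup>-\<^sup>\<alpha>\<^sup>-\<^sup>d \<parallel>v\<parallel>\<^sub>1\<close> and
  lose at least \<open>a r\<^sup>-\<^sup>\<alpha> sup v\<close>. This replaces a Nash inequality.\<close>

lemma res_sup_step:
  assumes "h > 0" "r > 0" "N \<ge> 0" "a \<ge> 0"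
    and lower: "\<And>x. (LINT y|lborel. k x y * indicator {y. norm (y - x) > r} y) \<ge> a * r powr (- \<alpha>)"
    and u: "\<And>x. apply_c_infty u x \<ge> 0" "mass u \<le> ennreal N" "\<And>x. apply_c_infty u x \<le> m"
  shows "apply_c_infty (res k h u) x * (1 + h * (a * r powr (- \<alpha>))) \<le> m + h * (M * r powr (- \<alpha> - DIM('a)) * N)"
proof -
  define v where "v = res k h u"
  have v: "apply_c_infty v y \<ge> 0" for y
    unfolding v_def using assms by (intro res_nonneg)
  have v_mass: "mass v \<le> ennreal N"
    unfolding v_def using assms by (intro res_mass_le)
  have m: "m \<ge> 0" using u(1,3) order_trans by blast
  have "0 \<le> M * r powr (- \<alpha> - DIM('a)) * N" using M assms by simp
  show ?thesis
  proof (cases "apply_c_infty v x > 0")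
    case True
    obtain x0 where x0: "apply_c_infty v x0 > 0" "\<And>y. apply_c_infty v y \<le> apply_c_infty v x0"
      by (rule pos_max_attained[of "apply_c_infty v" v x]) (use True in \<open>auto intro: continuous_on_apply_c_infty\<close>)
    let ?I = "indicator {y. norm (y - x0) > r} :: 'a \<Rightarrow> real"
    let ?V = "apply_c_infty v"
    have kI: "integrable lborel (\<lambda>y. k x0 y * ?I y)"
      by (rule Bochner_Integration.integrable_bound[OF integrable_k[of x0]]) (auto simp: indicator_def)
    have vkI: "integrable lborel (\<lambda>y. ?V y * (k x0 y * ?I y))"
      using integrable_bounded_k[of "\<lambda>y. ?V y * ?I y" "norm v" x0] abs_apply_c_infty_le_norm[of v]
      by (auto simp: mult_ac indicator_def)
    have "gen k ?V x0 \<le> (LINT y|lborel. ?V y * (k x0 y * ?I y) - ?V x0 * (k x0 y * ?I y))"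
      unfolding gen_def using x0(2) k_nonneg kI vkI
      by (intro integral_mono integrable_gen Bochner_Integration.integrable_diff)
        (auto simp: indicator_def mult_nonpos_nonneg left_diff_distrib intro!: mult_right_mono)
    also have "\<dots> = (LINT y|lborel. ?V y * (k x0 y * ?I y)) - ?V x0 * (LINT y|lborel. k x0 y * ?I y)"
      using kI vkI by (subst Bochner_Integration.integral_diff) auto
    also have "\<dots> \<le> M * r powr (- \<alpha> - DIM('a)) * N - ?V x0 * (a * r powr (- \<alpha>))"
      using x0(1) by (intro diff_mono far_gain_le[OF v v_mass assms(3,2)] mult_left_mono lower) auto
    finally have "h * gen k ?V x0 \<le> h * (M * r powr (- \<alpha> - DIM('a)) * N - ?V x0 * (a * r powr (- \<alpha>)))"
      using assms by (intro mult_left_mono) auto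
    moreover have "?V x0 - h * gen k ?V x0 = apply_c_infty u x0"
      using arg_cong[OF res_eq[OF assms(1), of u], of "\<lambda>u. apply_c_infty u x0"]
      by (simp add: minus_c_infty.rep_eq scaleR_c_infty.rep_eq apply_Gen v_def)
    ultimately have "?V x0 * (1 + h * (a * r powr (- \<alpha>))) \<le> m + h * (M * r powr (- \<alpha> - DIM('a)) * N)"
      using u(3)[of x0] by (simp add: algebra_simps)
    moreover have "?V x * (1 + h * (a * r powr (- \<alpha>))) \<le> ?V x0 * (1 + h * (a * r powr (- \<alpha>)))"
      using x0(2) assms by (intro mult_right_mono) auto
    ultimately show ?thesis unfolding v_def by linarith
  next
    case False
    with v[of x] have "apply_c_infty v x = 0" by simp
    then show ?thesis using m assms M by (simp add: v_def)
  qed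
qed

lemma funpow_res_nonneg:
  assumes "h > 0" "\<And>x. apply_c_infty u x \<ge> 0"
  shows "apply_c_infty ((res k h ^^ n) u) x \<ge> 0"
  using assms(2) by (induction n arbitrary: x) (auto intro: res_nonneg[OF assms(1)])

lemma funpow_res_mass_le:
  assumes "h > 0" "\<And>x. apply_c_infty u x \<ge> 0" "mass u \<le> ennreal N" "N \<ge> 0"
  shows "mass ((res k h ^^ n) u) \<le> ennreal N"
  by (induction n) (auto intro!: res_mass_le funpow_res_nonneg assms)

lemma funpow_res_symmetric:
  assumes "h > 0" "\<And>x. apply_c_infty u x \<ge> 0" "mass u < \<infinity>" "\<And>x. apply_c_infty w x \<ge> 0"
  shows "(\<integral>\<^sup>+ x. ennreal (apply_c_infty ((res k h ^^ n) u) x) * ennreal (apply_c_infty w x) \<partial>lborel)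
    = (\<integral>\<^sup>+ x. ennreal (apply_c_infty u x) * ennreal (apply_c_infty ((res k h ^^ n) w) x) \<partial>lborel)"
  using assms(4)
proof (induction n arbitrary: w)
  case (Suc n)
  have "mass ((res k h ^^ n) u) < \<infinity>"
    using funpow_res_mass_le[OF assms(1,2), of "enn2real (mass u)" n] assms(3)
    by (auto simp: less_top[symmetric] top_unique)
  then have "(\<integral>\<^sup>+ x. ennreal (apply_c_infty ((res k h ^^ Suc n) u) x) * ennreal (apply_c_infty w x) \<partial>lborel)
    = (\<integral>\<^sup>+ x. ennreal (apply_c_infty ((res k h ^^ n) u) x) * ennreal (apply_c_infty (res k h w) x) \<partial>lborel)"
    using assms Suc.prems by (simp add: res_symmetric funpow_res_nonneg)
  also have "\<dots> = (\<integral>\<^sup>+ x. ennreal (apply_c_infty u x) * ennreal (apply_c_infty ((res k h ^^ n) (res k h w)) x) \<partial>lborel)"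
    using Suc.prems assms by (intro Suc.IH res_nonneg)
  finally show ?case by (simp add: funpow_swap1)
qed simp

text \<open>The barrier starts at a time s > 0, where it lies above u, and every step moves it from
  s' to s' + h. The radius of the step follows the time by r^\<alpha> = c0 (s' + h);
  \<open>eps_le\<close> guarantees r \<ge> \<epsilon>, the range in which \<open>lower\<close> is
  available for a truncated kernel.\<close>

lemma funpow_res_sup_le:
  fixes a c0 C1 \<beta> :: real
  assumes beta: "\<beta> = DIM('a) / \<alpha>"
    and pos: "h > 0" "N \<ge> 0" "a > 0" "s > 0"
    and c0: "c0 = a / (3 * \<beta>)" and C1: "C1 = M * c0 powr (- 1 - \<beta>) / \<beta>"
    and small: "(1 + h / s) powr (\<beta> + 1) \<le> 2" and eps_le: "\<epsilon> powr \<alpha> \<le> c0 * s"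
    and lower: "\<And>r x. r \<ge> \<epsilon> \<Longrightarrow> (LINT y|lborel. k x y * indicator {y. norm (y - x) > r} y) \<ge> a * r powr (- \<alpha>)"
    and u: "\<And>x. apply_c_infty u x \<ge> 0" "mass u \<le> ennreal N" "\<And>x. apply_c_infty u x \<le> C1 * s powr (- \<beta>) * N"
  shows "apply_c_infty ((res k h ^^ n) u) x \<le> C1 * (s + n * h) powr (- \<beta>) * N"
proof (induction n arbitrary: x)
  case 0
  then show ?case using u(3) by simp
next
  case (Suc n)
  define s' where "s' = s + n * h"
  define r where "r = (c0 * (s' + h)) powr (1 / \<alpha>)"
  have \<beta>: "\<beta> > 0" using alpha by (simp add: beta)
  have c0_pos: "c0 > 0" unfolding c0 using \<beta> \<open>a > 0\<close> by simp
  have s': "s' > 0" "s' \<ge> s" using pos by (auto simp: s'_def add_pos_nonneg)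
  have r: "r > 0" using s' c0_pos pos by (simp add: r_def)
  have "\<epsilon> powr \<alpha> \<le> c0 * (s' + h)"
  proof -
    have "c0 * s \<le> c0 * (s' + h)" using s' c0_pos pos by (intro mult_left_mono) auto
    with eps_le show ?thesis by linarith
  qed
  then have "(\<epsilon> powr \<alpha>) powr (1 / \<alpha>) \<le> r"
    unfolding r_def using alpha by (intro powr_mono2) auto
  then have eps_r: "\<epsilon> \<le> r" using eps alpha by (simp add: powr_powr)
  have r1: "r powr (- \<alpha>) = 1 / (c0 * (s' + h))"
    using s' c0_pos pos alpha by (simp add: r_def powr_powr powr_minus_divide)
  have r2: "r powr (- \<alpha> - DIM('a)) = (c0 * (s' + h)) powr (- 1 - \<beta>)"
    using alpha by (simp add: r_def powr_powr beta divide_simps)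
  have "(1 + h / s') powr (\<beta> + 1) \<le> (1 + h / s) powr (\<beta> + 1)"
    using s' pos \<beta> by (intro powr_mono2 add_left_mono divide_left_mono) auto
  with small have small': "(1 + h / s') powr (\<beta> + 1) \<le> 2" by linarith
  have "apply_c_infty ((res k h ^^ Suc n) u) x * (1 + h * (a * r powr (- \<alpha>)))
    \<le> C1 * s' powr (- \<beta>) * N + h * (M * r powr (- \<alpha> - DIM('a)) * N)"
    unfolding funpow.simps comp_apply
    using pos u r eps_r lower[OF eps_r] Suc.IH
    by (intro res_sup_step funpow_res_nonneg funpow_res_mass_le) (auto simp: s'_def)
  also have "\<dots> = N * (C1 * s' powr (- \<beta>) + h * (M * (c0 * (s' + h)) powr (- 1 - \<beta>)))"
    by (simp add: r2 algebra_simps)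
  also have "\<dots> \<le> N * (C1 * (s' + h) powr (- \<beta>) * (1 + h * (a / (c0 * (s' + h)))))"
    using pos c0 C1 s' \<beta> M small' by (intro mult_left_mono powr_barrier_step) auto
  also have "\<dots> = C1 * (s' + h) powr (- \<beta>) * N * (1 + h * (a * r powr (- \<alpha>)))"
    by (simp add: r1)
  finally have "apply_c_infty ((res k h ^^ Suc n) u) x \<le> C1 * (s' + h) powr (- \<beta>) * N"
    by (rule mult_right_le_imp_le) (use pos in \<open>simp add: add_pos_nonneg\<close>)
  then show ?case by (simp add: s'_def algebra_simps)
qed

text \<open>At a positive maximum of v - c' - \<theta>' w the increments of v are at most \<theta>'
  times those of w. This is used for jumps up to \<rho>; longer ones are charged to the mass of v
  and enter c'. The condition relating \<theta> and \<theta>' is the implicit step for growth at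
  rate l.\<close>

lemma res_barrier_step:
  assumes "h > 0" "\<rho> > 0" "N \<ge> 0" "c \<ge> 0" "\<theta>' \<ge> 0"
    and w: "continuous_on UNIV w" "\<And>x. w x \<ge> 0"
    and gen_w: "\<And>x. (LINT y|lborel. (w y - w x) * (k x y * indicator {y. norm (y - x) \<le> \<rho>} y)) \<le> l * w x"
    and \<theta>: "\<theta> + h * \<theta>' * l \<le> \<theta>'"
    and u: "\<And>x. apply_c_infty u x \<ge> 0" "mass u \<le> ennreal N" "\<And>x. apply_c_infty u x \<le> c + \<theta> * w x"
  shows "apply_c_infty (res k h u) x \<le> c + h * (M * \<rho> powr (- \<alpha> - DIM('a)) * N) + \<theta>' * w x"
proof (rule ccontr)
  define v where "v = res k h u"
  define c' where "c' = c + h * (M * \<rho> powr (- \<alpha> - DIM('a)) * N)"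
  define z where "z x = apply_c_infty v x - c' - \<theta>' * w x" for x
  let ?V = "apply_c_infty v"
  assume "\<not> ?thesis"
  then have "z x > 0" by (simp add: z_def v_def c'_def)
  have c': "c' \<ge> 0" using assms M by (simp add: c'_def)
  have v: "?V y \<ge> 0" for y
    unfolding v_def using assms by (intro res_nonneg)
  have v_mass: "mass v \<le> ennreal N"
    unfolding v_def using assms by (intro res_mass_le)
  obtain x0 where x0: "z x0 > 0" "\<And>y. z y \<le> z x0"
  proof (rule pos_max_attained[of z v x])
    show "continuous_on UNIV z" unfolding z_def by (intro continuous_intros continuous_on_apply_c_infty w)
    show "z x \<le> ?V x" for x using c' mult_nonneg_nonneg[OF assms(5) w(2)[of x]] by (simp add: z_def)
  qed (use \<open>z x > 0\<close> in auto)
  let ?J = "indicator {y. norm (y - x0) \<le> \<rho>} :: 'a \<Rightarrow> real"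
  let ?I = "indicator {y. norm (y - x0) > \<rho>} :: 'a \<Rightarrow> real"
  have [measurable]: "w \<in> borel_measurable borel" by (intro borel_measurable_continuous_onI w)
  have kI: "integrable lborel (\<lambda>y. k x0 y * ?I y)"
    by (rule Bochner_Integration.integrable_bound[OF integrable_k[of x0]]) (auto simp: indicator_def)
  have vkI: "integrable lborel (\<lambda>y. ?V y * (k x0 y * ?I y))"
    using integrable_bounded_k[of "\<lambda>y. ?V y * ?I y" "norm v" x0] abs_apply_c_infty_le_norm[of v]
    by (auto simp: mult_ac indicator_def)
  \<comment> \<open>The barrier may be unbounded on the whole space, but short jumps from x0 stay in
    a ball, which makes its increments integrable against the kernel.\<close>
  have "bounded (w ` cball x0 \<rho>)"
    by (intro compact_imp_bounded compact_continuous_image continuous_on_subset[OF w(1)]) auto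
  then obtain B where "\<forall>y\<in>cball x0 \<rho>. \<bar>w y\<bar> \<le> B"
    by (auto simp: bounded_iff)
  then have B: "\<bar>w y\<bar> \<le> B" if "norm (y - x0) \<le> \<rho>" for y
    using that by (simp add: dist_norm norm_minus_commute)
  have B0: "B \<ge> 0" using B[of x0] assms(2) by auto
  have wkJ: "integrable lborel (\<lambda>y. (w y - w x0) * (k x0 y * ?J y))"
  proof -
    have "\<bar>(w y - w x0) * ?J y\<bar> \<le> B + B" for y
      using B[of y] B[of x0] B0 assms(2) by (auto simp: indicator_def)
    from integrable_bounded_k[of "\<lambda>y. (w y - w x0) * ?J y", OF _ this, of x0]
    show ?thesis by (simp add: mult_ac)
  qed
  have "gen k ?V x0 \<le> (LINT y|lborel. \<theta>' * ((w y - w x0) * (k x0 y * ?J y)) + ?V y * (k x0 y * ?I y))"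
    unfolding gen_def
  proof (intro integral_mono integrable_gen Bochner_Integration.integrable_add integrable_mult_right wkJ vkI)
    fix y
    show "(?V y - ?V x0) * k x0 y \<le> \<theta>' * ((w y - w x0) * (k x0 y * ?J y)) + ?V y * (k x0 y * ?I y)"
    proof (cases "norm (y - x0) \<le> \<rho>")
      case True
      have "?V y - ?V x0 \<le> \<theta>' * (w y - w x0)"
        using x0(2)[of y] by (simp add: z_def algebra_simps)
      then have "(?V y - ?V x0) * k x0 y \<le> \<theta>' * (w y - w x0) * k x0 y"
        using k_nonneg by (intro mult_right_mono) auto
      then show ?thesis using True by simp
    next
      case False
      then show ?thesis using v[of x0] k_nonneg[of x0 y] by (simp add: mult_right_mono)
    qed
  qed
  also have "\<dots> = \<theta>' * (LINT y|lborel. (w y - w x0) * (k x0 y * ?J y)) + (LINT y|lborel. ?V y * (k x0 y * ?I y))"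
    using wkJ vkI by (subst Bochner_Integration.integral_add) auto
  also have "\<dots> \<le> \<theta>' * (l * w x0) + M * \<rho> powr (- \<alpha> - DIM('a)) * N"
    using assms v v_mass by (intro add_mono mult_left_mono far_gain_le) auto
  finally have "h * gen k ?V x0 \<le> h * (\<theta>' * (l * w x0) + M * \<rho> powr (- \<alpha> - DIM('a)) * N)"
    using assms by (intro mult_left_mono) auto
  moreover have "?V x0 - h * gen k ?V x0 = apply_c_infty u x0"
    using arg_cong[OF res_eq[OF assms(1), of u], of "\<lambda>u. apply_c_infty u x0"]
    by (simp add: minus_c_infty.rep_eq scaleR_c_infty.rep_eq apply_Gen v_def)
  ultimately have "?V x0 \<le> c' + (\<theta> + h * \<theta>' * l) * w x0"
    using u(3)[of x0] by (simp add: c'_def algebra_simps)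
  also have "\<dots> \<le> c' + \<theta>' * w x0"
    using \<theta> w by (intro add_left_mono mult_right_mono) auto
  finally show False using x0(1) by (simp add: z_def)
qed

lemma funpow_res_barrier_le:
  assumes "h > 0" "\<rho> > 0" "N \<ge> 0" "S \<ge> 0" "l \<ge> 0" "h * l \<le> 1 / 2"
    and w: "continuous_on UNIV w" "\<And>x. w x \<ge> 0"
    and gen_w: "\<And>x. (LINT y|lborel. (w y - w x) * (k x y * indicator {y. norm (y - x) \<le> \<rho>} y)) \<le> l * w x"
    and u: "\<And>x. apply_c_infty u x \<ge> 0" "mass u \<le> ennreal N" "\<And>x. apply_c_infty u x \<le> S * w x"
  shows "apply_c_infty ((res k h ^^ n) u) x
    \<le> n * h * (M * \<rho> powr (- \<alpha> - DIM('a)) * N) + S * exp (2 * l * (n * h)) * w x"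
proof (induction n arbitrary: x)
  case 0
  then show ?case using u by simp
next
  case (Suc n)
  \<comment> \<open>The discrete growth factor 1/(1 - h l) is at most exp (2 h l) as long as h l
    \<le> 1/2; hence the 2 in the exponent.\<close>
  have "(1 - h * l) * exp (2 * (h * l)) \<ge> 1"
  proof -
    have "(1 - h * l) * (1 + 2 * (h * l)) = 1 + (h * l) * (1 - 2 * (h * l))"
      by (simp add: algebra_simps)
    also have "\<dots> \<ge> 1" using assms by simp
    finally have "1 \<le> (1 - h * l) * (1 + 2 * (h * l))" .
    also have "\<dots> \<le> (1 - h * l) * exp (2 * (h * l))"
      using assms by (intro mult_left_mono exp_ge_add_one_self) auto
    finally show ?thesis .
  qed
  then have "S * exp (2 * l * (n * h)) * 1 \<le> S * exp (2 * l * (n * h)) * ((1 - h * l) * exp (2 * (h * l)))"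
    using assms by (intro mult_left_mono) auto
  moreover have "exp (2 * l * (Suc n * h)) = exp (2 * l * (n * h)) * exp (2 * (h * l))"
    by (simp add: algebra_simps flip: exp_add)
  ultimately have \<theta>: "S * exp (2 * l * (n * h)) + h * (S * exp (2 * l * (Suc n * h))) * l \<le> S * exp (2 * l * (Suc n * h))"
    by (simp add: algebra_simps)
  have "apply_c_infty ((res k h ^^ Suc n) u) x
    \<le> n * h * (M * \<rho> powr (- \<alpha> - DIM('a)) * N) + h * (M * \<rho> powr (- \<alpha> - DIM('a)) * N)
      + S * exp (2 * l * (Suc n * h)) * w x"
    unfolding funpow.simps comp_apply
    by (rule res_barrier_step[OF _ _ _ _ _ w gen_w \<theta>])
      (use assms M Suc.IH in \<open>auto intro: funpow_res_nonneg funpow_res_mass_le\<close>)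
  then show ?case by (simp add: algebra_simps)
qed

end


section \<open>A product formula for contraction semigroups\<close>

context
  fixes P :: "real \<Rightarrow> 'b::banach \<Rightarrow>\<^sub>L 'b"
  assumes P: "contraction_semigroup P"
begin

lemma sg_0: "P 0 u = u"
  and sg_add: "s \<ge> 0 \<Longrightarrow> t \<ge> 0 \<Longrightarrow> P (s + t) u = P s (P t u)"
  and sg_tendsto: "((\<lambda>t. P t u) \<longlongrightarrow> u) (at_right 0)"
  using P unfolding contraction_semigroup_def by auto

lemma sg_norm_le: "t \<ge> 0 \<Longrightarrow> norm (P t u) \<le> norm u"
  using norm_blinfun[of "P t" u] P mult_right_mono[of "norm (P t)" 1 "norm u"]
  unfolding contraction_semigroup_def by fastforce

lemma sg_near:
  assumes "e > 0"
  obtains d where "d > 0" "\<And>t. 0 \<le> t \<Longrightarrow> t \<le> d \<Longrightarrow> norm (P t u - u) < e"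
proof -
  have "eventually (\<lambda>t. dist (P t u) u < e) (at_right 0)"
    using tendstoD[OF sg_tendsto assms] .
  then obtain b where b: "b > 0" "\<And>t. 0 < t \<Longrightarrow> t < b \<Longrightarrow> norm (P t u - u) < e"
    by (auto simp: eventually_at_right_field dist_norm)
  show ?thesis
  proof (rule that[of "b / 2"])
    show "norm (P t u - u) < e" if "0 \<le> t" "t \<le> b / 2" for t
      using b assms that by (cases "t = 0") (auto simp: sg_0)
  qed (use b in auto)
qed

text \<open>For s \<le> t the contraction \<open>P s\<close> reduces the difference to that between
  \<open>P (t - s) u\<close> and u, which settles both sides of a point.\<close>

lemma sg_continuous: "continuous_on {0..} (\<lambda>t. P t u)"
  unfolding continuous_on_iff
proof (intro ballI allI impI)
  fix s e :: real
  assume "s \<in> {0..}" "e > 0"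
  obtain d where d: "d > 0" "\<And>t. 0 \<le> t \<Longrightarrow> t \<le> d \<Longrightarrow> norm (P t u - u) < e"
    using sg_near[OF \<open>e > 0\<close>] by metis
  have *: "dist (P s u) (P t u) < e" if "0 \<le> s" "s \<le> t" "t - s < d" for s t
  proof -
    have "P t u - P s u = P s (P (t - s) u - u)"
      using sg_add[of s "t - s" u] that by (simp add: blinfun.bilinear_simps)
    then have "norm (P t u - P s u) \<le> norm (P (t - s) u - u)"
      using sg_norm_le that by simp
    also have "\<dots> < e" using d that by auto
    finally show ?thesis by (simp add: dist_norm norm_minus_commute)
  qed
  show "\<exists>d>0. \<forall>t\<in>{0..}. dist t s < d \<longrightarrow> dist (P t u) (P s u) < e"
  proof (intro exI[of _ d] conjI ballI impI)
    fix t :: real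
    assume "t \<in> {0..}" "dist t s < d"
    then show "dist (P t u) (P s u) < e"
      using *[of s t] *[of t s] \<open>s \<in> {0..}\<close> by (cases "s \<le> t") (auto simp: dist_real_def dist_commute)
  qed (rule d)
qed

text \<open>A telescoping sum takes the place of the integral formula for P h u - u: on a grid of
  mesh \<tau> each step contributes \<tau> v up to \<tau> (e + \<omega>), where e comes from the
  difference quotient at 0 and \<omega> from comparing P s v with v.\<close>

lemma generator_taylor:
  assumes uv: "(u, v) \<in> generator P" and "h > 0"
    and \<omega>: "\<And>s. 0 \<le> s \<Longrightarrow> s \<le> h \<Longrightarrow> norm (P s v - v) \<le> \<omega>"
  shows "norm (P h u - u - h *\<^sub>R v) \<le> h * \<omega>"
proof (rule field_le_epsilon)
  fix e' :: real
  assume "e' > 0"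
  define e where "e = e' / h"
  have e: "e > 0" using \<open>e' > 0\<close> \<open>h > 0\<close> by (simp add: e_def)
  have "eventually (\<lambda>t. dist ((P t u - u) /\<^sub>R t) v < e) (at_right 0)"
    using uv tendstoD[OF _ e] by (simp add: generator_def)
  then obtain d where d: "d > 0" "\<And>t. 0 < t \<Longrightarrow> t < d \<Longrightarrow> dist ((P t u - u) /\<^sub>R t) v < e"
    by (auto simp: eventually_at_right_field)
  obtain n :: nat where "h / d < n" using reals_Archimedean2 by blast
  define \<tau> where "\<tau> = h / n"
  have n: "n > 0" using \<open>h / d < n\<close> \<open>h > 0\<close> d(1) by (auto intro!: gr0I simp: field_simps)
  then have \<tau>: "\<tau> > 0" "\<tau> < d" "real n * \<tau> = h"
    using \<open>h / d < n\<close> \<open>h > 0\<close> d(1) by (auto simp: \<tau>_def field_simps)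
  have step: "norm (P \<tau> u - u - \<tau> *\<^sub>R v) \<le> \<tau> * e"
  proof -
    have "P \<tau> u - u - \<tau> *\<^sub>R v = \<tau> *\<^sub>R ((P \<tau> u - u) /\<^sub>R \<tau> - v)"
      using \<tau> by (simp add: scaleR_diff_right)
    then have "norm (P \<tau> u - u - \<tau> *\<^sub>R v) = \<tau> * dist ((P \<tau> u - u) /\<^sub>R \<tau>) v"
      using \<tau> by (simp add: dist_norm)
    also have "\<dots> \<le> \<tau> * e" using d(2)[OF \<tau>(1,2)] \<tau> by (intro mult_left_mono) auto
    finally show ?thesis .
  qed
  have "norm (P (real j * \<tau>) u - u - (real j * \<tau>) *\<^sub>R v) \<le> real j * (\<tau> * (e + \<omega>))" if "j \<le> n" for j :: nat
    using that
  proof (induction j)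
    case 0
    then show ?case by (simp add: sg_0)
  next
    case (Suc j)
    have j\<tau>: "0 \<le> real j * \<tau>" "real j * \<tau> \<le> h"
      using \<tau> Suc.prems mult_right_mono[of "real j" "real n" \<tau>] by auto
    have "P (real (Suc j) * \<tau>) u = P (real j * \<tau>) (P \<tau> u)"
      using sg_add[of "real j * \<tau>" \<tau> u] \<tau> j\<tau> by (simp add: algebra_simps)
    then have "P (real (Suc j) * \<tau>) u - u - (real (Suc j) * \<tau>) *\<^sub>R v = (P (real j * \<tau>) u - u - (real j * \<tau>) *\<^sub>R v)
        + P (real j * \<tau>) (P \<tau> u - u - \<tau> *\<^sub>R v) + \<tau> *\<^sub>R (P (real j * \<tau>) v - v)"
      by (simp add: blinfun.bilinear_simps algebra_simps)
    also have "norm \<dots> \<le> real j * (\<tau> * (e + \<omega>)) + \<tau> * e + \<tau> * \<omega>"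
      using Suc j\<tau> \<tau> order_trans[OF sg_norm_le step] \<omega>[OF j\<tau>]
      by (intro norm_add_rule_thm) (auto intro!: mult_left_mono)
    finally show ?case by (simp add: algebra_simps)
  qed
  from this[of n] have "norm (P h u - u - h *\<^sub>R v) \<le> real n * \<tau> * (e + \<omega>)"
    by (simp add: \<tau> mult.assoc[symmetric])
  also have "\<dots> = h * \<omega> + h * e" unfolding \<tau> by (simp add: algebra_simps)
  finally show "norm (P h u - u - h *\<^sub>R v) \<le> h * \<omega> + e'"
    using \<open>h > 0\<close> by (simp add: e_def)
qed

text \<open>The mean of P r u over 0 \<le> r \<le> s is close to u for small s and lies in the
  domain, with generator value (P s u - u)/s.\<close>

lemma generator_dense:
  assumes "e > 0"
  obtains w z where "(w, z) \<in> generator P" "norm (u - w) < e"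
proof -
  obtain s where s: "s > 0" "\<And>t. 0 \<le> t \<Longrightarrow> t \<le> s \<Longrightarrow> norm (P t u - u) < e / 2"
    using sg_near[of "e / 2"] assms by (metis half_gt_zero)
  define F where "F t = integral {0..t} (\<lambda>r. P r u)" for t
  have int: "(\<lambda>r. P r u) integrable_on {a..b}" if "a \<ge> 0" for a b
    using that by (intro integrable_continuous_interval continuous_on_subset[OF sg_continuous]) auto
  have F_diff: "F (t + h) - F t = integral {t..t + h} (\<lambda>r. P r u)" if "0 \<le> t" "0 \<le> h" for t h
    unfolding F_def using that Henstock_Kurzweil_Integration.integral_combine[of 0 t "t + h" "\<lambda>r. P r u"] int[of 0 "t + h"]
    by (simp add: algebra_simps)
  have mean: "norm (F (t + h) - F t - h *\<^sub>R P t u) \<le> e' * h"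
    if "0 \<le> t" "0 \<le> h" and e': "\<And>r. 0 \<le> r \<Longrightarrow> r \<le> h \<Longrightarrow> norm (P r u - u) \<le> e'" for t h e'
  proof -
    have "F (t + h) - F t - h *\<^sub>R P t u = integral {t..t + h} (\<lambda>r. P r u - P t u)"
    proof -
      have "integral {t..t + h} (\<lambda>r. P r u - P t u) = integral {t..t + h} (\<lambda>r. P r u) - integral {t..t + h} (\<lambda>r. P t u)"
        using that int by (intro Henstock_Kurzweil_Integration.integral_diff) auto
      also have "integral {t..t + h} (\<lambda>r. P t u) = h *\<^sub>R P t u"
        using integral_unique[OF has_integral_const_real[of "P t u" t "t + h"]] that by simp
      finally show ?thesis using that by (simp add: F_diff)
    qed
    also have "norm \<dots> \<le> e' * (t + h - t)"
    proof (rule integral_bound)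
      show "continuous_on {t..t + h} (\<lambda>r. P r u - P t u)"
        using that by (intro continuous_intros continuous_on_subset[OF sg_continuous]) auto
      fix r
      assume "r \<in> {t..t + h}"
      then have "P r u - P t u = P t (P (r - t) u - u)"
        using sg_add[of t "r - t" u] that by (simp add: blinfun.bilinear_simps)
      then show "norm (P r u - P t u) \<le> e'"
        using sg_norm_le[OF that(1)] e'[of "r - t"] \<open>r \<in> {t..t + h}\<close> by (auto intro: order_trans)
    qed (use that in auto)
    finally show ?thesis by simp
  qed
  have quot: "((\<lambda>h. (F (t + h) - F t) /\<^sub>R h) \<longlongrightarrow> P t u) (at_right 0)" if "0 \<le> t" for t
  proof (rule tendstoI)
    fix e' :: real
    assume "e' > 0"
    then obtain d where d: "d > 0" "\<And>r. 0 \<le> r \<Longrightarrow> r \<le> d \<Longrightarrow> norm (P r u - u) < e' / 2"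
      using sg_near[of "e' / 2"] by (metis half_gt_zero)
    have "dist ((F (t + h) - F t) /\<^sub>R h) (P t u) < e'" if "0 < h" "h < d" for h
    proof -
      have "(F (t + h) - F t) /\<^sub>R h - P t u = (F (t + h) - F t - h *\<^sub>R P t u) /\<^sub>R h"
        using that by (simp add: scaleR_diff_right)
      then have "dist ((F (t + h) - F t) /\<^sub>R h) (P t u) = norm (F (t + h) - F t - h *\<^sub>R P t u) / h"
        using that by (simp add: dist_norm divide_inverse_commute)
      also have "\<dots> \<le> e' / 2"
        using mean[of t h "e' / 2"] that \<open>0 \<le> t\<close> d(2) by (force simp: field_simps intro: less_imp_le)
      finally show ?thesis using \<open>e' > 0\<close> by simp
    qed
    then show "\<forall>\<^sub>F h in at_right 0. dist ((F (t + h) - F t) /\<^sub>R h) (P t u) < e'"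
      unfolding eventually_at_right_field using d(1) by blast
  qed
  have shift: "P h (F s) = F (s + h) - F h" if "h > 0" for h
  proof -
    have "P h (F s) = integral {0..s} (\<lambda>r. P h (P r u))"
      unfolding F_def using s integral_linear[OF int blinfun.bounded_linear_right, of 0 s "P h"] by (simp add: o_def)
    also have "\<dots> = integral {0..s} (\<lambda>r. P (r + h) u)"
      using that by (intro integral_cong) (simp add: sg_add[symmetric] add.commute)
    also have "\<dots> = integral {h..s + h} (\<lambda>r. P r u)"
      using integral_shift_Icc_real[of 0 s "\<lambda>r. P r u" h] by (simp add: o_def add.commute)
    also have "\<dots> = F (s + h) - F h"
      using F_diff[of h s] that s by (simp add: add.commute)
    finally show ?thesis .
  qed
  have F0: "F 0 = 0" by (simp add: F_def)
  define w where "w = F s /\<^sub>R s"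
  have "((\<lambda>h. ((F (s + h) - F s) /\<^sub>R h - (F (0 + h) - F 0) /\<^sub>R h) /\<^sub>R s) \<longlongrightarrow> (P s u - P 0 u) /\<^sub>R s) (at_right 0)"
    using s(1) by (intro tendsto_intros quot) auto
  then have "((\<lambda>h. (P h w - w) /\<^sub>R h) \<longlongrightarrow> (P s u - P 0 u) /\<^sub>R s) (at_right 0)"
  proof (rule Lim_transform_eventually)
    show "\<forall>\<^sub>F h in at_right 0. ((F (s + h) - F s) /\<^sub>R h - (F (0 + h) - F 0) /\<^sub>R h) /\<^sub>R s = (P h w - w) /\<^sub>R h"
      unfolding eventually_at_right_field
      by (intro exI[of _ 1]) (auto simp: w_def shift F0 blinfun.bilinear_simps algebra_simps)
  qed
  then have "(w, (P s u - P 0 u) /\<^sub>R s) \<in> generator P" by (simp add: generator_def)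
  moreover have "norm (u - w) < e"
  proof -
    have "norm (F s - s *\<^sub>R u) \<le> e / 2 * s"
      using mean[of 0 s "e / 2"] s by (auto simp: F0 sg_0 intro: less_imp_le)
    then have "norm (F s - s *\<^sub>R u) / s \<le> e / 2" using s by (simp add: field_simps)
    moreover have "u - w = - ((F s - s *\<^sub>R u) /\<^sub>R s)" using s by (simp add: w_def scaleR_diff_right)
    moreover have "norm ((F s - s *\<^sub>R u) /\<^sub>R s) = norm (F s - s *\<^sub>R u) / s"
      using s(1) by (simp add: divide_inverse_commute)
    ultimately have "norm (u - w) \<le> e / 2" by (simp only: norm_minus_cancel)
    then show ?thesis using assms by simp
  qed
  ultimately show ?thesis by (rule that)
qed

lemma generator_semigroup:
  assumes "(u, v) \<in> generator P" "s \<ge> 0"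
  shows "(P s u, P s v) \<in> generator P"
proof -
  have "((\<lambda>t. P s ((P t u - u) /\<^sub>R t)) \<longlongrightarrow> P s v) (at_right 0)"
    using assms(1) by (intro tendsto_intros) (auto simp: generator_def)
  then have "((\<lambda>t. (P t (P s u) - P s u) /\<^sub>R t) \<longlongrightarrow> P s v) (at_right 0)"
  proof (rule Lim_transform_eventually)
    show "\<forall>\<^sub>F t in at_right 0. P s ((P t u - u) /\<^sub>R t) = (P t (P s u) - P s u) /\<^sub>R t"
      unfolding eventually_at_right_field using assms
      by (intro exI[of _ 1]) (auto simp: blinfun.bilinear_simps sg_add[symmetric] add.commute)
  qed
  then show ?thesis by (simp add: generator_def)
qed

text \<open>Convergence of the approximate resolvents on the range of \<open>1 - h A\<close> suffices, because
  \<open>P h u\<close> lies in the domain of the generator.\<close>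

lemma resolvent_powers_tendsto:
  fixes R :: "real \<Rightarrow> real \<Rightarrow> 'b \<Rightarrow> 'b"
  assumes contr: "\<And>\<epsilon> h g g'. \<epsilon> > 0 \<Longrightarrow> h > 0 \<Longrightarrow> norm (R \<epsilon> h g - R \<epsilon> h g') \<le> norm (g - g')"
    and lim: "\<And>h w z. h > 0 \<Longrightarrow> (w, z) \<in> generator P \<Longrightarrow> ((\<lambda>\<epsilon>. R \<epsilon> h (w - h *\<^sub>R z)) \<longlongrightarrow> w) (at_right 0)"
    and "t > 0" "\<delta> > 0"
  shows "\<forall>\<^sub>F n in sequentially. \<forall>\<^sub>F \<epsilon> in at_right 0. norm ((R \<epsilon> (t / real n) ^^ n) u - P t u) < \<delta>"
proof -
  have pos: "\<forall>\<^sub>F \<epsilon> :: real in at_right 0. \<epsilon> > 0"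
    by (rule eventually_at_right_less)
  have dom: "\<forall>\<^sub>F n in sequentially. \<forall>\<^sub>F \<epsilon> in at_right 0. norm ((R \<epsilon> (t / real n) ^^ n) u - P t u) < \<delta>"
    if uv: "(u, v) \<in> generator P" and "\<delta> > 0" for u v \<delta>
  proof -
    \<comment> \<open>With this choice the n consistency errors 2 h \<omega> add up to \<delta>/2
      and the n resolvent errors \<delta>/(4 n) to \<delta>/4, which stays below \<delta>.\<close>
    define \<omega> where "\<omega> = \<delta> / (4 * t)"
    have "\<omega> > 0" using that \<open>t > 0\<close> by (simp add: \<omega>_def)
    then obtain h0 where h0: "h0 > 0" "\<And>s. 0 \<le> s \<Longrightarrow> s \<le> h0 \<Longrightarrow> norm (P s v - v) < \<omega>"
      using sg_near[OF \<open>\<omega> > 0\<close>] by metis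
    have "\<forall>\<^sub>F n in sequentially. real n > t / h0"
      using filterlim_real_sequentially unfolding filterlim_at_top_dense by blast
    with eventually_gt_at_top[of "0::nat"] show ?thesis
    proof eventually_elim
      case (elim n)
      define h where "h = t / n"
      have h: "h > 0" "h \<le> h0" "real n * h = t"
        using elim \<open>t > 0\<close> h0 by (auto simp: h_def field_simps)
      \<comment> \<open>Backward consistency: with A the generator, u differs from (1 - h A) P h u
        by at most 2 h \<omega>, and on vectors of the latter form the approximate resolvents
        converge.\<close>
      have taylor: "norm (u - (P h u - h *\<^sub>R P h v)) \<le> 2 * h * \<omega>"
      proof -
        have "norm (P h u - u - h *\<^sub>R v) \<le> h * \<omega>"
          using h h0 by (intro generator_taylor[OF uv]) (auto intro: less_imp_le)
        moreover have "norm (h *\<^sub>R (P h v - v)) \<le> h * \<omega>"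
          using h h0(2)[of h] by simp
        ultimately have "norm ((P h u - u - h *\<^sub>R v) - h *\<^sub>R (P h v - v)) \<le> 2 * h * \<omega>"
          using norm_triangle_ineq4[of "P h u - u - h *\<^sub>R v" "h *\<^sub>R (P h v - v)"] by linarith
        moreover have "(P h u - u - h *\<^sub>R v) - h *\<^sub>R (P h v - v) = - (u - (P h u - h *\<^sub>R P h v))"
          by (simp add: algebra_simps)
        ultimately show ?thesis by (simp only: norm_minus_cancel)
      qed
      have "\<forall>\<^sub>F \<epsilon> in at_right 0. \<forall>i\<in>{..<n}. norm (R \<epsilon> h (P (real (Suc i) * h) u - h *\<^sub>R P (real (Suc i) * h) v) - P (real (Suc i) * h) u) < \<delta> / (4 * real n)"
      \<comment> \<open>For fixed n only n vectors have to be approximated, so one threshold for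
        \<epsilon> serves them all. It depends on n, which dictates the order of the limits.\<close>
      proof (intro eventually_ball_finite ballI)
        fix i
        have "(P (real (Suc i) * h) u, P (real (Suc i) * h) v) \<in> generator P"
          using h by (intro generator_semigroup uv) auto
        from tendstoD[OF lim[OF h(1) this], of "\<delta> / (4 * real n)"]
        show "\<forall>\<^sub>F \<epsilon> in at_right 0. norm (R \<epsilon> h (P (real (Suc i) * h) u - h *\<^sub>R P (real (Suc i) * h) v) - P (real (Suc i) * h) u) < \<delta> / (4 * real n)"
          using elim \<open>\<delta> > 0\<close> by (simp add: dist_norm)
      qed simp
      with pos show ?case
      proof eventually_elim
        case (elim \<epsilon>)
        have "norm ((R \<epsilon> h ^^ i) u - P (real i * h) u) \<le> real i * (2 * h * \<omega> + \<delta> / (4 * real n))" if "i \<le> n" for i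
          using that
        proof (induction i)
          case 0
          then show ?case by (simp add: sg_0)
        next
          case (Suc i)
          let ?w = "P (real (Suc i) * h) u" and ?z = "P (real (Suc i) * h) v"
          have eq: "P (real i * h) (P h x) = P (real (Suc i) * h) x" for x
            using sg_add[of "real i * h" h x] h by (simp add: algebra_simps)
          have 1: "norm (R \<epsilon> h ((R \<epsilon> h ^^ i) u) - R \<epsilon> h (P (real i * h) u)) \<le> norm ((R \<epsilon> h ^^ i) u - P (real i * h) u)"
            using elim h by (intro contr)
          have "norm (R \<epsilon> h (P (real i * h) u) - R \<epsilon> h (?w - h *\<^sub>R ?z)) \<le> norm (P (real i * h) u - (?w - h *\<^sub>R ?z))"
            using elim h by (intro contr)
          also have "P (real i * h) u - (?w - h *\<^sub>R ?z) = P (real i * h) (u - (P h u - h *\<^sub>R P h v))"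
            by (simp add: blinfun.bilinear_simps eq)
          also have "norm \<dots> \<le> 2 * h * \<omega>"
            using h by (intro order_trans[OF sg_norm_le taylor]) auto
          finally have 2: "norm (R \<epsilon> h (P (real i * h) u) - R \<epsilon> h (?w - h *\<^sub>R ?z)) \<le> 2 * h * \<omega>" .
          have 3: "norm (R \<epsilon> h (?w - h *\<^sub>R ?z) - ?w) \<le> \<delta> / (4 * real n)"
            using elim Suc.prems by (auto intro: less_imp_le)
          have "(R \<epsilon> h ^^ Suc i) u - ?w = (R \<epsilon> h ((R \<epsilon> h ^^ i) u) - R \<epsilon> h (P (real i * h) u))
            + (R \<epsilon> h (P (real i * h) u) - R \<epsilon> h (?w - h *\<^sub>R ?z)) + (R \<epsilon> h (?w - h *\<^sub>R ?z) - ?w)"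
            by simp
          then have "norm ((R \<epsilon> h ^^ Suc i) u - ?w) \<le> norm (R \<epsilon> h ((R \<epsilon> h ^^ i) u) - R \<epsilon> h (P (real i * h) u))
            + norm (R \<epsilon> h (P (real i * h) u) - R \<epsilon> h (?w - h *\<^sub>R ?z)) + norm (R \<epsilon> h (?w - h *\<^sub>R ?z) - ?w)"
            by (metis norm_triangle_mono norm_triangle_ineq order_refl)
          moreover have "norm ((R \<epsilon> h ^^ i) u - P (real i * h) u) \<le> real i * (2 * h * \<omega> + \<delta> / (4 * real n))"
            using Suc by simp
          moreover have "real (Suc i) * (2 * h * \<omega> + \<delta> / (4 * real n))
            = real i * (2 * h * \<omega> + \<delta> / (4 * real n)) + (2 * h * \<omega> + \<delta> / (4 * real n))"
            by (simp only: of_nat_Suc distrib_right mult_1_left add.commute)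
          ultimately show ?case using 1 2 3 by linarith
        qed
        from this[of n] have "norm ((R \<epsilon> h ^^ n) u - P t u) \<le> real n * (2 * h * \<omega> + \<delta> / (4 * real n))"
          by (simp add: h)
        moreover have "real n * (2 * h * \<omega> + \<delta> / (4 * real n)) = 3 / 4 * \<delta>"
          using \<open>0 < n\<close> \<open>t > 0\<close> by (simp add: h_def \<omega>_def field_simps)
        ultimately have "norm ((R \<epsilon> h ^^ n) u - P t u) < \<delta>" using \<open>\<delta> > 0\<close> by linarith
        then show ?case by (simp add: h_def)
      qed
    qed
  qed
  \<comment> \<open>Resolvent powers and \<open>P t\<close> are contractions, so replacing u by a
    nearby element of the domain costs \<delta>/3 twice.\<close>
  obtain w z where wz: "(w, z) \<in> generator P" "norm (u - w) < \<delta> / 3"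
    using generator_dense[of "\<delta> / 3"] \<open>\<delta> > 0\<close> by (metis divide_pos_pos zero_less_numeral)
  have "\<forall>\<^sub>F n in sequentially. \<forall>\<^sub>F \<epsilon> in at_right 0. norm ((R \<epsilon> (t / real n) ^^ n) w - P t w) < \<delta> / 3"
    using \<open>\<delta> > 0\<close> by (intro dom[OF wz(1)]) simp
  with eventually_gt_at_top[of "0::nat"] show ?thesis
  proof eventually_elim
    case (elim n)
    from elim(2) pos show ?case
    proof eventually_elim
      case (elim \<epsilon>)
      have stable: "norm ((R \<epsilon> (t / real n) ^^ i) u - (R \<epsilon> (t / real n) ^^ i) w) \<le> norm (u - w)" for i
        using \<open>0 < n\<close> \<open>t > 0\<close> elim by (induction i) (auto intro: order_trans[OF contr])
      have "norm (P t (w - u)) \<le> norm (u - w)"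
        using sg_norm_le[of t "w - u"] \<open>t > 0\<close> by (simp add: norm_minus_commute)
      moreover have "(R \<epsilon> (t / real n) ^^ n) u - P t u = ((R \<epsilon> (t / real n) ^^ n) u - (R \<epsilon> (t / real n) ^^ n) w)
          + ((R \<epsilon> (t / real n) ^^ n) w - P t w) + P t (w - u)"
        by (simp add: blinfun.diff_right)
      then have "norm ((R \<epsilon> (t / real n) ^^ n) u - P t u) \<le> norm ((R \<epsilon> (t / real n) ^^ n) u - (R \<epsilon> (t / real n) ^^ n) w)
          + norm ((R \<epsilon> (t / real n) ^^ n) w - P t w) + norm (P t (w - u))"
        by (metis norm_triangle_mono norm_triangle_ineq order_refl)
      ultimately show ?case
        using elim(1) wz(2) stable[of n] by linarith
    qed
  qed
qed

end


section \<open>Truncation of the kernel\<close>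

definition truncated_kernel :: "('a::euclidean_space \<Rightarrow> 'a \<Rightarrow> ennreal) \<Rightarrow> real \<Rightarrow> 'a \<Rightarrow> 'a \<Rightarrow> real"
  where "truncated_kernel f \<epsilon> x y = indicator {y. norm (y - x) > \<epsilon>} y * enn2real (f x y)"

lemma gen_truncated_kernel:
  "gen (truncated_kernel f \<epsilon>) \<phi> x = (LINT y:{y. norm (y - x) > \<epsilon>}|lborel. (\<phi> y - \<phi> x) * enn2real (f x y))"
  unfolding gen_def set_lebesgue_integral_def truncated_kernel_def
  by (intro Bochner_Integration.integral_cong) auto

lemma compact_image_norm_bound:
  fixes g :: "'b \<Rightarrow> 'c::real_normed_vector"
  assumes "compact (g ` K)"
  obtains B where "\<And>x. x \<in> K \<Longrightarrow> norm (g x) \<le> B"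
  using compact_imp_bounded[OF assms] by (auto simp: bounded_iff)

text \<open>Both derivatives are continuous and vanish off the compact support, hence are bounded.
  The second difference follows from the mean value inequality for s \<mapsto> \<phi> (x + s) +
  \<phi> (x - s), whose derivative has norm at most 2 B |s|.\<close>

lemma C2_c_increment_bounds:
  fixes \<phi> :: "'a::euclidean_space \<Rightarrow> real"
  assumes "\<phi> \<in> C2_c"
  obtains B where "B \<ge> 0"
    "\<And>x h. \<bar>\<phi> (x + h) - \<phi> x\<bar> \<le> B * norm h"
    "\<And>x h. \<bar>\<phi> (x + h) + \<phi> (x - h) - 2 * \<phi> x\<bar> \<le> 2 * B * (norm h)\<^sup>2"
proof -
  obtain \<phi>' :: "'a \<Rightarrow> 'a \<Rightarrow>\<^sub>L real" and \<phi>'' :: "'a \<Rightarrow> 'a \<Rightarrow>\<^sub>L 'a \<Rightarrow>\<^sub>L real" where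
    d1: "\<And>x. (\<phi> has_derivative \<phi>' x) (at x)" and
    d2: "\<And>x. (\<phi>' has_derivative \<phi>'' x) (at x)" and
    c2: "continuous_on UNIV \<phi>''" and K: "compact (closure {x. \<phi> x \<noteq> 0})"
    using assms unfolding C2_c_def by auto
  define K where "K = closure {x. \<phi> x \<noteq> 0}"
  have c1: "continuous_on UNIV \<phi>'"
    using d2 by (meson continuous_at_imp_continuous_on has_derivative_continuous)
  have zero: "\<phi> x = 0" if "x \<in> - K" for x
    using that closure_subset[of "{x. \<phi> x \<noteq> 0}"] by (auto simp: K_def)
  have openK: "open (- K)" unfolding K_def by (rule open_Compl) simp
  have z1: "\<phi>' x = 0" if "x \<in> - K" for x
  proof -
    have "(\<phi> has_derivative (\<lambda>_. 0)) (at x)"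
      by (rule has_derivative_transform_within_open[OF has_derivative_const openK that]) (simp add: zero)
    then have "blinfun_apply (\<phi>' x) = (\<lambda>_. 0)"
      using d1 has_derivative_unique by blast
    then show ?thesis by (intro blinfun_eqI) simp
  qed
  have z2: "\<phi>'' x = 0" if "x \<in> - K" for x
  proof -
    have "(\<phi>' has_derivative (\<lambda>_. 0)) (at x)"
      by (rule has_derivative_transform_within_open[OF has_derivative_const openK that]) (simp add: z1)
    then have "blinfun_apply (\<phi>'' x) = (\<lambda>_. 0)"
      using d2 has_derivative_unique by blast
    then show ?thesis by (intro blinfun_eqI) simp
  qed
  have img: "compact (\<phi>' ` K)" "compact (\<phi>'' ` K)"
    using K c1 c2 by (auto simp: K_def intro!: compact_continuous_image intro: continuous_on_subset)
  obtain B1 where B1': "\<And>x. x \<in> K \<Longrightarrow> norm (\<phi>' x) \<le> B1"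
    using compact_image_norm_bound[OF img(1)] by blast
  obtain B2 where B2': "\<And>x. x \<in> K \<Longrightarrow> norm (\<phi>'' x) \<le> B2"
    using compact_image_norm_bound[OF img(2)] by blast
  define B where "B = max 0 (max B1 B2)"
  have "B \<ge> 0" by (simp add: B_def)
  have B1: "norm (\<phi>' x) \<le> B" for x
    using B1'[of x] z1[of x] by (cases "x \<in> K") (auto simp: B_def)
  have B2: "norm (\<phi>'' x) \<le> B" for x
    using B2'[of x] z2[of x] by (cases "x \<in> K") (auto simp: B_def)
  have first: "\<bar>\<phi> (x + h) - \<phi> x\<bar> \<le> B * norm h" for x h
    using differentiable_bound[of UNIV \<phi> "\<lambda>x. blinfun_apply (\<phi>' x)" B "x + h" x] d1 B1
    by (auto simp: norm_blinfun.rep_eq[symmetric])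
  have lip: "norm (\<phi>' x - \<phi>' y) \<le> B * norm (x - y)" for x y
    using differentiable_bound[of UNIV \<phi>' "\<lambda>x. blinfun_apply (\<phi>'' x)" B x y] d2 B2
    by (auto simp: norm_blinfun.rep_eq[symmetric])
  have second: "\<bar>\<phi> (x + h) + \<phi> (x - h) - 2 * \<phi> x\<bar> \<le> 2 * B * (norm h)\<^sup>2" for x h
  proof -
    have d: "((\<lambda>s. \<phi> (x + s) + \<phi> (x - s)) has_derivative blinfun_apply (\<phi>' (x + s) - \<phi>' (x - s))) (at s within cball 0 (norm h))" for s
    proof -
      have "((\<lambda>s. \<phi> (x + s)) has_derivative (\<lambda>t. \<phi>' (x + s) t)) (at s)"
        by (rule has_derivative_compose[OF _ d1, where f="\<lambda>s. x + s" and f'="\<lambda>t. t"]) (auto intro!: derivative_eq_intros)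
      moreover have "((\<lambda>s. \<phi> (x - s)) has_derivative (\<lambda>t. \<phi>' (x - s) (- t))) (at s)"
        by (rule has_derivative_compose[OF _ d1, where f="\<lambda>s. x - s" and f'="\<lambda>t. - t"]) (auto intro!: derivative_eq_intros)
      ultimately have "((\<lambda>s. \<phi> (x + s) + \<phi> (x - s)) has_derivative (\<lambda>t. \<phi>' (x + s) t + \<phi>' (x - s) (- t))) (at s)"
        by (rule has_derivative_add)
      then show ?thesis
        by (auto intro!: has_derivative_at_withinI simp: blinfun.bilinear_simps fun_eq_iff elim!: has_derivative_eq_rhs)
    qed
    have "norm ((\<phi> (x + h) + \<phi> (x - h)) - (\<phi> (x + 0) + \<phi> (x - 0))) \<le> (2 * B * norm h) * norm (h - 0)"
    proof (rule differentiable_bound[OF convex_cball d])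
      fix s :: 'a
      assume "s \<in> cball 0 (norm h)"
      then have "norm s \<le> norm h" by simp
      have "norm (\<phi>' (x + s) - \<phi>' (x - s)) \<le> B * norm ((x + s) - (x - s))" by (rule lip)
      also have "(x + s) - (x - s) = 2 *\<^sub>R s" by (simp add: scaleR_2)
      also have "B * norm (2 *\<^sub>R s) \<le> 2 * B * norm h"
        using \<open>norm s \<le> norm h\<close> \<open>B \<ge> 0\<close> by (simp add: mult_left_mono)
      finally show "onorm (blinfun_apply (\<phi>' (x + s) - \<phi>' (x - s))) \<le> 2 * B * norm h"
        by (simp add: norm_blinfun.rep_eq)
    qed auto
    then show ?thesis by (simp add: power2_eq_square mult_ac)
  qed
  show ?thesis by (rule that[OF \<open>B \<ge> 0\<close> first second])
qed

locale stable_like =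
  fixes f :: "'a::euclidean_space \<Rightarrow> 'a \<Rightarrow> ennreal" and \<alpha> M :: real
  assumes alpha: "0 < \<alpha>" "\<alpha> < 2" and M: "0 < M"
    and f_measurable: "(\<lambda>(x, y). f x y) \<in> borel_measurable borel"
    and f_le: "y \<noteq> x \<Longrightarrow> f x y \<le> ennreal (M * norm (y - x) powr (- \<alpha> - real DIM('a)))"
    and dir: "(\<forall>x h. f x (x + h) = f x (x - h)) \<or> \<alpha> < 1"
    and f_sym: "f x y = f y x"
    and f_cont: "continuous_on (- {y}) (\<lambda>x. f x y)"
begin

lemma enn2real_f_le: "y \<noteq> x \<Longrightarrow> enn2real (f x y) \<le> M * norm (y - x) powr (- \<alpha> - DIM('a))"
  using f_le M by (intro enn2real_leI) auto

lemma truncated_kernel_le: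
  assumes "\<epsilon> > 0"
  shows "truncated_kernel f \<epsilon> x y \<le> M * norm (y - x) powr (- \<alpha> - DIM('a))"
  using enn2real_f_le[of y x] M assms by (cases "y = x"; cases "norm (y - x) > \<epsilon>") (auto simp: truncated_kernel_def)

lemma truncated_kernel_symmetric:
  assumes "\<forall>x h. f x (x + h) = f x (x - h)"
  shows "truncated_kernel f \<epsilon> x (x + h) = truncated_kernel f \<epsilon> x (x - h)"
  using assms by (simp add: truncated_kernel_def indicator_def)

lemma jump_kernel_truncated:
  assumes "\<epsilon> > 0"
  shows "jump_kernel (truncated_kernel f \<epsilon>) \<alpha> M \<epsilon>"
proof
  have [measurable]: "(\<lambda>z. f (fst z) (snd z)) \<in> borel_measurable (borel \<Otimes>\<^sub>M borel)"
    using f_measurable by (simp add: borel_prod case_prod_beta')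
  show "(\<lambda>(x, y). truncated_kernel f \<epsilon> x y) \<in> borel_measurable (borel \<Otimes>\<^sub>M borel)"
    unfolding truncated_kernel_def case_prod_beta' by measurable
next
  fix x :: 'a
  have "AE y in lborel. y \<noteq> x"
    by (rule AE_lborel_singleton)
  \<comment> \<open>The indicator in the truncation jumps on this null set only; for other y
    \<noteq> x the truncated kernel agrees near x either with 0 or with f.\<close>
  moreover have "AE y in lborel. y \<notin> sphere x \<epsilon>"
  proof (rule AE_not_in)
    show "sphere x \<epsilon> \<in> null_sets lborel"
      using negligible_sphere[of x \<epsilon>]
      by (auto simp: null_sets_completion_iff negligible_iff_null_sets)
  qed
  ultimately show "AE y in lborel. isCont (\<lambda>x. truncated_kernel f \<epsilon> x y) x"
  proof eventually_elim
    case (elim y)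
    then consider "norm (y - x) < \<epsilon>" | "norm (y - x) > \<epsilon>"
      by (force simp: dist_norm norm_minus_commute)
    then show ?case
    proof cases
      case 1
      have "open {z. norm (y - z) < \<epsilon>}" by (intro open_Collect_less continuous_intros)
      then have "\<forall>\<^sub>F z in nhds x. truncated_kernel f \<epsilon> z y = 0"
        using 1 unfolding eventually_nhds by (intro exI[of _ "{z. norm (y - z) < \<epsilon>}"]) (auto simp: truncated_kernel_def)
      then show ?thesis by (subst isCont_cong) auto
    next
      case 2
      have "open {z. norm (y - z) > \<epsilon>}" by (intro open_Collect_less continuous_intros)
      then have ev: "\<forall>\<^sub>F z in nhds x. truncated_kernel f \<epsilon> z y = enn2real (f z y)"
        using 2 unfolding eventually_nhds by (intro exI[of _ "{z. norm (y - z) > \<epsilon>}"]) (auto simp: truncated_kernel_def)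
      have "((\<lambda>z. f z y) \<longlongrightarrow> f x y) (at x)"
        using f_cont[of y] elim continuous_on_eq_continuous_at[of "- {y}" "\<lambda>x. f x y"] by (auto simp: isCont_def open_Compl)
      then have "((\<lambda>z. enn2real (f z y)) \<longlongrightarrow> enn2real (f x y)) (at x)"
      proof (intro tendsto_enn2real)
        \<comment> \<open>\<open>enn2real\<close> is continuous only at finite values.\<close>
        have "f x y < top"
          using le_less_trans[OF f_le ennreal_less_top] elim by blast
        then show "((\<lambda>z. f z y) \<longlongrightarrow> ennreal (enn2real (f x y))) (at x)"
          using \<open>((\<lambda>z. f z y) \<longlongrightarrow> f x y) (at x)\<close> by simp
      qed simp
      then show ?thesis by (subst isCont_cong[OF ev]) (simp add: isCont_def)
    qed
  qed
qed (use assms alpha M truncated_kernel_le in \<open>auto simp: truncated_kernel_def f_sym norm_minus_commute indicator_def\<close>)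

text \<open>The difference of two truncations sees only jumps of length between \<epsilon>' and
  \<epsilon>. Second differences (p = 2) or, for \<alpha> < 1, first differences (p = 1) bound it by
  a multiple of \<epsilon>^(p - \<alpha>), uniformly in x.\<close>

lemma gen_truncated_Cauchy:
  fixes \<phi> :: "'a \<Rightarrow> real"
  assumes "\<phi> \<in> C2_c"
  obtains K \<gamma> where "\<gamma> > 0" "K \<ge> 0"
    "\<And>x \<epsilon> \<epsilon>'. 0 < \<epsilon>' \<Longrightarrow> \<epsilon>' < \<epsilon> \<Longrightarrow>
      \<bar>gen (truncated_kernel f \<epsilon>') \<phi> x - gen (truncated_kernel f \<epsilon>) \<phi> x\<bar> \<le> K * \<epsilon> powr \<gamma>"
proof -
  obtain B where B: "B \<ge> 0" "\<And>x h. \<bar>\<phi> (x + h) - \<phi> x\<bar> \<le> B * norm h"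
    "\<And>x h. \<bar>\<phi> (x + h) + \<phi> (x - h) - 2 * \<phi> x\<bar> \<le> 2 * B * (norm h)\<^sup>2"
    using C2_c_increment_bounds[OF assms] by metis
  define S where "S \<longleftrightarrow> (\<forall>x h. f x (x + h) = f x (x - h))"
  define p :: real where "p = (if S then 2 else 1)"
  have p: "p > \<alpha>" using dir alpha by (auto simp: p_def S_def)
  define K where "K = M * B * radial_const TYPE('a) (p - \<alpha>)"
  have K: "K \<ge> 0" using M B radial_const_pos[of "p - \<alpha>", where 'a='a] p by (simp add: K_def less_imp_le)
  have \<phi>_cont: "continuous_on UNIV \<phi>"
    using assms unfolding C2_c_def by (auto intro!: continuous_at_imp_continuous_on dest: has_derivative_continuous)
  then have [measurable]: "\<phi> \<in> borel_measurable borel" by (intro borel_measurable_continuous_onI)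
  have img: "compact (\<phi> ` closure {x. \<phi> x \<noteq> 0})"
    using assms \<phi>_cont by (auto simp: C2_c_def intro!: compact_continuous_image intro: continuous_on_subset)
  obtain b where "\<And>x. x \<in> closure {x. \<phi> x \<noteq> 0} \<Longrightarrow> norm (\<phi> x) \<le> b"
    by (rule compact_image_norm_bound[OF img]) auto
  then have b': "\<bar>\<phi> x\<bar> \<le> b" if "x \<in> closure {x. \<phi> x \<noteq> 0}" for x
    using that by simp
  have b: "\<bar>\<phi> x\<bar> \<le> max 0 b" for x
  proof (cases "\<phi> x = 0")
    case False
    then have "x \<in> closure {x. \<phi> x \<noteq> 0}" by (intro subsetD[OF closure_subset]) simp
    from b'[OF this] show ?thesis by (rule order_trans) (rule max.cobounded2)
  qed simp
  show ?thesis
  proof (rule that[of "p - \<alpha>" K])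
    fix x :: 'a and \<epsilon> \<epsilon>' :: real
    assume \<epsilon>: "0 < \<epsilon>'" "\<epsilon>' < \<epsilon>"
    define q where "q h = truncated_kernel f \<epsilon>' x (x + h) - truncated_kernel f \<epsilon> x (x + h)" for h
    interpret k: jump_kernel "truncated_kernel f \<epsilon>" \<alpha> M \<epsilon> using \<epsilon> by (intro jump_kernel_truncated) auto
    interpret k': jump_kernel "truncated_kernel f \<epsilon>'" \<alpha> M \<epsilon>' using \<epsilon> by (intro jump_kernel_truncated) auto
    have [measurable]: "q \<in> borel_measurable borel" unfolding q_def by measurable
    have q: "q h \<ge> 0" "q h \<le> M * norm h powr (- \<alpha> - DIM('a))" "norm h > \<epsilon> \<Longrightarrow> q h = 0" for h
      using \<epsilon> M k.k_nonneg[of x "x + h"] k'.k_le[of x "x + h"]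
      by (auto simp: q_def truncated_kernel_def indicator_def)
    have integrable: "integrable lborel (\<lambda>y. (\<phi> y - \<phi> x) * truncated_kernel f e x y)" if "e \<in> {\<epsilon>, \<epsilon>'}" for e
    proof -
      have "\<bar>\<phi> y - \<phi> x\<bar> \<le> 2 * max 0 b" for y using b[of x] b[of y] by linarith
      then show ?thesis using that
        by (auto intro!: k.integrable_bounded_k[of _ "2 * max 0 b"] k'.integrable_bounded_k[of _ "2 * max 0 b"])
    qed
    have diff: "gen (truncated_kernel f \<epsilon>') \<phi> x - gen (truncated_kernel f \<epsilon>) \<phi> x = (LINT h|lborel. (\<phi> (x + h) - \<phi> x) * q h)"
    proof -
      have "gen (truncated_kernel f \<epsilon>') \<phi> x - gen (truncated_kernel f \<epsilon>) \<phi> x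
        = (LINT y|lborel. (\<phi> y - \<phi> x) * truncated_kernel f \<epsilon>' x y - (\<phi> y - \<phi> x) * truncated_kernel f \<epsilon> x y)"
        unfolding gen_def by (intro Bochner_Integration.integral_diff[symmetric] integrable) auto
      also have "\<dots> = (LINT h|lborel. (\<phi> (x + h) - \<phi> x) * q h)"
        by (subst lborel_translate[of _ x]) (auto simp: q_def algebra_simps)
      finally show ?thesis .
    qed
    \<comment> \<open>The signs c = 1 and c = -1 turn the one-sided estimates for small jumps into a
      bound on the absolute value.\<close>
    have bound: "(LINT h|lborel. (c * (\<phi> (x + h) - \<phi> x)) * q h) \<le> K * \<epsilon> powr (p - \<alpha>)" if "\<bar>c\<bar> = 1" for c
    proof (cases S)
      case True
      show ?thesis unfolding K_def
      proof (rule small_jumps_symmetric_le)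
        show "q (- h) = q h" for h
          using True truncated_kernel_symmetric unfolding S_def q_def by (metis diff_conv_add_uminus minus_minus)
        show "c * (\<phi> (x + h) - \<phi> x) + c * (\<phi> (x + - h) - \<phi> x) \<le> 2 * B * norm h powr p" for h
        proof -
          have "c * (\<phi> (x + h) - \<phi> x) + c * (\<phi> (x + - h) - \<phi> x) \<le> \<bar>c * (\<phi> (x + h) + \<phi> (x - h) - 2 * \<phi> x)\<bar>"
            by (rule order_trans[OF _ abs_ge_self]) (simp add: algebra_simps)
          also have "\<dots> \<le> 2 * B * norm h powr p"
            using B(3)[of x h] that True by (simp add: abs_mult p_def powr_numeral)
          finally show ?thesis .
        qed
      qed (use p \<epsilon> B M q in auto)
    next
      case False
      show ?thesis unfolding K_def
      proof (rule small_jumps_le)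
        show "c * (\<phi> (x + h) - \<phi> x) \<le> B * norm h powr p" for h
          using B(2)[of x h] that False abs_ge_self[of "c * (\<phi> (x + h) - \<phi> x)"] by (simp add: abs_mult p_def)
      qed (use p \<epsilon> B M q in auto)
    qed
    show "\<bar>gen (truncated_kernel f \<epsilon>') \<phi> x - gen (truncated_kernel f \<epsilon>) \<phi> x\<bar> \<le> K * \<epsilon> powr (p - \<alpha>)"
    proof -
      have "(LINT h|lborel. ((- 1) * (\<phi> (x + h) - \<phi> x)) * q h) = (LINT h|lborel. - ((\<phi> (x + h) - \<phi> x) * q h))"
        by (intro Bochner_Integration.integral_cong) (auto simp: algebra_simps)
      then show ?thesis
        using bound[of 1] bound[of "-1"] unfolding diff by simp
    qed
  qed (use p K in auto)
qed

text \<open>\<open>Lim\<close> in \<open>nonlocal_op\<close> has a meaningful value only if the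
  limit exists. The Cauchy estimate provides existence at each point and, since its right side is
  free of x, convergence in norm as well.\<close>

lemma Gen_truncated_tendsto:
  assumes "(\<phi>, \<psi>) \<in> nonlocal_graph f"
  shows "((\<lambda>\<epsilon>. Gen (truncated_kernel f \<epsilon>) \<phi>) \<longlongrightarrow> \<psi>) (at_right 0)"
proof -
  have C2: "apply_c_infty \<phi> \<in> C2_c" and \<psi>: "apply_c_infty \<psi> = nonlocal_op f (apply_c_infty \<phi>)"
    using assms by (auto simp: nonlocal_graph_def)
  obtain K \<gamma> where \<gamma>: "\<gamma> > 0" "K \<ge> 0" and K: "\<And>x \<epsilon> \<epsilon>'. 0 < \<epsilon>' \<Longrightarrow> \<epsilon>' < \<epsilon> \<Longrightarrow>
      \<bar>gen (truncated_kernel f \<epsilon>') (apply_c_infty \<phi>) x - gen (truncated_kernel f \<epsilon>) (apply_c_infty \<phi>) x\<bar> \<le> K * \<epsilon> powr \<gamma>"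
    using gen_truncated_Cauchy[OF C2] by metis
  have small: "((\<lambda>\<epsilon>. K * \<epsilon> powr \<gamma>) \<longlongrightarrow> 0) (at_right 0)"
    using \<gamma> eventually_at_right_less[of "0::real"]
    by (intro tendsto_mult_right_zero tendsto_zero_powrI[where b=\<gamma>] tendsto_intros)
      (auto elim: eventually_mono)
  have close: "\<bar>gen (truncated_kernel f \<epsilon>) (apply_c_infty \<phi>) x - apply_c_infty \<psi> x\<bar> \<le> K * \<epsilon> powr \<gamma>" if "\<epsilon> > 0" for x \<epsilon>
  proof -
    define g where "g \<epsilon> = gen (truncated_kernel f \<epsilon>) (apply_c_infty \<phi>) x" for \<epsilon>
    have g: "\<bar>g \<epsilon>' - g \<epsilon>\<bar> \<le> K * \<epsilon> powr \<gamma>" if "0 < \<epsilon>'" "\<epsilon>' < \<epsilon>" for \<epsilon> \<epsilon>'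
      using K[OF that] by (simp add: g_def)
    define X where "X n = g (1 / Suc n)" for n
    have seq: "(\<lambda>n. K * (1 / Suc n) powr \<gamma>) \<longlonglongrightarrow> 0"
      using \<gamma> LIMSEQ_inverse_real_of_nat
      by (intro tendsto_mult_right_zero tendsto_zero_powrI[where b=\<gamma>] tendsto_const) (auto simp: inverse_eq_divide)
    have "Cauchy X"
    proof (rule CauchyI')
      fix e :: real
      assume "e > 0"
      from tendstoD[OF seq this] obtain N where N: "\<And>n. n \<ge> N \<Longrightarrow> K * (1 / Suc n) powr \<gamma> < e"
        using \<gamma> by (auto simp: eventually_sequentially dist_real_def)
      show "\<exists>N. \<forall>m\<ge>N. \<forall>n>m. dist (X m) (X n) < e"
      proof (intro exI[of _ N] allI impI)
        fix m n
        assume "m \<ge> N" "n > m"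
        then have "\<bar>X n - X m\<bar> \<le> K * (1 / Suc m) powr \<gamma>"
          unfolding X_def by (intro g) (auto simp: field_simps)
        with N[OF \<open>m \<ge> N\<close>] show "dist (X m) (X n) < e"
          by (simp add: dist_real_def abs_minus_commute)
      qed
    qed
    then obtain L where L: "X \<longlonglongrightarrow> L"
      using Cauchy_convergent convergent_def by blast
    have gL: "\<bar>g \<epsilon> - L\<bar> \<le> K * \<epsilon> powr \<gamma>" if "\<epsilon> > 0" for \<epsilon>
    proof (rule tendsto_upperbound)
      show "(\<lambda>n. \<bar>g \<epsilon> - X n\<bar>) \<longlonglongrightarrow> \<bar>g \<epsilon> - L\<bar>" by (intro tendsto_intros L)
      have "\<forall>\<^sub>F n in sequentially. 1 / real (Suc n) < \<epsilon>" using order_tendstoD(2)[OF LIMSEQ_inverse_real_of_nat \<open>\<epsilon> > 0\<close>] by (simp add: inverse_eq_divide)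
      then show "\<forall>\<^sub>F n in sequentially. \<bar>g \<epsilon> - X n\<bar> \<le> K * \<epsilon> powr \<gamma>"
        by eventually_elim (use g[of "1 / Suc n" \<epsilon> for n] in \<open>simp add: X_def abs_minus_commute\<close>)
    qed simp
    have "(g \<longlongrightarrow> L) (at_right 0)"
    proof (rule LIM_zero_cancel, rule tendsto_0_le[OF small, where K=1])
      show "\<forall>\<^sub>F \<epsilon> in at_right 0. norm (g \<epsilon> - L) \<le> norm (K * \<epsilon> powr \<gamma>) * 1"
        using eventually_at_right_less[of "0::real"] by eventually_elim (use gL \<gamma> in auto)
    qed
    then have "Lim (at_right 0) g = L" by (intro tendsto_Lim) auto
    then have "apply_c_infty \<psi> x = L"
      unfolding \<psi> nonlocal_op_def g_def gen_truncated_kernel by simp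
    with gL[OF that] show ?thesis by (simp add: g_def)
  qed
  show ?thesis
  proof (rule LIM_zero_cancel, rule tendsto_0_le[OF small, where K=1])
    show "\<forall>\<^sub>F \<epsilon> in at_right 0. norm (Gen (truncated_kernel f \<epsilon>) \<phi> - \<psi>) \<le> norm (K * \<epsilon> powr \<gamma>) * 1"
      using eventually_at_right_less[of "0::real"]
    proof eventually_elim
      case (elim \<epsilon>)
      interpret jump_kernel "truncated_kernel f \<epsilon>" \<alpha> M \<epsilon> using elim by (rule jump_kernel_truncated)
      show ?case
        using close[OF elim] \<gamma> by (intro norm_c_infty_le) (simp add: minus_c_infty.rep_eq apply_Gen)
    qed
  qed
qed

text \<open>On the graph itself the resolvent maps \<phi> - h G \<phi> back to \<phi>, with G the
  truncated generator, and G \<phi> converges. Contractivity carries this over to the closure, where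
  only approximation by the graph is available.\<close>

lemma res_truncated_tendsto:
  assumes "h > 0" "(w, z) \<in> closure (nonlocal_graph f)"
  shows "((\<lambda>\<epsilon>. res (truncated_kernel f \<epsilon>) h (w - h *\<^sub>R z)) \<longlongrightarrow> w) (at_right 0)"
proof (rule tendstoI)
  fix e :: real
  assume "e > 0"
  \<comment> \<open>The approximation error enters as d + h d inside the resolvent and as d outside,
    in total e/2.\<close>
  define d where "d = e / (2 * (2 + h))"
  have "d > 0" using \<open>e > 0\<close> \<open>h > 0\<close> by (simp add: d_def)
  then obtain \<phi> \<psi> where graph: "(\<phi>, \<psi>) \<in> nonlocal_graph f" and "dist (\<phi>, \<psi>) (w, z) < d"
    using assms(2) closure_approachable[of "(w, z)" "nonlocal_graph f"] by force
  then have near: "norm (w - \<phi>) < d" "norm (z - \<psi>) < d"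
    using dist_fst_le[of "(\<phi>, \<psi>)" "(w, z)"] dist_snd_le[of "(\<phi>, \<psi>)" "(w, z)"]
    by (auto simp: dist_norm norm_minus_commute)
  have "e / (2 * h) > 0" using \<open>e > 0\<close> \<open>h > 0\<close> by simp
  from tendstoD[OF Gen_truncated_tendsto[OF graph] this] eventually_at_right_less[of "0::real"]
  show "\<forall>\<^sub>F \<epsilon> in at_right 0. dist (res (truncated_kernel f \<epsilon>) h (w - h *\<^sub>R z)) w < e"
  proof eventually_elim
    case (elim \<epsilon>)
    interpret jump_kernel "truncated_kernel f \<epsilon>" \<alpha> M \<epsilon> using elim(2) by (rule jump_kernel_truncated)
    let ?G = "Gen (truncated_kernel f \<epsilon>) \<phi>"
    have "res (truncated_kernel f \<epsilon>) h (\<phi> - h *\<^sub>R ?G) = \<phi>"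
      by (rule res_unique[OF assms(1)]) simp
    then have "norm (res (truncated_kernel f \<epsilon>) h (w - h *\<^sub>R z) - \<phi>) \<le> norm ((w - h *\<^sub>R z) - (\<phi> - h *\<^sub>R ?G))"
      using res_contraction[OF assms(1), of "w - h *\<^sub>R z" "\<phi> - h *\<^sub>R ?G"] by simp
    also have "(w - h *\<^sub>R z) - (\<phi> - h *\<^sub>R ?G) = (w - \<phi>) - h *\<^sub>R (z - \<psi>) + h *\<^sub>R (?G - \<psi>)"
      by (simp add: algebra_simps)
    also have "norm \<dots> \<le> norm (w - \<phi>) + h * norm (z - \<psi>) + h * norm (?G - \<psi>)"
      using \<open>h > 0\<close> norm_triangle_ineq[of "(w - \<phi>) - h *\<^sub>R (z - \<psi>)" "h *\<^sub>R (?G - \<psi>)"]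
        norm_triangle_ineq4[of "w - \<phi>" "h *\<^sub>R (z - \<psi>)"] by simp
    also have "\<dots> \<le> d + h * d + h * norm (?G - \<psi>)"
      using near \<open>h > 0\<close> by (intro add_mono mult_left_mono) (auto intro: less_imp_le)
    finally have *: "norm (res (truncated_kernel f \<epsilon>) h (w - h *\<^sub>R z) - \<phi>) \<le> d + h * d + h * norm (?G - \<psi>)" .
    have "h * norm (?G - \<psi>) < e / 2"
      using elim(1) \<open>h > 0\<close> by (simp add: dist_norm field_simps)
    moreover have "(2 + h) * d = e / 2"
    proof -
      have "2 + h \<noteq> 0" using \<open>h > 0\<close> by simp
      from nonzero_mult_divide_mult_cancel_left[OF this, of e 2] show ?thesis
        by (simp only: d_def times_divide_eq_right mult.commute[of 2])
    qed
    then have "d + h * d + d = e / 2"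
      by (simp add: algebra_simps)
    moreover have "dist (res (truncated_kernel f \<epsilon>) h (w - h *\<^sub>R z)) w
        \<le> norm (res (truncated_kernel f \<epsilon>) h (w - h *\<^sub>R z) - \<phi>) + norm (w - \<phi>)"
      using norm_triangle_ineq4[of "res (truncated_kernel f \<epsilon>) h (w - h *\<^sub>R z) - \<phi>" "w - \<phi>"]
      by (simp add: dist_norm)
    ultimately show ?case using * near by linarith
  qed
qed

lemma resolvent_powers_truncated:
  assumes "contraction_semigroup P" "closure (nonlocal_graph f) = generator P" "t > 0" "\<delta> > 0"
  shows "\<forall>\<^sub>F n in sequentially. \<forall>\<^sub>F \<epsilon> in at_right 0.
    norm ((res (truncated_kernel f \<epsilon>) (t / real n) ^^ n) u - P t u) < \<delta>"
proof (rule resolvent_powers_tendsto[OF assms(1) _ _ assms(3,4)])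
  show "norm (res (truncated_kernel f \<epsilon>) h g - res (truncated_kernel f \<epsilon>) h g') \<le> norm (g - g')"
    if "\<epsilon> > 0" "h > 0" for \<epsilon> h g g'
    using jump_kernel.res_contraction[OF jump_kernel_truncated] that by blast
qed (use assms res_truncated_tendsto in auto)

end


section \<open>Estimates for the semigroup\<close>

text \<open>The nested limit, \<epsilon> to 0 for fixed n and then n to infinity, as a single
  filter. The threshold for \<epsilon> may depend on n, so it is not the product filter. Closed
  conditions then pass to the limit by the general facts on filters.\<close>

definition iterated_filter :: "(nat \<times> real) filter"
  where "iterated_filter = Abs_filter (\<lambda>Q. \<forall>\<^sub>F n in sequentially. \<forall>\<^sub>F \<epsilon> in at_right 0. Q (n, \<epsilon>))"

lemma eventually_iterated_filter:
  "eventually Q iterated_filter \<longleftrightarrow> (\<forall>\<^sub>F n in sequentially. \<forall>\<^sub>F \<epsilon> in at_right 0. Q (n, \<epsilon>))"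
  unfolding iterated_filter_def
proof (rule eventually_Abs_filter, unfold_locales)
  fix P Q :: "nat \<times> real \<Rightarrow> bool"
  assume "\<forall>\<^sub>F n in sequentially. \<forall>\<^sub>F \<epsilon> in at_right 0. P (n, \<epsilon>)" "\<forall>\<^sub>F n in sequentially. \<forall>\<^sub>F \<epsilon> in at_right 0. Q (n, \<epsilon>)"
  then show "\<forall>\<^sub>F n in sequentially. \<forall>\<^sub>F \<epsilon> in at_right 0. P (n, \<epsilon>) \<and> Q (n, \<epsilon>)"
    by eventually_elim (rule eventually_conj)
next
  fix P Q :: "nat \<times> real \<Rightarrow> bool"
  assume "\<forall>x. P x \<longrightarrow> Q x" "\<forall>\<^sub>F n in sequentially. \<forall>\<^sub>F \<epsilon> in at_right 0. P (n, \<epsilon>)"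
  then show "\<forall>\<^sub>F n in sequentially. \<forall>\<^sub>F \<epsilon> in at_right 0. Q (n, \<epsilon>)"
    by (auto elim!: eventually_mono)
qed simp

lemma iterated_filter_neq_bot: "iterated_filter \<noteq> bot"
proof
  assume "iterated_filter = bot"
  then have "eventually (\<lambda>_. False) iterated_filter" by simp
  then have "\<forall>\<^sub>F n in sequentially. \<forall>\<^sub>F \<epsilon> :: real in at_right 0. False"
    by (rule eventually_iterated_filter[THEN iffD1])
  then show False by (simp add: eventually_const_iff)
qed

text \<open>The constant C1 of \<open>funpow_res_sup_le\<close> with \<beta> = d/\<alpha> and c0 =
  a/(3 \<beta>) inserted.\<close>

definition diag_const :: "'a::euclidean_space itself \<Rightarrow> real \<Rightarrow> real \<Rightarrow> real \<Rightarrow> real"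
  where "diag_const _ \<alpha> M a = M * (a / (3 * (DIM('a) / \<alpha>))) powr (- 1 - DIM('a) / \<alpha>) / (DIM('a) / \<alpha>)"

text \<open>The ratio K of the radius r to the truncation radius \<rho>. It is chosen so that the
  normalized barrier of \<open>P_far_le\<close> has at its centre the factor t / r^\<alpha> to the
  power (d + \<alpha>)/\<alpha>.\<close>

definition trunc_ratio :: "'a::euclidean_space itself \<Rightarrow> real \<Rightarrow> real"
  where "trunc_ratio _ \<alpha> = 2 * real DIM('a) * (real DIM('a) + \<alpha>) / \<alpha>"

text \<open>The first summand accounts for jumps longer than r/K. The second is the factor 2 d from
  the barrier at its centre times the growth of the barrier over the whole time interval.\<close>

definition off_const :: "'a::euclidean_space itself \<Rightarrow> real \<Rightarrow> real \<Rightarrow> real"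
  where "off_const T \<alpha> M = M * trunc_ratio T \<alpha> powr (\<alpha> + real DIM('a))
    + 2 * real DIM('a) * exp (2 * (truncation_const T \<alpha> M * trunc_ratio T \<alpha> powr \<alpha>))"

definition cutoff :: "('a::euclidean_space \<Rightarrow> real) \<Rightarrow> 'a c_infty \<Rightarrow> 'a c_infty"
  where "cutoff \<eta> v = C_infty (\<lambda>x. \<eta> x * apply_c_infty v x)"

lemma apply_cutoff:
  assumes "continuous_on UNIV \<eta>" "\<And>x. 0 \<le> \<eta> x" "\<And>x. \<eta> x \<le> 1"
  shows "apply_c_infty (cutoff \<eta> v) = (\<lambda>x. \<eta> x * apply_c_infty v x)"
  unfolding cutoff_def
proof (rule apply_c_infty_C_infty)
  show "continuous_on UNIV (\<lambda>x. \<eta> x * apply_c_infty v x)"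
    by (intro continuous_intros assms continuous_on_apply_c_infty)
  show "((\<lambda>x. \<eta> x * apply_c_infty v x) \<longlongrightarrow> 0) at_infinity"
    by (rule tendsto_0_le[OF tendsto_apply_c_infty[of v], where K=1])
      (use assms in \<open>auto intro!: always_eventually mult_left_le_one_le simp: abs_mult\<close>)
qed

lemma mass_cutoff_le:
  assumes "continuous_on UNIV \<eta>" "\<And>x. 0 \<le> \<eta> x" "\<And>x. \<eta> x \<le> 1" "\<And>x. 0 \<le> apply_c_infty v x"
  shows "mass (cutoff \<eta> v) \<le> mass v"
  unfolding mass_def apply_cutoff[OF assms(1-3)]
  by (intro nn_integral_mono ennreal_leI mult_left_le_one_le assms)

lemma integrable_of_mass:
  assumes "\<And>x. apply_c_infty v x \<ge> 0" "mass v \<le> ennreal N"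
  shows "integrable lborel (apply_c_infty v)"
  using assms unfolding mass_def by (intro integrableI_bounded) (auto simp: less_top[symmetric] top_unique)

lemma integral_le_of_mass:
  assumes "\<And>x. apply_c_infty v x \<ge> 0" "mass v \<le> ennreal N" "N \<ge> 0"
  shows "(LINT x|lborel. apply_c_infty v x) \<le> N"
  using assms unfolding mass_def by (intro integral_le_nn_integral[where g="apply_c_infty v"]) auto

lemma integrable_mult_c_infty:
  assumes "integrable lborel (apply_c_infty w)"
  shows "integrable lborel (\<lambda>x. apply_c_infty v x * apply_c_infty w x)"
proof (rule Bochner_Integration.integrable_bound[OF integrable_mult_right[OF assms, of "norm v"]])
  show "AE x in lborel. norm (apply_c_infty v x * apply_c_infty w x) \<le> norm (norm v * apply_c_infty w x)"
    by (intro AE_I2) (simp add: abs_mult mult_right_mono abs_apply_c_infty_le_norm)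
qed measurable

lemma tendsto_integral_mult_c_infty:
  assumes w: "integrable lborel (apply_c_infty w)" and lim: "(v \<longlongrightarrow> l) F"
  shows "((\<lambda>z. LINT x|lborel. apply_c_infty (v z) x * apply_c_infty w x)
    \<longlongrightarrow> (LINT x|lborel. apply_c_infty l x * apply_c_infty w x)) F"
proof (rule LIM_zero_cancel)
  have "((\<lambda>z. norm (v z - l)) \<longlongrightarrow> 0) F"
    using lim by (intro tendsto_norm_zero LIM_zero)
  then show "((\<lambda>z. (LINT x|lborel. apply_c_infty (v z) x * apply_c_infty w x)
    - (LINT x|lborel. apply_c_infty l x * apply_c_infty w x)) \<longlongrightarrow> 0) F"
  proof (rule tendsto_0_le[where K="LINT x|lborel. \<bar>apply_c_infty w x\<bar>"], intro always_eventually allI)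
    fix z
    have "(LINT x|lborel. apply_c_infty (v z) x * apply_c_infty w x) - (LINT x|lborel. apply_c_infty l x * apply_c_infty w x)
      = (LINT x|lborel. apply_c_infty (v z - l) x * apply_c_infty w x)"
      unfolding Bochner_Integration.integral_diff[OF integrable_mult_c_infty[OF w] integrable_mult_c_infty[OF w], symmetric]
      by (simp add: minus_c_infty.rep_eq left_diff_distrib)
    also have "norm \<dots> \<le> (LINT x|lborel. norm (v z - l) * \<bar>apply_c_infty w x\<bar>)"
      using w by (intro order_trans[OF integral_norm_bound] integral_mono integrable_norm integrable_mult_c_infty)
        (auto simp: abs_mult mult_right_mono abs_apply_c_infty_le_norm)
    finally show "norm ((LINT x|lborel. apply_c_infty (v z) x * apply_c_infty w x)
       - (LINT x|lborel. apply_c_infty l x * apply_c_infty w x)) \<le> norm (norm (v z - l)) * (LINT x|lborel. \<bar>apply_c_infty w x\<bar>)"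
      by simp
  qed
qed

section \<open>Passage of the resolvent estimates to the semigroup\<close>

locale stable_like_semigroup = stable_like f \<alpha> M
  for f :: "'a::euclidean_space \<Rightarrow> 'a \<Rightarrow> ennreal" and \<alpha> M :: real +
  fixes a :: real and P :: "real \<Rightarrow> 'a c_infty \<Rightarrow>\<^sub>L 'a c_infty"
  assumes a: "a > 0"
    and lower: "\<epsilon> > 0 \<Longrightarrow> ennreal (a * \<epsilon> powr (- \<alpha>)) \<le> (\<integral>\<^sup>+ y\<in>{y. norm (y - x) > \<epsilon>}. f x y \<partial>lborel)"
    and semigroup: "contraction_semigroup P"
    and generator: "closure (nonlocal_graph f) = generator P"
begin

lemma truncated_kernel_lower:
  assumes "\<epsilon> > 0" "r \<ge> \<epsilon>"
  shows "a * r powr (- \<alpha>) \<le> (LINT y|lborel. truncated_kernel f \<epsilon> x y * indicator {y. norm (y - x) > r} y)"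
proof -
  interpret jump_kernel "truncated_kernel f \<epsilon>" \<alpha> M \<epsilon> using assms by (intro jump_kernel_truncated)
  have int: "integrable lborel (\<lambda>y. truncated_kernel f \<epsilon> x y * indicator {y. norm (y - x) > r} y)"
    by (rule Bochner_Integration.integrable_bound[OF integrable_k[of x]]) (auto simp: indicator_def)
  have "ennreal (a * r powr (- \<alpha>)) \<le> (\<integral>\<^sup>+ y\<in>{y. norm (y - x) > r}. f x y \<partial>lborel)"
    using assms by (intro lower) auto
  also have "\<dots> = (\<integral>\<^sup>+ y. ennreal (truncated_kernel f \<epsilon> x y * indicator {y. norm (y - x) > r} y) \<partial>lborel)"
  proof (intro nn_integral_cong)
    fix y
    show "f x y * indicator {y. norm (y - x) > r} y
      = ennreal (truncated_kernel f \<epsilon> x y * indicator {y. norm (y - x) > r} y)"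
    proof (cases "norm (y - x) > r")
      case True
      then have "y \<noteq> x" using assms by auto
      then have "f x y < top"
        by (intro le_less_trans[OF f_le ennreal_less_top])
      with True assms show ?thesis by (simp add: truncated_kernel_def)
    qed simp
  qed
  also have "\<dots> = ennreal (LINT y|lborel. truncated_kernel f \<epsilon> x y * indicator {y. norm (y - x) > r} y)"
    using k_nonneg by (intro nn_integral_eq_integral int) auto
  finally show ?thesis
    using k_nonneg by (subst (asm) ennreal_le_iff) auto
qed

definition approx :: "real \<Rightarrow> nat \<times> real \<Rightarrow> 'a c_infty \<Rightarrow> 'a c_infty"
  where "approx t z = res (truncated_kernel f (snd z)) (t / real (fst z)) ^^ fst z"

lemma approx_tendsto: "t > 0 \<Longrightarrow> ((\<lambda>z. approx t z u) \<longlongrightarrow> P t u) iterated_filter"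
  using resolvent_powers_truncated[OF semigroup generator]
  by (auto simp: tendsto_iff eventually_iterated_filter approx_def dist_norm)

lemma eventually_iterated_filter_pos:
  assumes "\<forall>\<^sub>F n in sequentially. Q n" "\<forall>\<^sub>F \<epsilon> in at_right 0. R \<epsilon>"
  shows "\<forall>\<^sub>F z in iterated_filter. fst z > 0 \<and> snd z > 0 \<and> Q (fst z) \<and> R (snd z)"
  unfolding eventually_iterated_filter using assms(1) eventually_gt_at_top[of "0::nat"]
proof eventually_elim
  case (elim n)
  from assms(2) eventually_at_right_less[of "0::real"] show ?case
    by eventually_elim (use elim in auto)
qed

lemma eventually_iterated_filter_mono:
  assumes "\<forall>\<^sub>F n in sequentially. Q n" "\<forall>\<^sub>F \<epsilon> in at_right 0. R \<epsilon>"
    and "\<And>n \<epsilon>. n > 0 \<Longrightarrow> \<epsilon> > 0 \<Longrightarrow> Q n \<Longrightarrow> R \<epsilon> \<Longrightarrow> S (n, \<epsilon>)"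
  shows "\<forall>\<^sub>F z in iterated_filter. S z"
  using eventually_iterated_filter_pos[OF assms(1,2)] by eventually_elim (use assms(3) in auto)

lemma P_le:
  assumes "t > 0" "\<forall>\<^sub>F n in sequentially. Q n" "\<forall>\<^sub>F \<epsilon> in at_right 0. R \<epsilon>"
    and "\<And>n \<epsilon>. n > 0 \<Longrightarrow> \<epsilon> > 0 \<Longrightarrow> Q n \<Longrightarrow> R \<epsilon> \<Longrightarrow>
      apply_c_infty ((res (truncated_kernel f \<epsilon>) (t / real n) ^^ n) u) x \<le> B"
  shows "apply_c_infty (P t u) x \<le> B"
proof (rule tendsto_upperbound[OF tendsto_apply_c_infty_at[OF approx_tendsto[OF assms(1)]]])
  show "\<forall>\<^sub>F z in iterated_filter. apply_c_infty (approx t z u) x \<le> B"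
    by (rule eventually_iterated_filter_mono[OF assms(2,3)]) (simp add: approx_def assms(4))
qed (rule iterated_filter_neq_bot)

lemma P_positive:
  assumes "t > 0" "\<And>x. apply_c_infty u x \<ge> 0"
  shows "apply_c_infty (P t u) x \<ge> 0"
proof (rule tendsto_lowerbound[OF tendsto_apply_c_infty_at[OF approx_tendsto[OF assms(1)]]])
  show "\<forall>\<^sub>F z in iterated_filter. 0 \<le> apply_c_infty (approx t z u) x"
    by (rule eventually_iterated_filter_mono[OF eventually_True eventually_True])
      (use assms in \<open>auto simp: approx_def intro!: jump_kernel.funpow_res_nonneg jump_kernel_truncated\<close>)
qed (rule iterated_filter_neq_bot)

lemma P_mass_le:
  assumes "t > 0" "\<And>x. apply_c_infty u x \<ge> 0" "mass u \<le> ennreal N" "N \<ge> 0"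
  shows "mass (P t u) \<le> ennreal N"
proof -
  have "P t u \<in> {v. (\<forall>x. 0 \<le> apply_c_infty v x) \<and> mass v \<le> ennreal N}"
  proof (rule Lim_in_closed_set[OF closed_mass_le _ iterated_filter_neq_bot approx_tendsto[OF assms(1)]])
    show "\<forall>\<^sub>F z in iterated_filter. approx t z u \<in> {v. (\<forall>x. 0 \<le> apply_c_infty v x) \<and> mass v \<le> ennreal N}"
      by (rule eventually_iterated_filter_mono[OF eventually_True eventually_True])
        (use assms in \<open>auto simp: approx_def intro!: jump_kernel.funpow_res_nonneg jump_kernel.funpow_res_mass_le jump_kernel_truncated\<close>)
  qed
  then show ?thesis by simp
qed

text \<open>Symmetry of the resolvent powers comes in \<open>ennreal\<close> integrals. It is
  rewritten with real integrals, because these converge when one factor converges uniformly and the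
  other is integrable.\<close>

lemma P_symmetric:
  assumes "t > 0" and u: "\<And>x. apply_c_infty u x \<ge> 0" "mass u \<le> ennreal N"
    and w: "\<And>x. apply_c_infty w x \<ge> 0" "mass w \<le> ennreal N'"
  shows "(LINT x|lborel. apply_c_infty (P t u) x * apply_c_infty w x)
    = (LINT x|lborel. apply_c_infty u x * apply_c_infty (P t w) x)"
proof -
  have int: "integrable lborel (apply_c_infty u)" "integrable lborel (apply_c_infty w)"
    using integrable_of_mass u w by blast+
  have "\<forall>\<^sub>F z in iterated_filter. (LINT x|lborel. apply_c_infty (approx t z u) x * apply_c_infty w x)
    = (LINT x|lborel. apply_c_infty (approx t z w) x * apply_c_infty u x)"
  proof (rule eventually_iterated_filter_mono[OF eventually_True eventually_True])
    fix n :: nat and \<epsilon> :: real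
    assume "n > 0" "\<epsilon> > 0"
    then have h: "t / n > 0" using assms by simp
    interpret jump_kernel "truncated_kernel f \<epsilon>" \<alpha> M \<epsilon> using \<open>\<epsilon> > 0\<close> by (rule jump_kernel_truncated)
    let ?J = "res (truncated_kernel f \<epsilon>) (t / n) ^^ n"
    have J: "apply_c_infty (?J v) x \<ge> 0" if "\<And>x. apply_c_infty v x \<ge> 0" for v x
      using that by (intro funpow_res_nonneg h)
    have "ennreal (LINT x|lborel. apply_c_infty (?J u) x * apply_c_infty w x)
      = (\<integral>\<^sup>+ x. ennreal (apply_c_infty (?J u) x) * ennreal (apply_c_infty w x) \<partial>lborel)"
      using J[OF u(1)] w by (subst nn_integral_eq_integral[symmetric]) (auto intro!: integrable_mult_c_infty int simp: ennreal_mult')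
    also have "\<dots> = (\<integral>\<^sup>+ x. ennreal (apply_c_infty u x) * ennreal (apply_c_infty (?J w) x) \<partial>lborel)"
      using u w h by (intro funpow_res_symmetric) (auto simp: less_top[symmetric] top_unique)
    also have "\<dots> = (\<integral>\<^sup>+ x. ennreal (apply_c_infty (?J w) x * apply_c_infty u x) \<partial>lborel)"
      using J[OF w(1)] u by (simp add: ennreal_mult' mult.commute)
    also have "\<dots> = ennreal (LINT x|lborel. apply_c_infty (?J w) x * apply_c_infty u x)"
      using J[OF w(1)] u by (intro nn_integral_eq_integral integrable_mult_c_infty int) simp
    finally show "(LINT x|lborel. apply_c_infty (approx t (n, \<epsilon>) u) x * apply_c_infty w x)
       = (LINT x|lborel. apply_c_infty (approx t (n, \<epsilon>) w) x * apply_c_infty u x)"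
      using J u w by (subst (asm) ennreal_inj) (auto simp: approx_def)
  qed
  then have "((\<lambda>z. LINT x|lborel. apply_c_infty (approx t z w) x * apply_c_infty u x)
      \<longlongrightarrow> (LINT x|lborel. apply_c_infty (P t u) x * apply_c_infty w x)) iterated_filter"
    by (rule Lim_transform_eventually[OF tendsto_integral_mult_c_infty[OF int(2) approx_tendsto[OF assms(1)]]])
  moreover have "((\<lambda>z. LINT x|lborel. apply_c_infty (approx t z w) x * apply_c_infty u x)
      \<longlongrightarrow> (LINT x|lborel. apply_c_infty (P t w) x * apply_c_infty u x)) iterated_filter"
    by (rule tendsto_integral_mult_c_infty[OF int(1) approx_tendsto[OF assms(1)]])
  ultimately have "(LINT x|lborel. apply_c_infty (P t u) x * apply_c_infty w x) = (LINT x|lborel. apply_c_infty (P t w) x * apply_c_infty u x)"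
    using tendsto_unique[OF iterated_filter_neq_bot] by blast
  then show ?thesis by (simp add: mult.commute)
qed

lemma diag_const_pos: "diag_const TYPE('a) \<alpha> M a > 0"
  using alpha M a by (simp add: diag_const_def)

lemma P_sup_le:
  assumes "t > 0" and u: "\<And>x. apply_c_infty u x \<ge> 0" "mass u \<le> ennreal N" and "N \<ge> 0"
  shows "apply_c_infty (P t u) x \<le> diag_const TYPE('a) \<alpha> M a * t powr (- (real DIM('a) / \<alpha>)) * N"
proof -
  define \<beta> where "\<beta> = real DIM('a) / \<alpha>"
  define c0 where "c0 = a / (3 * \<beta>)"
  define C1 where "C1 = M * c0 powr (- 1 - \<beta>) / \<beta>"
  have \<beta>: "\<beta> > 0" using alpha by (simp add: \<beta>_def)
  have c0: "c0 > 0" using \<beta> a by (simp add: c0_def)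
  have C1: "C1 > 0" "C1 = diag_const TYPE('a) \<alpha> M a"
    using M \<beta> c0 by (simp add: C1_def, simp add: C1_def c0_def diag_const_def \<beta>_def)
  have pos: "apply_c_infty (P t u) x \<le> C1 * t powr (- \<beta>) * N'" if "N' > 0" "mass u \<le> ennreal N'" for N'
  proof -
    \<comment> \<open>The starting time at which the barrier C1 s^(-\<beta>) N' equals
      \<open>norm u + 1\<close> and so lies above u; the 1 keeps the quotient positive for u =
      0.\<close>
    define s where "s = ((norm u + 1) / (C1 * N')) powr (- 1 / \<beta>)"
    have q: "(norm u + 1) / (C1 * N') > 0"
      using that C1 by (intro divide_pos_pos mult_pos_pos add_nonneg_pos) auto
    have s: "s > 0" unfolding s_def powr_gt_zero using q by (metis less_irrefl)
    have "s powr (- \<beta>) = (norm u + 1) / (C1 * N')"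
    proof -
      have "(- 1 / \<beta>) * (- \<beta>) = 1" using \<beta> by simp
      then show ?thesis using q unfolding s_def powr_powr by (simp only: powr_one less_imp_le)
    qed
    moreover have "C1 \<noteq> 0" "N' \<noteq> 0" using C1 that by auto
    ultimately have s_eq: "C1 * s powr (- \<beta>) * N' = norm u + 1"
      by simp
    show ?thesis
    proof (rule P_le[OF assms(1)])
      have "(\<lambda>n. (1 + t * inverse (real n) / s) powr (\<beta> + 1)) \<longlonglongrightarrow> (1 + t * 0 / s) powr (\<beta> + 1)"
        using s by (intro tendsto_intros tendsto_inverse_0_at_top filterlim_real_sequentially) auto
      then have "(\<lambda>n. (1 + t / real n / s) powr (\<beta> + 1)) \<longlonglongrightarrow> 1"
        by (simp add: divide_inverse)
      from order_tendstoD(2)[OF this, of 2]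
      show "\<forall>\<^sub>F n in sequentially. (1 + t / real n / s) powr (\<beta> + 1) < 2" by simp
      have "((\<lambda>\<epsilon>. \<epsilon> powr \<alpha>) \<longlongrightarrow> 0) (at_right 0)"
        using alpha eventually_at_right_less[of "0::real"]
        by (intro tendsto_zero_powrI[where b=\<alpha>] tendsto_intros) (auto elim: eventually_mono)
      from order_tendstoD(2)[OF this, of "c0 * s"]
      show "\<forall>\<^sub>F \<epsilon> in at_right 0. \<epsilon> powr \<alpha> < c0 * s" using c0 s by simp
    next
      fix n :: nat and \<epsilon> :: real
      assume n: "n > 0" "\<epsilon> > 0" "(1 + t / real n / s) powr (\<beta> + 1) < 2" "\<epsilon> powr \<alpha> < c0 * s"
      interpret jump_kernel "truncated_kernel f \<epsilon>" \<alpha> M \<epsilon> using \<open>\<epsilon> > 0\<close> by (rule jump_kernel_truncated)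
      have "apply_c_infty ((res (truncated_kernel f \<epsilon>) (t / real n) ^^ n) u) x \<le> C1 * (s + real n * (t / real n)) powr (- \<beta>) * N'"
      proof (rule funpow_res_sup_le[OF \<beta>_def _ _ a s c0_def C1_def])
        show "apply_c_infty u x \<le> C1 * s powr - \<beta> * N'" for x
          using abs_apply_c_infty_le_norm[of u x] unfolding s_eq by linarith
      qed (use n assms that u truncated_kernel_lower in auto)
      \<comment> \<open>Dropping s from the base removes the dependence on
        \<open>norm u\<close>.\<close>
      also have "\<dots> \<le> C1 * t powr (- \<beta>) * N'"
        using n s assms(1) C1 that \<beta> by (intro mult_right_mono mult_left_mono powr_mono2') auto
      finally show "apply_c_infty ((res (truncated_kernel f \<epsilon>) (t / real n) ^^ n) u) x \<le> C1 * t powr (- \<beta>) * N'" .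
    qed
  qed
  \<comment> \<open>The starting time requires a positive mass bound, so N = 0 is reached by letting
    N + d decrease to N.\<close>
  have "apply_c_infty (P t u) x \<le> C1 * t powr (- \<beta>) * N + e" if "e > 0" for e
  proof -
    define d where "d = e / (C1 * t powr (- \<beta>))"
    have d: "d > 0" using that C1 assms(1) by (simp add: d_def)
    have "mass u \<le> ennreal (N + d)"
      using u(2) d by (elim order_trans) (simp add: ennreal_leI)
    then have "apply_c_infty (P t u) x \<le> C1 * t powr (- \<beta>) * (N + d)"
      using d \<open>N \<ge> 0\<close> by (intro pos) auto
    also have "\<dots> = C1 * t powr (- \<beta>) * N + e"
      using C1 assms(1) by (simp add: d_def algebra_simps)
    finally show ?thesis .
  qed
  then have "apply_c_infty (P t u) x \<le> C1 * t powr (- \<beta>) * N"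
    by (rule field_le_epsilon)
  then show ?thesis by (simp add: C1 \<beta>_def)
qed

lemma trunc_ratio_pos: "trunc_ratio TYPE('a) \<alpha> > 0"
  using alpha by (simp add: trunc_ratio_def add_pos_pos)

lemma truncation_const_pos: "truncation_const TYPE('a) \<alpha> M > 0"
  using alpha M radial_const_pos[of "2 - \<alpha>", where 'a='a] radial_const_pos[of "1 - \<alpha>", where 'a='a]
  by (simp add: truncation_const_def add_pos_pos)

lemma off_const_pos: "off_const TYPE('a) \<alpha> M > 0"
  using M trunc_ratio_pos by (simp add: off_const_def add_pos_pos)

text \<open>Barrier argument with truncation radius \<rho> = r/K. The choice exp (2 \<kappa> \<rho>)
  = r^\<alpha>/t makes the growth rate l equal to A K^\<alpha>/t, so that exp (2 l t) is a constant.
  The barrier is normalized to be at least 1 outside the ball of radius r; its value at x is then 2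
  d (t / r^\<alpha>)^(1 + d/\<alpha>), which contains the desired t r^(-\<alpha>-d).\<close>

lemma P_far_le:
  assumes t: "t > 0" "t \<le> r powr \<alpha>" and "r > 0" "N \<ge> 0" "S \<ge> 0"
    and g: "\<And>y. apply_c_infty g y \<ge> 0" "mass g \<le> ennreal N" "\<And>y. apply_c_infty g y \<le> S"
    and vanish: "\<And>y. norm (y - x) < r \<Longrightarrow> apply_c_infty g y = 0"
  shows "apply_c_infty (P t g) x \<le> off_const TYPE('a) \<alpha> M * t * r powr (- \<alpha> - real DIM('a)) * (N + S * t powr (real DIM('a) / \<alpha>))"
proof -
  define d :: real where "d = real DIM('a)"
  define K where "K = trunc_ratio TYPE('a) \<alpha>"
  define A where "A = truncation_const TYPE('a) \<alpha> M"
  define \<rho> where "\<rho> = r / K"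
  define q where "q = r powr \<alpha> / t"
  define \<kappa> where "\<kappa> = ln q / (2 * \<rho>)"
  define l where "l = A * exp (2 * \<kappa> * \<rho>) * \<rho> powr (- \<alpha>)"
  define w where "w y = 2 * exp (- (\<kappa> * r / d)) * cosh_weight \<kappa> (y - x)" for y
  have d: "d > 0" by (simp add: d_def)
  have K: "K > 0" unfolding K_def by (rule trunc_ratio_pos)
  have A: "A > 0" unfolding A_def by (rule truncation_const_pos)
  have \<rho>: "\<rho> > 0" using K \<open>r > 0\<close> by (simp add: \<rho>_def)
  \<comment> \<open>Here t \<le> r^\<alpha> enters; it makes \<kappa> nonnegative.\<close>
  have q: "q \<ge> 1" using t by (simp add: q_def)
  have \<kappa>: "\<kappa> \<ge> 0" using q \<rho> by (simp add: \<kappa>_def)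
  have l: "l = A * K powr \<alpha> / t"
  proof -
    have "exp (2 * \<kappa> * \<rho>) = q" using q \<rho> by (simp add: \<kappa>_def)
    then show ?thesis
      using K \<open>r > 0\<close> unfolding l_def by (simp add: q_def \<rho>_def powr_divide powr_minus field_simps)
  qed
  have w: "continuous_on UNIV w" "w y \<ge> 0" for y
    unfolding w_def by (intro continuous_intros) (simp add: cosh_weight_nonneg)
  have w_ge: "w y \<ge> 1" if "norm (y - x) \<ge> r" for y
  proof -
    have "exp (- (\<kappa> * r / d)) * exp (\<kappa> * r / d) \<le> exp (- (\<kappa> * r / d)) * (2 * cosh_weight \<kappa> (y - x))"
      using cosh_weight_ge[OF that \<kappa>] by (intro mult_left_mono) (auto simp: d_def)
    then show ?thesis by (simp add: w_def mult_ac flip: exp_add)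
  qed
  have "apply_c_infty (P t g) x \<le> t * (M * \<rho> powr (- \<alpha> - real DIM('a)) * N) + S * exp (2 * l * t) * w x"
  proof (rule P_le[OF t(1)])
    have "(\<lambda>n. t * l * inverse (real n)) \<longlonglongrightarrow> t * l * 0"
      by (intro tendsto_intros tendsto_inverse_0_at_top filterlim_real_sequentially)
    then have "(\<lambda>n. t / real n * l) \<longlonglongrightarrow> 0"
      by (simp add: divide_inverse mult_ac)
    from order_tendstoD(2)[OF this, of "1 / 2"]
    show "\<forall>\<^sub>F n in sequentially. t / real n * l < 1 / 2" by simp
    show "\<forall>\<^sub>F \<epsilon> :: real in at_right 0. True" by simp
  next
    fix n :: nat and \<epsilon> :: real
    assume n: "n > 0" "\<epsilon> > 0" "t / real n * l < 1 / 2"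
    interpret jump_kernel "truncated_kernel f \<epsilon>" \<alpha> M \<epsilon> using \<open>\<epsilon> > 0\<close> by (rule jump_kernel_truncated)
    have dir': "(\<forall>x h. truncated_kernel f \<epsilon> x (x + h) = truncated_kernel f \<epsilon> x (x - h)) \<or> \<alpha> < 1"
      using dir truncated_kernel_symmetric by blast
    have "apply_c_infty ((res (truncated_kernel f \<epsilon>) (t / real n) ^^ n) g) x
      \<le> n * (t / real n) * (M * \<rho> powr (- \<alpha> - real DIM('a)) * N) + S * exp (2 * l * (n * (t / real n))) * w x"
    proof (rule funpow_res_barrier_le[where w=w])
      fix y
      let ?I = "\<lambda>z. truncated_kernel f \<epsilon> y z * indicator {z. norm (z - y) \<le> \<rho>} z"
      have "(LINT z|lborel. (w z - w y) * ?I z) = (LINT z|lborel. (2 * exp (- (\<kappa> * r / d))) *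
         ((cosh_weight \<kappa> (z - x) - cosh_weight \<kappa> (y - x)) * ?I z))"
        by (intro Bochner_Integration.integral_cong) (auto simp: w_def algebra_simps)
      also have "\<dots> = (2 * exp (- (\<kappa> * r / d))) *
         (LINT z|lborel. (cosh_weight \<kappa> (z - x) - cosh_weight \<kappa> (y - x)) * ?I z)"
        by (rule integral_mult_right_zero)
      also have "\<dots> \<le> (2 * exp (- (\<kappa> * r / d))) * (l * cosh_weight \<kappa> (y - x))"
        using cosh_weight_generator_le[OF dir' \<rho> \<kappa>, of x y] unfolding l_def A_def
        by (intro mult_left_mono) auto
      finally show "(LINT z|lborel. (w z - w y) * ?I z) \<le> l * w y"
        by (simp add: w_def mult_ac)
    next
      show "apply_c_infty g y \<le> S * w y" for y
      proof (cases "norm (y - x) < r")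
        case True
        then show ?thesis using vanish w(2)[of y] \<open>S \<ge> 0\<close> by simp
      next
        case False
        then show ?thesis
          using g(3)[of y] mult_left_mono[OF w_ge[of y] \<open>S \<ge> 0\<close>] by simp
      qed
    qed (use n t \<rho> assms w g A K in \<open>auto simp: l\<close>)
    then show "apply_c_infty ((res (truncated_kernel f \<epsilon>) (t / real n) ^^ n) g) x
      \<le> t * (M * \<rho> powr (- \<alpha> - real DIM('a)) * N) + S * exp (2 * l * t) * w x"
      using n by simp
  qed
  also have "S * exp (2 * l * t) * w x = S * (2 * d * exp (2 * (A * K powr \<alpha>))) * exp (- (\<kappa> * r / d))"
    using t by (simp add: w_def cosh_weight_0 l d_def)
  also have "exp (- (\<kappa> * r / d)) = t powr (1 + d / \<alpha>) * r powr (- \<alpha> - d)"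
  proof -
    have "\<kappa> * r / d = ln q * ((d + \<alpha>) / \<alpha>)"
      using \<open>r > 0\<close> d alpha by (simp add: \<kappa>_def \<rho>_def K_def trunc_ratio_def d_def[symmetric] field_simps)
    then have "exp (- (\<kappa> * r / d)) = q powr (- ((d + \<alpha>) / \<alpha>))"
      using q by (simp add: powr_def)
    also have "\<dots> = (r powr \<alpha>) powr (- ((d + \<alpha>) / \<alpha>)) / t powr (- ((d + \<alpha>) / \<alpha>))"
      using t by (simp add: q_def powr_divide)
    also have "(r powr \<alpha>) powr (- ((d + \<alpha>) / \<alpha>)) = r powr (- \<alpha> - d)"
    proof -
      have "\<alpha> * (- ((d + \<alpha>) / \<alpha>)) = - \<alpha> - d" using alpha by (simp add: field_simps)
      then show ?thesis by (simp only: powr_powr)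
    qed
    also have "r powr (- \<alpha> - d) / t powr (- ((d + \<alpha>) / \<alpha>)) = t powr ((d + \<alpha>) / \<alpha>) * r powr (- \<alpha> - d)"
      by (simp add: powr_minus field_simps)
    also have "(d + \<alpha>) / \<alpha> = 1 + d / \<alpha>" using alpha by (simp add: field_simps)
    finally show ?thesis .
  qed
  also have "t powr (1 + d / \<alpha>) = t * t powr (d / \<alpha>)"
    using t by (simp add: powr_add)
  also have "\<rho> powr (- \<alpha> - real DIM('a)) = K powr (\<alpha> + d) * r powr (- \<alpha> - d)"
    using K \<open>r > 0\<close> by (simp add: \<rho>_def d_def powr_divide powr_diff powr_add powr_minus field_simps)
  also have "t * (M * (K powr (\<alpha> + d) * r powr (- \<alpha> - d)) * N)
      + S * (2 * d * exp (2 * (A * K powr \<alpha>))) * (t * t powr (d / \<alpha>) * r powr (- \<alpha> - d))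
     = t * r powr (- \<alpha> - d) * ((M * K powr (\<alpha> + d)) * N + (2 * d * exp (2 * (A * K powr \<alpha>))) * (S * t powr (d / \<alpha>)))"
    by (simp add: algebra_simps)
  also have "\<dots> \<le> t * r powr (- \<alpha> - d) * (off_const TYPE('a) \<alpha> M * N + off_const TYPE('a) \<alpha> M * (S * t powr (d / \<alpha>)))"
    using t M d assms by (intro mult_left_mono add_mono mult_right_mono) (auto simp: off_const_def K_def A_def d_def)
  finally show ?thesis by (simp add: d_def algebra_simps)
qed

end

text \<open>A tent function, used as an approximate point mass at x to recover pointwise values from
  pairings.\<close>

lemma bump_c_infty:
  fixes x :: "'a::euclidean_space"
  assumes "\<delta> > 0"
  obtains w N where "\<And>y. 0 \<le> apply_c_infty w y" "\<And>y. norm (y - x) \<ge> \<delta> \<Longrightarrow> apply_c_infty w y = 0"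
    "N > 0" "mass w = ennreal N" "(LINT y|lborel. apply_c_infty w y) = N"
proof -
  define b where "b y = max 0 (\<delta> - norm (y - x))" for y :: 'a
  have cont: "continuous_on UNIV b" unfolding b_def by (intro continuous_intros)
  have "eventually (\<lambda>y. b y = 0) at_infinity"
    unfolding eventually_at_infinity
  proof (intro exI[of _ "norm x + \<delta>"] allI impI)
    fix y :: 'a
    assume "norm x + \<delta> \<le> norm y"
    then have "\<delta> \<le> norm (y - x)" using norm_triangle_ineq2[of y x] by linarith
    then show "b y = 0" by (simp add: b_def)
  qed
  then have lim: "(b \<longlongrightarrow> 0) at_infinity" by (rule tendsto_eventually)
  define w where "w = C_infty b"
  have w: "apply_c_infty w = b" unfolding w_def by (rule apply_c_infty_C_infty[OF cont lim])
  have [measurable]: "b \<in> borel_measurable borel" by (rule borel_measurable_continuous_onI[OF cont])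
  have b: "0 \<le> b y" "norm (y - x) \<ge> \<delta> \<Longrightarrow> b y = 0" for y by (auto simp: b_def)
  have "(\<integral>\<^sup>+ y. ennreal (b y) \<partial>lborel) \<le> (\<integral>\<^sup>+ y. ennreal \<delta> * indicator (ball x \<delta>) y \<partial>lborel)"
    using assms by (intro nn_integral_mono) (auto simp: b_def indicator_def dist_norm norm_minus_commute intro!: ennreal_leI)
  also have "\<dots> = ennreal \<delta> * emeasure lborel (ball x \<delta>)"
    by (rule nn_integral_cmult_indicator) simp
  also have "\<dots> < \<infinity>"
    using emeasure_lborel_ball_finite[of x \<delta>] by (simp add: ennreal_mult_less_top)
  finally have fin: "(\<integral>\<^sup>+ y. ennreal (b y) \<partial>lborel) < \<infinity>" .
  have int: "integrable lborel b"
    using fin b(1) by (intro integrableI_bounded) auto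
  define N where "N = (LINT y|lborel. b y)"
  have mass: "mass w = ennreal N"
    unfolding mass_def w N_def using b(1) by (intro nn_integral_eq_integral int) auto
  have "N > 0"
  proof -
    have half: "\<delta> / 2 \<le> b y" if "norm (y - x) < \<delta> / 2" for y
      using that unfolding b_def by linarith
    have "0 < ennreal (\<delta> / 2) * emeasure lborel (ball x (\<delta> / 2))"
      using assms by (simp add: emeasure_ball ennreal_zero_less_mult_iff unit_ball_vol_pos)
    also have "\<dots> = (\<integral>\<^sup>+ y. ennreal (\<delta> / 2) * indicator (ball x (\<delta> / 2)) y \<partial>lborel)"
      by (rule nn_integral_cmult_indicator[symmetric]) simp
    also have "\<dots> \<le> (\<integral>\<^sup>+ y. ennreal (b y) \<partial>lborel)"
      by (intro nn_integral_mono) (auto simp: indicator_def dist_norm norm_minus_commute intro!: ennreal_leI half)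
    also have "\<dots> = ennreal N" using mass by (simp add: mass_def w)
    finally show ?thesis by simp
  qed
  with mass b show ?thesis
    by (intro that[of w N]) (auto simp: w N_def)
qed

text \<open>The factor 4^(\<alpha>+d) comes from working with radius R/4; the two summands cover the
  regime t/2 \<le> (R/4)^\<alpha> and its complement.\<close>

definition tail_const :: "'a::euclidean_space itself \<Rightarrow> real \<Rightarrow> real \<Rightarrow> real \<Rightarrow> real"
  where "tail_const T \<alpha> M a = 4 powr (\<alpha> + real DIM('a)) * (off_const T \<alpha> M * (1 + diag_const T \<alpha> M a) + diag_const T \<alpha> M a)"

section \<open>Off-diagonal decay of the semigroup\<close>

context stable_like_semigroup
begin

text \<open>With \<open>\<eta>\<close> a cutoff that separates \<open>x\<close> from the support of \<open>\<phi>\<close>, split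
  \<open>P t \<phi> = P s (\<eta> P s \<phi>) + P s ((1 - \<eta>) P s \<phi>)\<close> for \<open>s = t / 2\<close>. The first function is small
  near \<open>x\<close> by \<open>P_far_le\<close>, the second after moving \<open>P s (1 - \<eta>) P s\<close> to the test function.\<close>

lemma P_tail_pairing_le:
  assumes "s > 0" "R > 0" "s \<le> (R / 4) powr \<alpha>" "N \<ge> 0" "0 < \<delta>" "\<delta> \<le> R / 12" "N' \<ge> 0"
    and \<phi>: "\<And>y. apply_c_infty \<phi> y \<ge> 0" "mass \<phi> \<le> ennreal N"
      "\<And>y. norm (y - x) < R \<Longrightarrow> apply_c_infty \<phi> y = 0"
    and w: "\<And>y. apply_c_infty w y \<ge> 0" "mass w \<le> ennreal N'"
      "\<And>y. norm (y - x) \<ge> \<delta> \<Longrightarrow> apply_c_infty w y = 0"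
  shows "(LINT y|lborel. apply_c_infty (P (s + s) \<phi>) y * apply_c_infty w y)
    \<le> 2 * (off_const TYPE('a) \<alpha> M * s * (R / 4) powr (- \<alpha> - real DIM('a)) * (1 + diag_const TYPE('a) \<alpha> M a)) * N * N'"
proof -
  define E where "E = off_const TYPE('a) \<alpha> M * s * (R / 4) powr (- \<alpha> - real DIM('a)) * (1 + diag_const TYPE('a) \<alpha> M a)"
  have E: "E \<ge> 0" unfolding E_def using off_const_pos diag_const_pos assms by (simp add: less_imp_le)
  \<comment> \<open>The ramp rises from 0 at distance R/3 to 1 at distance 2 R/3. As \<delta> \<le>
    R/12, a ball of radius R/4 about a point where w is nonzero stays within R/3 of x; about a point
    where \<phi> is nonzero it stays beyond 2 R/3.\<close>
  define \<eta> where "\<eta> y = max 0 (min 1 (3 * norm (y - x) / R - 1))" for y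
  have \<eta>: "continuous_on UNIV \<eta>" "0 \<le> \<eta> y" "\<eta> y \<le> 1" for y
    unfolding \<eta>_def using \<open>R > 0\<close> by (intro continuous_intros) auto
  have \<eta>': "continuous_on UNIV (\<lambda>y. 1 - \<eta> y)" "0 \<le> 1 - \<eta> y" "1 - \<eta> y \<le> 1" for y
    using \<eta> by (auto intro: continuous_intros)
  have \<eta>_0: "\<eta> y = 0" if "norm (y - x) \<le> R / 3" for y
    using that \<open>R > 0\<close> by (simp add: \<eta>_def field_simps)
  have \<eta>_1: "\<eta> y = 1" if "norm (y - x) \<ge> 2 * R / 3" for y
    using that \<open>R > 0\<close> by (simp add: \<eta>_def field_simps)
  define h where "h = P s \<phi>"
  define v where "v = P s w"
  have h: "apply_c_infty h y \<ge> 0" for y unfolding h_def by (intro P_positive assms)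
  have h_mass: "mass h \<le> ennreal N" unfolding h_def by (intro P_mass_le assms)
  have h_le: "apply_c_infty h y \<le> diag_const TYPE('a) \<alpha> M a * s powr (- (real DIM('a) / \<alpha>)) * N" for y
    unfolding h_def by (intro P_sup_le assms)
  have v: "apply_c_infty v y \<ge> 0" for y unfolding v_def by (intro P_positive assms)
  have v_mass: "mass v \<le> ennreal N'" unfolding v_def by (intro P_mass_le assms)
  have v_le: "apply_c_infty v y \<le> diag_const TYPE('a) \<alpha> M a * s powr (- (real DIM('a) / \<alpha>)) * N'" for y
    unfolding v_def by (intro P_sup_le assms)
  note cut = apply_cutoff[OF \<eta>] apply_cutoff[OF \<eta>']
  have pos_cut: "apply_c_infty (cutoff \<eta> h) y \<ge> 0" "apply_c_infty (cutoff (\<lambda>y. 1 - \<eta> y) h) y \<ge> 0"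
     "apply_c_infty (cutoff (\<lambda>y. 1 - \<eta> y) v) y \<ge> 0" for y
    using h v \<eta> \<eta>' by (simp_all add: cut)
  have mass_cut: "mass (cutoff \<eta> h) \<le> ennreal N" "mass (cutoff (\<lambda>y. 1 - \<eta> y) h) \<le> ennreal N"
     "mass (cutoff (\<lambda>y. 1 - \<eta> y) v) \<le> ennreal N'"
    using order_trans[OF mass_cutoff_le h_mass] order_trans[OF mass_cutoff_le v_mass] h v \<eta> \<eta>' by blast+
  \<comment> \<open>\<open>P_far_le\<close> involves a supremum. For functions below the diagonal
    bound at time s the factor s^(d/\<alpha>) cancels against it, and only the mass bound L
    remains.\<close>
  have far: "apply_c_infty (P s g) z \<le> E * L"
    if "L \<ge> 0" "\<And>y. apply_c_infty g y \<ge> 0" "mass g \<le> ennreal L"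
      "\<And>y. apply_c_infty g y \<le> diag_const TYPE('a) \<alpha> M a * s powr (- (real DIM('a) / \<alpha>)) * L"
      "\<And>y. norm (y - z) < R / 4 \<Longrightarrow> apply_c_infty g y = 0" for g z L
  proof -
    have "apply_c_infty (P s g) z \<le> off_const TYPE('a) \<alpha> M * s * (R / 4) powr (- \<alpha> - real DIM('a)) *
      (L + (diag_const TYPE('a) \<alpha> M a * s powr (- (real DIM('a) / \<alpha>)) * L) * s powr (real DIM('a) / \<alpha>))"
      using that assms diag_const_pos by (intro P_far_le) (auto simp: less_imp_le)
    also have "(diag_const TYPE('a) \<alpha> M a * s powr (- (real DIM('a) / \<alpha>)) * L) * s powr (real DIM('a) / \<alpha>)
       = diag_const TYPE('a) \<alpha> M a * L * (s powr (- (real DIM('a) / \<alpha>)) * s powr (real DIM('a) / \<alpha>))"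
      by (simp only: mult_ac)
    also have "s powr (- (real DIM('a) / \<alpha>)) * s powr (real DIM('a) / \<alpha>) = 1"
      using \<open>s > 0\<close> by (simp add: powr_minus)
    finally show ?thesis by (simp add: E_def algebra_simps)
  qed
  have w_int: "integrable lborel (apply_c_infty w)" and \<phi>_int: "integrable lborel (apply_c_infty \<phi>)"
    using integrable_of_mass w \<phi> by blast+
  have first: "(LINT y|lborel. apply_c_infty (P s (cutoff \<eta> h)) y * apply_c_infty w y) \<le> E * N * N'"
  proof -
    have "(LINT y|lborel. apply_c_infty (P s (cutoff \<eta> h)) y * apply_c_infty w y) \<le> (LINT y|lborel. E * N * apply_c_infty w y)"
    proof (intro integral_mono integrable_mult_c_infty integrable_mult_right w_int)
      fix z
      show "apply_c_infty (P s (cutoff \<eta> h)) z * apply_c_infty w z \<le> E * N * apply_c_infty w z"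
      proof (cases "norm (z - x) \<ge> \<delta>")
        case False
        have "apply_c_infty (P s (cutoff \<eta> h)) z \<le> E * N"
        proof (rule far)
          show "apply_c_infty (cutoff \<eta> h) y \<le> diag_const TYPE('a) \<alpha> M a * s powr (- (real DIM('a) / \<alpha>)) * N" for y
            unfolding cut using mult_left_le_one_le[OF h \<eta>(2,3), of y y] h_le[of y] by simp
          fix y
          assume "norm (y - z) < R / 4"
          then have "norm (y - x) \<le> R / 3"
            using False assms norm_triangle_ineq[of "y - z" "z - x"] by simp
          then show "apply_c_infty (cutoff \<eta> h) y = 0"
            unfolding cut by (simp add: \<eta>_0)
        qed (use assms pos_cut mass_cut in auto)
        then show ?thesis using w(1) by (rule mult_right_mono)
      qed (use w in simp)
    qed
    also have "\<dots> \<le> E * N * N'"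
      using integral_le_of_mass[OF w(1,2) \<open>N' \<ge> 0\<close>] E \<open>N \<ge> 0\<close> by (simp add: mult_left_mono)
    finally show ?thesis .
  qed
  have second: "(LINT y|lborel. apply_c_infty (P s (cutoff (\<lambda>y. 1 - \<eta> y) h)) y * apply_c_infty w y) \<le> E * N * N'"
  proof -
    let ?g = "cutoff (\<lambda>y. 1 - \<eta> y) v"
    have "(LINT y|lborel. apply_c_infty (P s (cutoff (\<lambda>y. 1 - \<eta> y) h)) y * apply_c_infty w y)
       = (LINT y|lborel. apply_c_infty (cutoff (\<lambda>y. 1 - \<eta> y) h) y * apply_c_infty v y)"
      unfolding v_def by (rule P_symmetric[OF \<open>s > 0\<close> pos_cut(2) mass_cut(2) w(1,2)])
    also have "\<dots> = (LINT y|lborel. apply_c_infty h y * apply_c_infty ?g y)"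
      by (simp add: cut mult_ac)
    also have "\<dots> = (LINT y|lborel. apply_c_infty \<phi> y * apply_c_infty (P s ?g) y)"
      unfolding h_def by (rule P_symmetric[OF \<open>s > 0\<close> \<phi>(1,2) pos_cut(3) mass_cut(3)])
    also have "\<dots> \<le> (LINT y|lborel. E * N' * apply_c_infty \<phi> y)"
    proof (intro integral_mono integrable_mult_right \<phi>_int)
      show "integrable lborel (\<lambda>y. apply_c_infty \<phi> y * apply_c_infty (P s ?g) y)"
        using integrable_mult_c_infty[OF \<phi>_int, of "P s ?g"] by (simp add: mult.commute)
      fix z
      show "apply_c_infty \<phi> z * apply_c_infty (P s ?g) z \<le> E * N' * apply_c_infty \<phi> z"
      proof (cases "norm (z - x) < R")
        case False
        have "apply_c_infty (P s ?g) z \<le> E * N'"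
        proof (rule far)
          show "apply_c_infty ?g y \<le> diag_const TYPE('a) \<alpha> M a * s powr (- (real DIM('a) / \<alpha>)) * N'" for y
            unfolding cut using mult_left_le_one_le[OF v \<eta>'(2,3), of y y] v_le[of y] by simp
          fix y
          assume "norm (y - z) < R / 4"
          then have "norm (y - x) \<ge> 2 * R / 3"
            using False \<open>R > 0\<close> norm_triangle_ineq4[of "y - x" "y - z"] by simp
          then show "apply_c_infty ?g y = 0"
            unfolding cut by (simp add: \<eta>_1)
        qed (use assms pos_cut mass_cut in auto)
        from mult_right_mono[OF this \<phi>(1)] show ?thesis by (simp add: mult.commute)
      qed (use \<phi> in simp)
    qed
    also have "\<dots> \<le> E * N * N'"
      using mult_left_mono[OF integral_le_of_mass[OF \<phi>(1,2) \<open>N \<ge> 0\<close>], of "E * N'"] E \<open>N' \<ge> 0\<close>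
      by (simp add: mult_ac)
    finally show ?thesis .
  qed
  have h_split: "h = cutoff \<eta> h + cutoff (\<lambda>y. 1 - \<eta> y) h"
    by (rule c_infty_eqI) (simp add: plus_c_infty.rep_eq cut algebra_simps)
  have "P (s + s) \<phi> = P s h"
    unfolding h_def using \<open>s > 0\<close> by (intro sg_add[OF semigroup]) auto
  also have "\<dots> = P s (cutoff \<eta> h) + P s (cutoff (\<lambda>y. 1 - \<eta> y) h)"
    by (subst h_split) (rule blinfun.add_right)
  finally have "(LINT y|lborel. apply_c_infty (P (s + s) \<phi>) y * apply_c_infty w y)
     = (LINT y|lborel. apply_c_infty (P s (cutoff \<eta> h)) y * apply_c_infty w y
       + apply_c_infty (P s (cutoff (\<lambda>y. 1 - \<eta> y) h)) y * apply_c_infty w y)"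
    by (simp add: plus_c_infty.rep_eq distrib_right)
  also have "\<dots> = (LINT y|lborel. apply_c_infty (P s (cutoff \<eta> h)) y * apply_c_infty w y)
       + (LINT y|lborel. apply_c_infty (P s (cutoff (\<lambda>y. 1 - \<eta> y) h)) y * apply_c_infty w y)"
    by (intro Bochner_Integration.integral_add integrable_mult_c_infty w_int)
  finally show ?thesis using first second by (simp add: E_def)
qed

text \<open>If t/2 \<le> (R/4)^\<alpha>, a value at x above the bound would persist on a small ball
  by continuity and contradict the pairing estimate for a bump supported there. For larger t the
  diagonal bound suffices, since t^(-d/\<alpha>) = t t^(-1-d/\<alpha>).\<close>

lemma P_tail_le:
  assumes "t > 0" "R > 0" "N \<ge> 0"
    and \<phi>: "\<And>y. apply_c_infty \<phi> y \<ge> 0" "mass \<phi> \<le> ennreal N"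
      "\<And>y. norm (y - x) < R \<Longrightarrow> apply_c_infty \<phi> y = 0"
  shows "apply_c_infty (P t \<phi>) x \<le> tail_const TYPE('a) \<alpha> M a * t * R powr (- \<alpha> - real DIM('a)) * N"
proof -
  define s where "s = t / 2"
  have s: "s > 0" "s + s = t" using \<open>t > 0\<close> by (simp_all add: s_def)
  have R4: "(R / 4) powr (- \<alpha> - real DIM('a)) = 4 powr (\<alpha> + real DIM('a)) * R powr (- \<alpha> - real DIM('a))"
  proof -
    have "- \<alpha> - real DIM('a) = - (\<alpha> + real DIM('a))" by simp
    then show ?thesis using \<open>R > 0\<close> by (simp only: powr_minus powr_divide) (simp add: divide_inverse)
  qed
  have T: "tail_const TYPE('a) \<alpha> M a * t * R powr (- \<alpha> - real DIM('a)) * N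
    = (off_const TYPE('a) \<alpha> M * (1 + diag_const TYPE('a) \<alpha> M a) + diag_const TYPE('a) \<alpha> M a) * t * (R / 4) powr (- \<alpha> - real DIM('a)) * N"
    unfolding R4 tail_const_def by (simp only: mult_ac)
  show ?thesis
  proof (cases "s \<le> (R / 4) powr \<alpha>")
    case True
    define B where "B = 2 * (off_const TYPE('a) \<alpha> M * s * (R / 4) powr (- \<alpha> - real DIM('a)) * (1 + diag_const TYPE('a) \<alpha> M a)) * N"
    have "apply_c_infty (P t \<phi>) x \<le> B"
    proof (rule ccontr)
      assume "\<not> ?thesis"
      then have gt: "apply_c_infty (P t \<phi>) x > B" by simp
      define e where "e = (apply_c_infty (P t \<phi>) x - B) / 2"
      have e: "e > 0" using gt by (simp add: e_def)
      have "isCont (apply_c_infty (P t \<phi>)) x"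
        using continuous_on_apply_c_infty[of UNIV "P t \<phi>"] by (simp add: continuous_on_eq_continuous_at)
      then obtain d where d: "d > 0" "\<And>y. norm (y - x) < d \<Longrightarrow> \<bar>apply_c_infty (P t \<phi>) y - apply_c_infty (P t \<phi>) x\<bar> < e"
        using e unfolding continuous_at_eps_delta dist_norm by (metis real_norm_def)
      define \<delta> where "\<delta> = min d (R / 12)"
      have \<delta>: "0 < \<delta>" "\<delta> \<le> R / 12" "\<delta> \<le> d" using d(1) \<open>R > 0\<close> by (auto simp: \<delta>_def)
      obtain w N' where w: "\<And>y. 0 \<le> apply_c_infty w y" "\<And>y. norm (y - x) \<ge> \<delta> \<Longrightarrow> apply_c_infty w y = 0"
        "N' > 0" "mass w = ennreal N'" "(LINT y|lborel. apply_c_infty w y) = N'"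
        using bump_c_infty[OF \<delta>(1), of x] by metis
      have w_int: "integrable lborel (apply_c_infty w)"
        using integrable_of_mass[of w N'] w by simp
      have "(B + e) * N' = (LINT y|lborel. (B + e) * apply_c_infty w y)" by (simp add: w)
      also have "\<dots> \<le> (LINT y|lborel. apply_c_infty (P t \<phi>) y * apply_c_infty w y)"
      proof (intro integral_mono integrable_mult_c_infty integrable_mult_right w_int)
        fix y
        show "(B + e) * apply_c_infty w y \<le> apply_c_infty (P t \<phi>) y * apply_c_infty w y"
        proof (cases "norm (y - x) \<ge> \<delta>")
          case False
          then have "\<bar>apply_c_infty (P t \<phi>) y - apply_c_infty (P t \<phi>) x\<bar> < e" using d \<delta> by simp
          moreover have "B + 2 * e = apply_c_infty (P t \<phi>) x" unfolding e_def by (simp add: field_simps)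
          ultimately have "B + e \<le> apply_c_infty (P t \<phi>) y" by linarith
          then show ?thesis using w(1) by (rule mult_right_mono)
        qed (use w in simp)
      qed
      also have "\<dots> \<le> B * N'"
        using P_tail_pairing_le[OF s(1) \<open>R > 0\<close> True \<open>N \<ge> 0\<close> \<delta>(1,2) _ \<phi> w(1) _ w(2), of N'] w(3,4)
        unfolding s B_def by simp
      finally show False using e w(3) by (simp add: mult_le_cancel_right)
    qed
    also have "B = off_const TYPE('a) \<alpha> M * (1 + diag_const TYPE('a) \<alpha> M a) * t * (R / 4) powr (- \<alpha> - real DIM('a)) * N"
      by (simp add: B_def s_def)
    also have "\<dots> \<le> (off_const TYPE('a) \<alpha> M * (1 + diag_const TYPE('a) \<alpha> M a) + diag_const TYPE('a) \<alpha> M a) * t * (R / 4) powr (- \<alpha> - real DIM('a)) * N"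
      using diag_const_pos assms by (intro mult_right_mono) (auto intro: less_imp_le)
    finally show ?thesis by (simp only: T)
  next
    case False
    have "apply_c_infty (P t \<phi>) x \<le> diag_const TYPE('a) \<alpha> M a * t powr (- (real DIM('a) / \<alpha>)) * N"
      by (intro P_sup_le assms)
    also have "t powr (- (real DIM('a) / \<alpha>)) \<le> t * (R / 4) powr (- \<alpha> - real DIM('a))"
    proof -
      have "t powr (- (1 + real DIM('a) / \<alpha>)) \<le> ((R / 4) powr \<alpha>) powr (- (1 + real DIM('a) / \<alpha>))"
      proof (rule powr_mono2')
        have "0 \<le> real DIM('a) / \<alpha>" using alpha by simp
        then show "- (1 + real DIM('a) / \<alpha>) \<le> 0" by linarith
      qed (use False s \<open>R > 0\<close> in auto)
      also have "\<dots> = (R / 4) powr (- \<alpha> - real DIM('a))"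
      proof -
        have "\<alpha> * (- (1 + real DIM('a) / \<alpha>)) = - \<alpha> - real DIM('a)" using alpha by (simp add: field_simps)
        then show ?thesis by (simp only: powr_powr)
      qed
      finally have "t * t powr (- (1 + real DIM('a) / \<alpha>)) \<le> t * (R / 4) powr (- \<alpha> - real DIM('a))"
        using \<open>t > 0\<close> by (intro mult_left_mono) auto
      moreover have "t * t powr (- (1 + real DIM('a) / \<alpha>)) = t powr (- (real DIM('a) / \<alpha>))"
        using \<open>t > 0\<close> powr_add[of t 1 "- (1 + real DIM('a) / \<alpha>)"] by simp
      ultimately show ?thesis by simp
    qed
    also have "diag_const TYPE('a) \<alpha> M a * (t * (R / 4) powr (- \<alpha> - real DIM('a))) * N = diag_const TYPE('a) \<alpha> M a * t * (R / 4) powr (- \<alpha> - real DIM('a)) * N"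
      by simp
    also have "\<dots> \<le> (off_const TYPE('a) \<alpha> M * (1 + diag_const TYPE('a) \<alpha> M a) + diag_const TYPE('a) \<alpha> M a) * t * (R / 4) powr (- \<alpha> - real DIM('a)) * N"
      using diag_const_pos off_const_pos assms by (intro mult_right_mono) (auto simp: less_imp_le)
    finally show ?thesis
      using diag_const_pos \<open>N \<ge> 0\<close> by (simp add: T mult_left_mono mult_right_mono)
  qed
qed

end


section \<open>Densities of functionals bounded in mean\<close>

text \<open>On the set where g1 > g2 the difference is positive, yet its integral is at most 0, so
  the set is null.\<close>

lemma AE_le_of_integral_indicator_le:
  fixes g1 g2 :: "'b \<Rightarrow> real"
  assumes int: "integrable M g1" "integrable M g2"
    and le: "\<And>B. B \<in> sets M \<Longrightarrow> (LINT x|M. indicator B x * g1 x) \<le> (LINT x|M. indicator B x * g2 x)"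
  shows "AE x in M. g1 x \<le> g2 x"
proof -
  have [measurable]: "g1 \<in> borel_measurable M" "g2 \<in> borel_measurable M" using int by auto
  define B where "B = {x \<in> space M. g1 x > g2 x}"
  have B: "B \<in> sets M" unfolding B_def by measurable
  have int': "integrable M (\<lambda>x. indicator B x * g1 x)" "integrable M (\<lambda>x. indicator B x * g2 x)"
    using integrable_mult_indicator[OF B int(1)] integrable_mult_indicator[OF B int(2)] by simp_all
  have nonneg: "AE x in M. 0 \<le> indicator B x * g1 x - indicator B x * g2 x"
    by (intro AE_I2) (auto simp: B_def indicator_def)
  have "(LINT x|M. indicator B x * g1 x - indicator B x * g2 x) \<le> 0"
    using le[OF B] int' by simp
  moreover have "(LINT x|M. indicator B x * g1 x - indicator B x * g2 x) \<ge> 0"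
    using nonneg by (rule integral_nonneg_AE)
  ultimately have "(LINT x|M. indicator B x * g1 x - indicator B x * g2 x) = 0" by linarith
  then have "AE x in M. indicator B x * g1 x - indicator B x * g2 x = 0"
    using integral_nonneg_eq_0_iff_AE[OF Bochner_Integration.integrable_diff[OF int'] nonneg] by blast
  with AE_space show ?thesis
    by eventually_elim (auto simp: B_def indicator_def split: if_splits)
qed

lemma L1_tendsto_dominated:
  fixes s :: "nat \<Rightarrow> 'b \<Rightarrow> real"
  assumes "\<And>i. integrable M (s i)" "integrable M F" "integrable M w"
    and "AE x in M. (\<lambda>i. s i x) \<longlonglongrightarrow> F x" "\<And>i. AE x in M. \<bar>s i x\<bar> \<le> w x"
  shows "(\<lambda>i. LINT x|M. \<bar>F x - s i x\<bar>) \<longlonglongrightarrow> 0"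
proof -
  have "(\<lambda>i. LINT x|M. \<bar>F x - s i x\<bar>) \<longlonglongrightarrow> (LINT x|M. (0::real))"
  proof (rule integral_dominated_convergence[where w="\<lambda>x. \<bar>F x\<bar> + w x"])
    show "AE x in M. (\<lambda>i. \<bar>F x - s i x\<bar>) \<longlonglongrightarrow> 0"
      using assms(4)
    proof eventually_elim
      case (elim x)
      have "(\<lambda>i. \<bar>F x - s i x\<bar>) \<longlonglongrightarrow> \<bar>F x - F x\<bar>" by (intro tendsto_intros elim)
      then show ?case by simp
    qed
    show "AE x in M. norm \<bar>F x - s i x\<bar> \<le> \<bar>F x\<bar> + w x" for i
      using assms(5)[of i]
    proof eventually_elim
      case (elim x)
      then show ?case using abs_triangle_ineq4[of "F x" "s i x"] by simp
    qed
  qed (use assms in auto)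
  then show ?thesis by simp
qed

lemma L1_dist_triangle:
  fixes F G H :: "'b \<Rightarrow> real"
  assumes "integrable M F" "integrable M G" "integrable M H"
  shows "(LINT x|M. \<bar>F x - H x\<bar>) \<le> (LINT x|M. \<bar>F x - G x\<bar>) + (LINT x|M. \<bar>G x - H x\<bar>)"
proof -
  have "(LINT x|M. \<bar>F x - H x\<bar>) \<le> (LINT x|M. \<bar>F x - G x\<bar> + \<bar>G x - H x\<bar>)"
    using assms by (intro integral_mono) auto
  also have "\<dots> = (LINT x|M. \<bar>F x - G x\<bar>) + (LINT x|M. \<bar>G x - H x\<bar>)"
    using assms by (intro Bochner_Integration.integral_add) auto
  finally show ?thesis .
qed

section \<open>Density of the integrable functions vanishing at infinity in L1\<close>

definition L1_approximable :: "('a::euclidean_space \<Rightarrow> real) \<Rightarrow> bool"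
  where "L1_approximable F \<longleftrightarrow>
    (\<forall>e>0. \<exists>\<phi>. integrable lborel (apply_c_infty \<phi>) \<and> (LINT x|lborel. \<bar>F x - apply_c_infty \<phi> x\<bar>) < e)"

lemma L1_approximable_limit:
  assumes F: "integrable lborel F" and s: "\<And>i::nat. integrable lborel (s i)" "\<And>i. L1_approximable (s i)"
    and lim: "(\<lambda>i. LINT x|lborel. \<bar>F x - s i x\<bar>) \<longlonglongrightarrow> 0"
  shows "L1_approximable F"
  unfolding L1_approximable_def
proof (intro allI impI)
  fix e :: real
  assume "e > 0"
  then obtain i where i: "(LINT x|lborel. \<bar>F x - s i x\<bar>) < e / 2"
    using order_tendstoD(2)[OF lim, of "e / 2"] by (auto simp: eventually_sequentially)
  obtain \<phi> where \<phi>: "integrable lborel (apply_c_infty \<phi>)" "(LINT x|lborel. \<bar>s i x - apply_c_infty \<phi> x\<bar>) < e / 2"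
    using s(2)[of i] \<open>e > 0\<close> unfolding L1_approximable_def by (meson half_gt_zero)
  with i L1_dist_triangle[OF F s(1) \<phi>(1), of i]
  show "\<exists>\<phi>. integrable lborel (apply_c_infty \<phi>) \<and> (LINT x|lborel. \<bar>F x - apply_c_infty \<phi> x\<bar>) < e"
    by (intro exI[of _ \<phi>]) auto
qed

lemma L1_approximable_scale:
  assumes "L1_approximable F"
  shows "L1_approximable (\<lambda>x. c * F x)"
  unfolding L1_approximable_def
proof (intro allI impI)
  fix e :: real
  assume "e > 0"
  then have "e / (\<bar>c\<bar> + 1) > 0" by simp
  then obtain \<phi> where \<phi>: "integrable lborel (apply_c_infty \<phi>)" "(LINT x|lborel. \<bar>F x - apply_c_infty \<phi> x\<bar>) < e / (\<bar>c\<bar> + 1)"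
    using assms unfolding L1_approximable_def by blast
  have "(LINT x|lborel. \<bar>c * F x - apply_c_infty (c *\<^sub>R \<phi>) x\<bar>) = \<bar>c\<bar> * (LINT x|lborel. \<bar>F x - apply_c_infty \<phi> x\<bar>)"
    by (simp add: scaleR_c_infty.rep_eq abs_mult flip: right_diff_distrib)
  also have "\<dots> \<le> (\<bar>c\<bar> + 1) * (LINT x|lborel. \<bar>F x - apply_c_infty \<phi> x\<bar>)"
    by (intro mult_right_mono) auto
  also have "\<dots> < e"
    using \<phi>(2) by (simp add: field_simps)
  finally show "\<exists>\<phi>. integrable lborel (apply_c_infty \<phi>) \<and> (LINT x|lborel. \<bar>c * F x - apply_c_infty \<phi> x\<bar>) < e"
    using \<phi>(1) by (intro exI[of _ "c *\<^sub>R \<phi>"]) (simp add: scaleR_c_infty.rep_eq)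
qed

text \<open>Outer regularity of A and of its complement encloses A between a closed and an open set
  that differ by little measure, and Urysohn's function for this pair is L1-close to the indicator.
  Intersecting the open set with a ball makes it vanish near infinity.\<close>

lemma L1_approximable_indicator_bounded:
  fixes A :: "'a::euclidean_space set"
  assumes A: "A \<in> sets borel" "A \<subseteq> ball 0 b"
  shows "L1_approximable (indicator A)"
  unfolding L1_approximable_def
proof (intro allI impI)
  fix e :: real
  assume "e > 0"
  obtain U where U: "open U" "A \<subseteq> U" "emeasure lborel (U - A) < ennreal (e / 4)"
    using outer_regular_lborel[OF A(1), of "e / 4"] \<open>e > 0\<close> by auto
  obtain V where V: "open V" "- A \<subseteq> V" "emeasure lborel (V - (- A)) < ennreal (e / 4)"
    using outer_regular_lborel[of "- A" "e / 4"] A(1) \<open>e > 0\<close> by auto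
  define U' where "U' = U \<inter> ball 0 b"
  have "closed (- V)" "closed (- U')" "(- V) \<inter> (- U') = {}"
    using U V A by (auto simp: U'_def)
  then obtain \<phi> :: "'a \<Rightarrow> real" where \<phi>: "continuous_on UNIV \<phi>" "\<And>x. \<phi> x \<in> closed_segment 1 0"
    "\<And>x. x \<in> - V \<Longrightarrow> \<phi> x = 1" "\<And>x. x \<in> - U' \<Longrightarrow> \<phi> x = 0"
    using Urysohn[of "- V" "- U'" 1 "0::real"] by metis
  have \<phi>01: "0 \<le> \<phi> x" "\<phi> x \<le> 1" for x using \<phi>(2)[of x] by (auto simp: closed_segment_eq_real_ivl)
  have "eventually (\<lambda>x. \<phi> x = 0) at_infinity"
    unfolding eventually_at_infinity by (intro exI[of _ b]) (auto intro!: \<phi>(4) simp: U'_def)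
  then have "(\<phi> \<longlongrightarrow> 0) at_infinity" by (rule tendsto_eventually)
  then have ap: "apply_c_infty (C_infty \<phi>) = \<phi>" by (rule apply_c_infty_C_infty[OF \<phi>(1)])
  have [measurable]: "\<phi> \<in> borel_measurable borel" by (rule borel_measurable_continuous_onI[OF \<phi>(1)])
  have [measurable]: "A \<in> sets borel" "U \<in> sets borel" "V \<in> sets borel" using A U V by auto
  have int_ball: "integrable lborel (indicator (ball (0::'a) b) :: 'a \<Rightarrow> real)"
    using emeasure_lborel_ball_finite[of "0::'a" b] by (intro integrable_real_indicator) auto
  have int: "integrable lborel \<phi>"
    by (rule Bochner_Integration.integrable_bound[OF int_ball]) (use \<phi>01 \<phi>(4) in \<open>auto simp: indicator_def U'_def\<close>)
  define W where "W = (U - A) \<union> (V - (- A))"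
  have W[measurable]: "W \<in> sets borel" unfolding W_def by measurable
  have "(LINT x|lborel. \<bar>indicator A x - \<phi> x\<bar>) \<le> e / 2"
  proof (rule integral_le_nn_integral[where g="indicator W"])
    have "(\<integral>\<^sup>+ x. ennreal (indicator W x) \<partial>lborel) = emeasure lborel ((U - A) \<union> (V - (- A)))"
      using W by (simp only: ennreal_indicator nn_integral_indicator sets_lborel W_def)
    also have "\<dots> \<le> emeasure lborel (U - A) + emeasure lborel (V - (- A))"
      by (rule emeasure_subadditive) auto
    also have "\<dots> \<le> ennreal (e / 4) + ennreal (e / 4)"
      using U V by (intro add_mono) auto
    also have "\<dots> = ennreal (e / 2)"
      using \<open>e > 0\<close> by (simp add: ennreal_plus[symmetric] del: ennreal_plus)
    finally show "(\<integral>\<^sup>+ x. ennreal (indicator W x) \<partial>lborel) \<le> ennreal (e / 2)" .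
    fix x
    show "\<bar>indicator A x - \<phi> x\<bar> \<le> indicator W x"
      using \<phi>01[of x] \<phi>(3)[of x] \<phi>(4)[of x] by (auto simp: indicator_def U'_def W_def)
  qed (use \<open>e > 0\<close> in auto)
  then show "\<exists>\<phi>. integrable lborel (apply_c_infty \<phi>) \<and> (LINT x|lborel. \<bar>indicator A x - apply_c_infty \<phi> x\<bar>) < e"
    using int \<open>e > 0\<close> by (intro exI[of _ "C_infty \<phi>"]) (simp add: ap)
qed

lemma L1_approximable:
  fixes F :: "'a::euclidean_space \<Rightarrow> real"
  assumes "integrable lborel F"
  shows "L1_approximable F"
  using assms
proof (induction rule: integrable_induct)
  case (base A c)
  have A: "A \<in> sets borel" using base by simp
  have int: "integrable lborel (indicator A :: 'a \<Rightarrow> real)" using base by (intro integrable_real_indicator) auto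
  have "L1_approximable (indicator A :: 'a \<Rightarrow> real)"
  proof (rule L1_approximable_limit[where s="\<lambda>n. indicator (A \<inter> ball 0 (real n))"])
    have bound: "\<bar>indicator (A \<inter> ball 0 (real n)) x\<bar> \<le> (indicator A x :: real)" for n and x :: 'a
      by (simp add: indicator_def)
    show int_n: "integrable lborel (indicator (A \<inter> ball 0 (real n)) :: 'a \<Rightarrow> real)" for n
    proof (rule Bochner_Integration.integrable_bound[OF int])
      show "(indicator (A \<inter> ball 0 (real n)) :: 'a \<Rightarrow> real) \<in> borel_measurable lborel"
        using A by (intro borel_measurable_indicator) simp
    qed (auto simp: indicator_def)
    show "(\<lambda>n. LINT x|lborel. \<bar>indicator A x - indicator (A \<inter> ball 0 (real n)) x :: real\<bar>) \<longlonglongrightarrow> 0"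
    proof (rule L1_tendsto_dominated[OF int_n int int])
      show "AE x in lborel. (\<lambda>n. indicator (A \<inter> ball 0 (real n)) x :: real) \<longlonglongrightarrow> indicator A x"
      proof (rule AE_I2, rule tendsto_eventually)
        fix x :: 'a
        have "\<forall>\<^sub>F n in sequentially. norm x < real n"
          using filterlim_real_sequentially unfolding filterlim_at_top_dense by blast
        then show "\<forall>\<^sub>F n in sequentially. (indicator (A \<inter> ball 0 (real n)) x :: real) = indicator A x"
          by eventually_elim (auto simp: indicator_def)
      qed
    qed (use bound in auto)
  qed (use int A in \<open>auto intro: L1_approximable_indicator_bounded\<close>)
  then show ?case using L1_approximable_scale[of "indicator A" c] by (simp add: mult.commute)
next
  case (add F G)
  show ?case
    unfolding L1_approximable_def
  proof (intro allI impI)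
    fix e :: real
    assume "e > 0"
    then have "e / 2 > 0" by simp
    then obtain \<phi> \<psi> where \<phi>: "integrable lborel (apply_c_infty \<phi>)" "(LINT x|lborel. \<bar>F x - apply_c_infty \<phi> x\<bar>) < e / 2"
      and \<psi>: "integrable lborel (apply_c_infty \<psi>)" "(LINT x|lborel. \<bar>G x - apply_c_infty \<psi> x\<bar>) < e / 2"
      using add unfolding L1_approximable_def by meson
    have "(LINT x|lborel. \<bar>(F x + G x) - apply_c_infty (\<phi> + \<psi>) x\<bar>)
      \<le> (LINT x|lborel. \<bar>F x - apply_c_infty \<phi> x\<bar> + \<bar>G x - apply_c_infty \<psi> x\<bar>)"
      using add \<phi> \<psi> by (intro integral_mono) (auto simp: plus_c_infty.rep_eq)
    also have "\<dots> = (LINT x|lborel. \<bar>F x - apply_c_infty \<phi> x\<bar>) + (LINT x|lborel. \<bar>G x - apply_c_infty \<psi> x\<bar>)"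
      using add \<phi> \<psi> by (intro Bochner_Integration.integral_add) auto
    also have "\<dots> < e" using \<phi> \<psi> by simp
    finally show "\<exists>\<phi>. integrable lborel (apply_c_infty \<phi>) \<and> (LINT x|lborel. \<bar>(F x + G x) - apply_c_infty \<phi> x\<bar>) < e"
      using \<phi> \<psi> by (intro exI[of _ "\<phi> + \<psi>"]) (auto simp: plus_c_infty.rep_eq)
  qed
next
  case (lim F s)
  have conv: "(\<lambda>i. LINT x|lborel. \<bar>F x - s i x\<bar>) \<longlonglongrightarrow> 0"
    by (rule L1_tendsto_dominated[where w="\<lambda>x. 2 * norm (F x)"]) (use lim in auto)
  show ?case
    by (rule L1_approximable_limit[OF _ _ _ conv]) (use lim in auto)
qed

section \<open>Extension of a positive functional to L1\<close>

definition abs_c_infty :: "'a::euclidean_space c_infty \<Rightarrow> 'a c_infty"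
  where "abs_c_infty \<phi> = C_infty (\<lambda>x. \<bar>apply_c_infty \<phi> x\<bar>)"

lemma apply_abs_c_infty [simp]: "apply_c_infty (abs_c_infty \<phi>) = (\<lambda>x. \<bar>apply_c_infty \<phi> x\<bar>)"
  unfolding abs_c_infty_def
  by (intro apply_c_infty_C_infty continuous_intros continuous_on_apply_c_infty tendsto_rabs_zero tendsto_apply_c_infty)

text \<open>The functional in mind is \<phi> \<mapsto> P t \<phi> x, for which
  \<open>bounded\<close> is the diagonal estimate. That bound speaks of integrable \<phi> only,
  while \<Lambda> is defined beyond L1 as well.\<close>

locale L1_bounded_functional =
  fixes \<Lambda> :: "'a::euclidean_space c_infty \<Rightarrow> real" and c :: real
  assumes linear: "linear \<Lambda>"
    and positive: "\<And>\<phi>. (\<And>x. 0 \<le> apply_c_infty \<phi> x) \<Longrightarrow> 0 \<le> \<Lambda> \<phi>"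
    and bounded: "\<And>\<phi>. (\<And>x. 0 \<le> apply_c_infty \<phi> x) \<Longrightarrow> integrable lborel (apply_c_infty \<phi>) \<Longrightarrow>
      \<Lambda> \<phi> \<le> c * (LINT x|lborel. apply_c_infty \<phi> x)"
    and c: "c > 0"
begin

lemma functional_abs_le:
  assumes "integrable lborel (apply_c_infty \<phi>)"
  shows "\<bar>\<Lambda> \<phi>\<bar> \<le> c * (LINT x|lborel. \<bar>apply_c_infty \<phi> x\<bar>)"
proof -
  have "0 \<le> \<Lambda> (abs_c_infty \<phi> - \<phi>)" "0 \<le> \<Lambda> (abs_c_infty \<phi> + \<phi>)"
    by (intro positive; simp add: minus_c_infty.rep_eq plus_c_infty.rep_eq)+
  then have "\<bar>\<Lambda> \<phi>\<bar> \<le> \<Lambda> (abs_c_infty \<phi>)"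
    by (simp add: linear_diff[OF linear] linear_add[OF linear])
  also have "\<dots> \<le> c * (LINT x|lborel. apply_c_infty (abs_c_infty \<phi>) x)"
    using assms by (intro bounded) auto
  finally show ?thesis by simp
qed

lemma functional_diff_le:
  assumes "integrable lborel (apply_c_infty \<phi>)" "integrable lborel (apply_c_infty \<psi>)"
  shows "\<bar>\<Lambda> \<phi> - \<Lambda> \<psi>\<bar> \<le> c * (LINT x|lborel. \<bar>apply_c_infty \<phi> x - apply_c_infty \<psi> x\<bar>)"
  using functional_abs_le[of "\<phi> - \<psi>"] assms by (simp add: linear_diff[OF linear] minus_c_infty.rep_eq)

text \<open>Extension by continuity without reference to an approximating sequence: the value is a
  number compatible with the Lipschitz bound against all integrable \<phi>. By density only one such
  number exists, see \<open>ext_eqI\<close>.\<close>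

definition ext :: "('a \<Rightarrow> real) \<Rightarrow> real"
  where "ext F = (SOME l. \<forall>\<phi>. integrable lborel (apply_c_infty \<phi>) \<longrightarrow>
    \<bar>l - \<Lambda> \<phi>\<bar> \<le> c * (LINT x|lborel. \<bar>F x - apply_c_infty \<phi> x\<bar>))"

text \<open>A number as in the definition of \<open>ext\<close> exists: the values of \<Lambda>
  along an L1-approximating sequence are Cauchy, and their limit inherits the bound.\<close>

lemma ext_near:
  assumes F: "integrable lborel F" and \<phi>: "integrable lborel (apply_c_infty \<phi>)"
  shows "\<bar>ext F - \<Lambda> \<phi>\<bar> \<le> c * (LINT x|lborel. \<bar>F x - apply_c_infty \<phi> x\<bar>)"
proof -
  have "\<exists>\<phi>. integrable lborel (apply_c_infty \<phi>) \<and> (LINT x|lborel. \<bar>F x - apply_c_infty \<phi> x\<bar>) < inverse (real (Suc n))" for n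
    using L1_approximable[OF F] unfolding L1_approximable_def by simp
  then obtain X where X: "\<And>n. integrable lborel (apply_c_infty (X n))"
    "\<And>n. (LINT x|lborel. \<bar>F x - apply_c_infty (X n) x\<bar>) < inverse (real (Suc n))"
    by metis
  have swap: "(LINT x|lborel. \<bar>G x - H x\<bar>) = (LINT x|lborel. \<bar>H x - G x\<bar>)" for G H :: "'a \<Rightarrow> real"
    by (simp add: abs_minus_commute)
  have step: "\<bar>\<Lambda> (X n) - \<Lambda> \<phi>\<bar> \<le> c * (inverse (real (Suc n)) + (LINT x|lborel. \<bar>F x - apply_c_infty \<phi> x\<bar>))"
    if \<phi>: "integrable lborel (apply_c_infty \<phi>)" for n \<phi>
  proof -
    have "(LINT x|lborel. \<bar>apply_c_infty (X n) x - apply_c_infty \<phi> x\<bar>)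
      \<le> inverse (real (Suc n)) + (LINT x|lborel. \<bar>F x - apply_c_infty \<phi> x\<bar>)"
      using L1_dist_triangle[OF X(1) F \<phi>, of n] X(2)[of n] swap[of F "apply_c_infty (X n)"] by linarith
    then have "c * (LINT x|lborel. \<bar>apply_c_infty (X n) x - apply_c_infty \<phi> x\<bar>)
      \<le> c * (inverse (real (Suc n)) + (LINT x|lborel. \<bar>F x - apply_c_infty \<phi> x\<bar>))"
      using c by (intro mult_left_mono) auto
    with functional_diff_le[OF X(1) \<phi>, of n] show ?thesis by linarith
  qed
  have "Cauchy (\<lambda>n. \<Lambda> (X n))"
  proof (rule CauchyI')
    fix e :: real
    assume "e > 0"
    have "(\<lambda>n. c * (2 * inverse (real (Suc n)))) \<longlonglongrightarrow> c * (2 * 0)"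
      by (intro tendsto_intros LIMSEQ_inverse_real_of_nat)
    then obtain N where N: "\<And>n. n \<ge> N \<Longrightarrow> c * (2 * inverse (real (Suc n))) < e"
      using order_tendstoD(2)[of _ "c * (2 * 0)" sequentially e] \<open>e > 0\<close> by (auto simp: eventually_sequentially)
    show "\<exists>N. \<forall>m\<ge>N. \<forall>n>m. dist (\<Lambda> (X m)) (\<Lambda> (X n)) < e"
    proof (intro exI[of _ N] allI impI)
      fix m n
      assume mn: "m \<ge> N" "n > m"
      have "c * (inverse (real (Suc m)) + (LINT x|lborel. \<bar>F x - apply_c_infty (X n) x\<bar>)) \<le> c * (2 * inverse (real (Suc m)))"
      proof (intro mult_left_mono)
        have "inverse (real (Suc n)) \<le> inverse (real (Suc m))" using mn by (intro le_imp_inverse_le) auto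
        then show "inverse (real (Suc m)) + (LINT x|lborel. \<bar>F x - apply_c_infty (X n) x\<bar>) \<le> 2 * inverse (real (Suc m))"
          using X(2)[of n] by linarith
      qed (use c in simp)
      with step[OF X(1), of m n] N[OF mn(1)] show "dist (\<Lambda> (X m)) (\<Lambda> (X n)) < e"
        unfolding dist_real_def by linarith
    qed
  qed
  then obtain l where l: "(\<lambda>n. \<Lambda> (X n)) \<longlonglongrightarrow> l"
    using Cauchy_convergent convergent_def by blast
  have "\<bar>l - \<Lambda> \<phi>\<bar> \<le> c * (LINT x|lborel. \<bar>F x - apply_c_infty \<phi> x\<bar>)" if \<phi>: "integrable lborel (apply_c_infty \<phi>)" for \<phi>
  proof (rule LIMSEQ_le)
    show "(\<lambda>n. \<bar>\<Lambda> (X n) - \<Lambda> \<phi>\<bar>) \<longlonglongrightarrow> \<bar>l - \<Lambda> \<phi>\<bar>" by (intro tendsto_intros l)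
    have "(\<lambda>n. c * (inverse (real (Suc n)) + (LINT x|lborel. \<bar>F x - apply_c_infty \<phi> x\<bar>)))
      \<longlonglongrightarrow> c * (0 + (LINT x|lborel. \<bar>F x - apply_c_infty \<phi> x\<bar>))"
      by (intro tendsto_intros LIMSEQ_inverse_real_of_nat)
    then show "(\<lambda>n. c * (inverse (real (Suc n)) + (LINT x|lborel. \<bar>F x - apply_c_infty \<phi> x\<bar>)))
      \<longlonglongrightarrow> c * (LINT x|lborel. \<bar>F x - apply_c_infty \<phi> x\<bar>)" by simp
  qed (use step[OF \<phi>] in blast)
  then have "\<exists>l. \<forall>\<phi>. integrable lborel (apply_c_infty \<phi>) \<longrightarrow> \<bar>l - \<Lambda> \<phi>\<bar> \<le> c * (LINT x|lborel. \<bar>F x - apply_c_infty \<phi> x\<bar>)"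
    by blast
  from someI_ex[OF this] \<phi> show ?thesis unfolding ext_def by blast
qed

lemma ext_c_infty:
  assumes "integrable lborel (apply_c_infty \<phi>)"
  shows "ext (apply_c_infty \<phi>) = \<Lambda> \<phi>"
  using ext_near[OF assms assms] by simp

lemma L1_approxE:
  assumes "integrable lborel F" "e > 0"
  obtains \<phi> where "integrable lborel (apply_c_infty \<phi>)" "(LINT x|lborel. \<bar>F x - apply_c_infty \<phi> x\<bar>) < e"
  using L1_approximable[OF assms(1)] assms(2) unfolding L1_approximable_def by blast

text \<open>Both numbers are compared with \<Lambda> at an approximant within e/(c + K) of F, which
  shows that they differ by at most e.\<close>

lemma ext_eqI:
  assumes F: "integrable lborel F"
    and l: "\<And>\<phi>. integrable lborel (apply_c_infty \<phi>) \<Longrightarrow> \<bar>l - \<Lambda> \<phi>\<bar> \<le> K * (LINT x|lborel. \<bar>F x - apply_c_infty \<phi> x\<bar>)" "K \<ge> 0"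
  shows "ext F = l"
proof -
  have "\<bar>ext F - l\<bar> \<le> 0 + e" if "e > 0" for e
  proof -
    have "e / (c + K) > 0" using that c l by (simp add: add_pos_nonneg)
    then obtain \<phi> where \<phi>: "integrable lborel (apply_c_infty \<phi>)" "(LINT x|lborel. \<bar>F x - apply_c_infty \<phi> x\<bar>) < e / (c + K)"
      using L1_approxE[OF F] by metis
    have "\<bar>ext F - l\<bar> \<le> (c + K) * (LINT x|lborel. \<bar>F x - apply_c_infty \<phi> x\<bar>)"
      using ext_near[OF F \<phi>(1)] l(1)[OF \<phi>(1)] by (simp add: distrib_right)
    also have "\<dots> \<le> (c + K) * (e / (c + K))"
      using \<phi>(2) c l(2) by (intro mult_left_mono) auto
    also have "\<dots> = e" using c l(2) by simp
    finally show ?thesis by simp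
  qed
  then have "\<bar>ext F - l\<bar> \<le> 0" by (rule field_le_epsilon)
  then show ?thesis by simp
qed

lemma ext_scale:
  assumes F: "integrable lborel F"
  shows "ext (\<lambda>x. r * F x) = r * ext F"
proof (cases "r = 0")
  case True
  have "ext (apply_c_infty 0) = \<Lambda> 0" by (rule ext_c_infty) (simp add: zero_c_infty.rep_eq)
  then show ?thesis using True by (simp add: zero_c_infty.rep_eq linear_0[OF linear])
next
  case False
  show ?thesis
  proof (rule ext_eqI[where K=c])
    fix \<phi> :: "'a c_infty"
    assume \<phi>: "integrable lborel (apply_c_infty \<phi>)"
    have \<phi>': "integrable lborel (apply_c_infty (\<phi> /\<^sub>R r))" using \<phi> by (simp add: scaleR_c_infty.rep_eq)
    have "r * \<Lambda> (\<phi> /\<^sub>R r) = \<Lambda> \<phi>"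
      using False by (simp add: linear_cmul[OF linear])
    then have "\<bar>r * ext F - \<Lambda> \<phi>\<bar> = \<bar>r\<bar> * \<bar>ext F - \<Lambda> (\<phi> /\<^sub>R r)\<bar>"
      by (metis abs_mult right_diff_distrib)
    also have "\<dots> \<le> \<bar>r\<bar> * (c * (LINT x|lborel. \<bar>F x - apply_c_infty (\<phi> /\<^sub>R r) x\<bar>))"
      by (intro mult_left_mono ext_near F \<phi>') auto
    also have "\<dots> = c * (LINT x|lborel. \<bar>r\<bar> * \<bar>F x - apply_c_infty (\<phi> /\<^sub>R r) x\<bar>)" by simp
    also have "(\<lambda>x. \<bar>r\<bar> * \<bar>F x - apply_c_infty (\<phi> /\<^sub>R r) x\<bar>) = (\<lambda>x. \<bar>r * F x - apply_c_infty \<phi> x\<bar>)"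
      using False by (simp add: fun_eq_iff scaleR_c_infty.rep_eq right_diff_distrib mult.assoc[symmetric] flip: abs_mult)
    finally show "\<bar>r * ext F - \<Lambda> \<phi>\<bar> \<le> c * (LINT x|lborel. \<bar>r * F x - apply_c_infty \<phi> x\<bar>)" .
  qed (use F c in auto)
qed

lemma ext_add:
  assumes F: "integrable lborel F" and G: "integrable lborel G"
  shows "ext (\<lambda>x. F x + G x) = ext F + ext G"
proof (rule ext_eqI[where K=c])
  show FG: "integrable lborel (\<lambda>x. F x + G x)" using F G by simp
  fix \<phi> :: "'a c_infty"
  assume \<phi>: "integrable lborel (apply_c_infty \<phi>)"
  show "\<bar>(ext F + ext G) - \<Lambda> \<phi>\<bar> \<le> c * (LINT x|lborel. \<bar>(F x + G x) - apply_c_infty \<phi> x\<bar>)"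
  proof (rule field_le_epsilon)
    fix e :: real
    assume "e > 0"
    then have "e / (2 * c) > 0" using c by simp
    then obtain \<psi> where \<psi>: "integrable lborel (apply_c_infty \<psi>)" "(LINT x|lborel. \<bar>F x - apply_c_infty \<psi> x\<bar>) < e / (2 * c)"
      using L1_approxE[OF F] by metis
    have diff: "integrable lborel (apply_c_infty (\<phi> - \<psi>))" using \<phi> \<psi> by (simp add: minus_c_infty.rep_eq)
    have "(LINT x|lborel. \<bar>G x - apply_c_infty (\<phi> - \<psi>) x\<bar>)
       \<le> (LINT x|lborel. \<bar>(F x + G x) - apply_c_infty \<phi> x\<bar> + \<bar>F x - apply_c_infty \<psi> x\<bar>)"
      using F G \<phi> \<psi> by (intro integral_mono) (auto simp: minus_c_infty.rep_eq)
    also have "\<dots> = (LINT x|lborel. \<bar>(F x + G x) - apply_c_infty \<phi> x\<bar>) + (LINT x|lborel. \<bar>F x - apply_c_infty \<psi> x\<bar>)"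
      using F G \<phi> \<psi> by (intro Bochner_Integration.integral_add) auto
    finally have "c * (LINT x|lborel. \<bar>G x - apply_c_infty (\<phi> - \<psi>) x\<bar>)
      \<le> c * ((LINT x|lborel. \<bar>(F x + G x) - apply_c_infty \<phi> x\<bar>) + (LINT x|lborel. \<bar>F x - apply_c_infty \<psi> x\<bar>))"
      using c by (intro mult_left_mono) auto
    moreover have "c * (LINT x|lborel. \<bar>F x - apply_c_infty \<psi> x\<bar>) \<le> e / 2"
      using mult_left_mono[OF less_imp_le[OF \<psi>(2)], of c] c by simp
    ultimately show "\<bar>(ext F + ext G) - \<Lambda> \<phi>\<bar> \<le> c * (LINT x|lborel. \<bar>(F x + G x) - apply_c_infty \<phi> x\<bar>) + e"
      using ext_near[OF F \<psi>(1)] ext_near[OF G diff]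
      unfolding linear_diff[OF linear] distrib_left by linarith
  qed
qed (use c in simp)

text \<open>An approximant \<phi> of F is replaced by \<eta> |\<phi>|. This is nonnegative and no
  farther from F, because F \<ge> 0 and \<eta> = 1 where F is nonzero. A bound on cut-off functions
  thus becomes a bound of \<open>ext\<close> on functions that live where \<eta> = 1.\<close>

lemma ext_nonneg_le:
  assumes F: "integrable lborel F" and nonneg: "\<And>x. F x \<ge> 0"
    and \<eta>: "continuous_on UNIV \<eta>" "\<And>x. 0 \<le> \<eta> x" "\<And>x. \<eta> x \<le> 1" "\<And>x. F x \<noteq> 0 \<Longrightarrow> \<eta> x = 1"
    and c': "c' \<ge> 0" "\<And>\<phi>. (\<And>x. 0 \<le> apply_c_infty \<phi> x) \<Longrightarrow> integrable lborel (apply_c_infty \<phi>) \<Longrightarrow>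
      \<Lambda> (cutoff \<eta> \<phi>) \<le> c' * (LINT x|lborel. apply_c_infty (cutoff \<eta> \<phi>) x)"
  shows "0 \<le> ext F" "ext F \<le> c' * (LINT x|lborel. F x)"
proof -
  have near: "\<exists>\<psi>. 0 \<le> \<Lambda> \<psi> \<and> \<Lambda> \<psi> \<le> c' * ((LINT x|lborel. F x) + e) \<and> \<bar>ext F - \<Lambda> \<psi>\<bar> \<le> c * e" if e: "e > 0" for e
  proof -
    obtain \<phi> where \<phi>: "integrable lborel (apply_c_infty \<phi>)" "(LINT x|lborel. \<bar>F x - apply_c_infty \<phi> x\<bar>) < e"
      using L1_approxE[OF F e] by metis
    define \<psi> where "\<psi> = cutoff \<eta> (abs_c_infty \<phi>)"
    have \<psi>: "apply_c_infty \<psi> x = \<eta> x * \<bar>apply_c_infty \<phi> x\<bar>" for x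
      unfolding \<psi>_def by (simp add: apply_cutoff[OF \<eta>(1-3)])
    have [measurable]: "\<eta> \<in> borel_measurable borel" by (rule borel_measurable_continuous_onI[OF \<eta>(1)])
    have \<psi>_int: "integrable lborel (apply_c_infty \<psi>)"
      by (rule Bochner_Integration.integrable_bound[OF \<phi>(1)]) (auto simp: \<psi> abs_mult \<eta> intro!: mult_left_le_one_le)
    have pointwise: "\<bar>F x - apply_c_infty \<psi> x\<bar> \<le> \<bar>F x - apply_c_infty \<phi> x\<bar>" for x
    proof -
      have "F x - apply_c_infty \<psi> x = \<eta> x * (F x - \<bar>apply_c_infty \<phi> x\<bar>)"
        using \<eta>(4)[of x] by (cases "F x = 0") (auto simp: \<psi> algebra_simps)
      then have "\<bar>F x - apply_c_infty \<psi> x\<bar> \<le> \<bar>F x - \<bar>apply_c_infty \<phi> x\<bar>\<bar>"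
        using \<eta>(2,3)[of x] by (simp add: abs_mult mult_left_le_one_le)
      also have "\<dots> \<le> \<bar>F x - apply_c_infty \<phi> x\<bar>" using nonneg[of x] by linarith
      finally show ?thesis .
    qed
    have "(LINT x|lborel. \<bar>F x - apply_c_infty \<psi> x\<bar>) \<le> (LINT x|lborel. \<bar>F x - apply_c_infty \<phi> x\<bar>)"
      using F \<psi>_int \<phi>(1) by (intro integral_mono pointwise) auto
    with \<phi>(2) have dist: "(LINT x|lborel. \<bar>F x - apply_c_infty \<psi> x\<bar>) \<le> e" by linarith
    have "\<bar>ext F - \<Lambda> \<psi>\<bar> \<le> c * e"
      using ext_near[OF F \<psi>_int] mult_left_mono[OF dist, of c] c by linarith
    moreover have "0 \<le> \<Lambda> \<psi>" using \<eta> by (intro positive) (simp add: \<psi>)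
    moreover have "\<Lambda> \<psi> \<le> c' * ((LINT x|lborel. F x) + e)"
    proof -
      have "\<Lambda> \<psi> \<le> c' * (LINT x|lborel. apply_c_infty \<psi> x)"
        unfolding \<psi>_def using \<phi>(1) by (intro c'(2)) auto
      also have "(LINT x|lborel. apply_c_infty \<psi> x) \<le> (LINT x|lborel. F x + \<bar>F x - apply_c_infty \<psi> x\<bar>)"
        using F \<psi>_int by (intro integral_mono) auto
      also have "\<dots> = (LINT x|lborel. F x) + (LINT x|lborel. \<bar>F x - apply_c_infty \<psi> x\<bar>)"
        using F \<psi>_int by (intro Bochner_Integration.integral_add) auto
      also have "\<dots> \<le> (LINT x|lborel. F x) + e" using dist by simp
      finally show ?thesis using c'(1) by (simp add: mult_left_mono)
    qed
    ultimately show ?thesis by blast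
  qed
  show "0 \<le> ext F"
  proof (rule field_le_epsilon)
    fix e :: real
    assume "e > 0"
    then show "0 \<le> ext F + e" using near[of "e / c"] c by fastforce
  qed
  show "ext F \<le> c' * (LINT x|lborel. F x)"
  proof (rule field_le_epsilon)
    fix e :: real
    assume "e > 0"
    then have "e / (c + c') > 0" using c c'(1) by (simp add: add_pos_nonneg)
    from near[OF this] have "ext F \<le> c' * ((LINT x|lborel. F x) + e / (c + c')) + c * (e / (c + c'))"
      by auto
    also have "\<dots> = c' * (LINT x|lborel. F x) + (c + c') * (e / (c + c'))"
      by (simp only: distrib_left distrib_right add_ac)
    also have "(c + c') * (e / (c + c')) = e" using c c'(1) by simp
    finally show "ext F \<le> c' * (LINT x|lborel. F x) + e" .
  qed
qed

lemma ext_nonneg_le':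
  assumes "integrable lborel F" "\<And>x. F x \<ge> 0"
  shows "0 \<le> ext F" "ext F \<le> c * (LINT x|lborel. F x)"
proof -
  have cut: "cutoff (\<lambda>_. 1) \<phi> = \<phi>" for \<phi> :: "'a c_infty"
    by (rule c_infty_eqI) (simp add: apply_cutoff)
  note * = ext_nonneg_le[OF assms, of "\<lambda>_. 1" c]
  show "0 \<le> ext F" "ext F \<le> c * (LINT x|lborel. F x)"
    using * c bounded by (auto simp: cut)
qed

lemma ext_abs_le:
  assumes F: "integrable lborel F"
  shows "\<bar>ext F\<bar> \<le> c * (LINT x|lborel. \<bar>F x\<bar>)"
  using ext_near[OF F, of 0] by (simp add: zero_c_infty.rep_eq linear_0[OF linear])

lemma ext_tendsto:
  assumes "\<And>i::nat. integrable lborel (s i)" "integrable lborel F"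
    and "(\<lambda>i. LINT x|lborel. \<bar>F x - s i x\<bar>) \<longlonglongrightarrow> 0"
  shows "(\<lambda>i. ext (s i)) \<longlonglongrightarrow> ext F"
proof (rule LIM_zero_cancel, rule tendsto_0_le[OF assms(3), where K=c], intro always_eventually allI)
  fix i
  have "ext F = ext (\<lambda>x. s i x + (F x - s i x))" by simp
  also have "\<dots> = ext (s i) + ext (\<lambda>x. F x - s i x)"
    using assms by (intro ext_add) auto
  finally have "ext (s i) - ext F = - ext (\<lambda>x. F x - s i x)" by simp
  then show "norm (ext (s i) - ext F) \<le> norm (LINT x|lborel. \<bar>F x - s i x\<bar>) * c"
    using ext_abs_le[of "\<lambda>x. F x - s i x"] assms by (simp add: mult.commute)
qed

end

section \<open>Radon-Nikodym density of the extended functional\<close>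

context L1_bounded_functional
begin

text \<open>Induction over the functions G integrable for the measure with density \<theta>: both
  sides agree on indicators, and \<open>le\<close> makes the right side continuous in the L1 norm of
  that measure, as the left side is. The claim is the case G = F / \<theta>.\<close>

lemma ext_density_weighted:
  fixes \<theta> g :: "'a \<Rightarrow> real"
  assumes \<theta>: "integrable lborel \<theta>" "\<And>x. \<theta> x > 0" and g: "integrable lborel g" "\<And>x. 0 \<le> g x"
    and le: "AE x in lborel. g x \<le> c * \<theta> x"
    and eq: "\<And>A. A \<in> sets borel \<Longrightarrow> ext (\<lambda>x. indicator A x * \<theta> x) = (LINT x|lborel. indicator A x * g x)"
    and F: "integrable lborel F"
  shows "ext F = (LINT x|lborel. F x / \<theta> x * g x)"
proof -
  define \<mu> where "\<mu> = density lborel \<theta>"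
  have [measurable]: "\<theta> \<in> borel_measurable borel" "g \<in> borel_measurable borel" using \<theta> g by auto
  have \<mu>_int: "integrable \<mu> G \<longleftrightarrow> integrable lborel (\<lambda>x. \<theta> x * G x)" if "G \<in> borel_measurable borel" for G :: "'a \<Rightarrow> real"
    unfolding \<mu>_def using that \<theta>(2) by (subst integrable_density) (auto intro: less_imp_le)
  have sets_\<mu>: "sets \<mu> = sets borel" "space \<mu> = UNIV" by (simp_all add: \<mu>_def)
  have dom: "AE x in lborel. \<bar>G x * g x\<bar> \<le> c * (\<theta> x * \<bar>G x\<bar>)" for G :: "'a \<Rightarrow> real"
    using le
  proof eventually_elim
    case (elim x)
    then have "\<bar>G x\<bar> * g x \<le> \<bar>G x\<bar> * (c * \<theta> x)" by (intro mult_left_mono) auto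
    then show ?case using g(2)[of x] by (simp add: abs_mult mult_ac)
  qed
  have G_int: "integrable lborel (\<lambda>x. G x * g x)" if G: "integrable \<mu> G" for G
  proof -
    have [measurable]: "G \<in> borel_measurable borel" using borel_measurable_integrable[OF G] by (simp add: \<mu>_def)
    have "integrable lborel (\<lambda>x. c * \<bar>\<theta> x * G x\<bar>)" using G by (simp add: \<mu>_int)
    then show ?thesis
      by (rule Bochner_Integration.integrable_bound)
        (use dom[of G] \<theta>(2) c in \<open>auto simp: abs_mult less_imp_le\<close>)
  qed
  have main: "ext (\<lambda>x. \<theta> x * G x) = (LINT x|lborel. G x * g x)" if "integrable \<mu> G" for G :: "'a \<Rightarrow> real"
    using that
  proof (induction rule: integrable_induct)
    case (base A r)
    then have A: "A \<in> sets borel" by (simp add: sets_\<mu>)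
    have int: "integrable lborel (\<lambda>x. indicator A x * \<theta> x)"
      using integrable_mult_indicator[of A lborel \<theta>] A \<theta> by simp
    have "(\<lambda>x. \<theta> x * (indicator A x *\<^sub>R r)) = (\<lambda>x. r * (indicator A x * \<theta> x))" by (simp add: fun_eq_iff)
    then have "ext (\<lambda>x. \<theta> x * (indicator A x *\<^sub>R r)) = r * (LINT x|lborel. indicator A x * g x)"
      by (simp add: ext_scale[OF int] eq[OF A])
    also have "\<dots> = (LINT x|lborel. indicator A x *\<^sub>R r * g x)"
      by (subst integral_mult_right_zero[symmetric]) (simp add: mult_ac)
    finally show ?case .
  next
    case (add F G)
    have meas: "F \<in> borel_measurable borel" "G \<in> borel_measurable borel"
      using add borel_measurable_integrable[of \<mu>] by (auto simp: \<mu>_def)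
    have "ext (\<lambda>x. \<theta> x * (F x + G x)) = ext (\<lambda>x. \<theta> x * F x) + ext (\<lambda>x. \<theta> x * G x)"
      using add meas by (subst ext_add[symmetric]) (auto simp: \<mu>_int distrib_left)
    also have "\<dots> = (LINT x|lborel. F x * g x + G x * g x)"
      using add G_int by (subst Bochner_Integration.integral_add) auto
    finally show ?case by (simp add: distrib_right)
  next
    case (lim G s)
    have [measurable]: "G \<in> borel_measurable borel" "s i \<in> borel_measurable borel" for i
      using lim borel_measurable_integrable[of \<mu>] by (auto simp: \<mu>_def)
    have \<theta>G: "integrable lborel (\<lambda>x. \<theta> x * G x)" "integrable lborel (\<lambda>x. \<theta> x * s i x)" for i
      using lim by (simp_all add: \<mu>_int)
    have lim_s: "(\<lambda>i. s i x) \<longlonglongrightarrow> G x" "\<bar>s i x\<bar> \<le> 2 * \<bar>G x\<bar>" for i x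
      using lim by (auto simp: sets_\<mu>)
    have "(\<lambda>i. LINT x|lborel. \<bar>\<theta> x * G x - \<theta> x * s i x\<bar>) \<longlonglongrightarrow> 0"
    proof (rule L1_tendsto_dominated[where w="\<lambda>x. 2 * \<bar>\<theta> x * G x\<bar>"])
      show "AE x in lborel. (\<lambda>i. \<theta> x * s i x) \<longlonglongrightarrow> \<theta> x * G x"
        by (intro AE_I2 tendsto_intros lim_s)
      show "AE x in lborel. \<bar>\<theta> x * s i x\<bar> \<le> 2 * \<bar>\<theta> x * G x\<bar>" for i
        using mult_left_mono[OF lim_s(2)[of i]] \<theta>(2) by (intro AE_I2) (simp add: abs_mult less_imp_le mult_ac)
    qed (use \<theta>G in auto)
    then have 1: "(\<lambda>i. ext (\<lambda>x. \<theta> x * s i x)) \<longlonglongrightarrow> ext (\<lambda>x. \<theta> x * G x)"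
      by (intro ext_tendsto \<theta>G)
    have 2: "(\<lambda>i. LINT x|lborel. s i x * g x) \<longlonglongrightarrow> (LINT x|lborel. G x * g x)"
    proof (rule integral_dominated_convergence[where w="\<lambda>x. 2 * \<bar>G x * g x\<bar>"])
      show "integrable lborel (\<lambda>x. 2 * \<bar>G x * g x\<bar>)" using G_int[OF \<open>integrable \<mu> G\<close>] by simp
      show "AE x in lborel. (\<lambda>i. s i x * g x) \<longlonglongrightarrow> G x * g x"
        by (intro AE_I2 tendsto_intros lim_s)
      show "AE x in lborel. norm (s i x * g x) \<le> 2 * \<bar>G x * g x\<bar>" for i
        using mult_right_mono[OF lim_s(2)[of i]] g(2) by (intro AE_I2) (simp add: abs_mult mult_ac)
    qed auto
    have "(\<lambda>i. ext (\<lambda>x. \<theta> x * s i x)) \<longlonglongrightarrow> (LINT x|lborel. G x * g x)"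
      using 2 lim by simp
    with 1 show ?case by (rule LIMSEQ_unique)
  qed
  have nz: "\<theta> x \<noteq> 0" for x using \<theta>(2)[of x] by simp
  have [measurable]: "F \<in> borel_measurable borel" using F by auto
  have "integrable \<mu> (\<lambda>x. F x / \<theta> x)"
    using F by (subst \<mu>_int) (auto simp: nz)
  from main[OF this] show ?thesis by (simp add: nz)
qed

text \<open>Lebesgue measure is infinite, so indicators need not be integrable. A strictly positive
  integrable weight \<theta> makes A \<mapsto>
  \<open>ext (\<lambda>x. indicator A x * \<theta> x)\<close> a finite measure; its Radon-Nikodym
  density divided by \<theta> is the density sought.\<close>

lemma density_exists:
  obtains q where "q \<in> borel_measurable borel" "\<And>x. 0 \<le> q x" "\<And>x. q x \<le> c"
    "\<And>F. integrable lborel F \<Longrightarrow> ext F = (LINT x|lborel. F x * q x)"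
proof -
  obtain h :: "'a \<Rightarrow> ennreal" where h: "h \<in> borel_measurable lborel" "integral\<^sup>N lborel h \<noteq> \<infinity>"
    "\<And>x. 0 < h x" "\<And>x. h x < \<infinity>"
    using sigma_finite_measure.Ex_finite_integrable_function[OF sigma_finite_lborel] by auto
  define \<theta> where "\<theta> x = enn2real (h x)" for x
  have h_eq: "h x = ennreal (\<theta> x)" for x using h(4)[of x] by (simp add: \<theta>_def)
  have \<theta>_pos: "\<theta> x > 0" for x using h(3)[of x] by (simp add: h_eq)
  have [measurable]: "\<theta> \<in> borel_measurable borel" using h(1) unfolding \<theta>_def by measurable
  have \<theta>: "integrable lborel \<theta>"
    using h(2) \<theta>_pos by (intro integrableI_bounded) (auto simp: h_eq less_imp_le less_top[symmetric] cong: nn_integral_cong)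
  have \<theta>A: "integrable lborel (\<lambda>x. indicator A x * \<theta> x)" if "A \<in> sets borel" for A
    using integrable_mult_indicator[of A lborel \<theta>] that \<theta> by simp
  define e where "e A = ext (\<lambda>x. indicator A x * \<theta> x)" for A
  have e: "0 \<le> e A" "e A \<le> c * (LINT x|lborel. indicator A x * \<theta> x)" if "A \<in> sets borel" for A
    unfolding e_def using \<theta>_pos by (intro ext_nonneg_le' \<theta>A that; simp add: less_imp_le)+
  have e_empty: "e {} = 0" using e[of "{}"] by simp
  \<comment> \<open>Countable additivity is continuity of \<open>ext\<close> in L1: the partial
    unions, multiplied by \<theta>, converge in L1 with majorant \<theta>.\<close>
  have e_sums: "(\<lambda>i. e (A i)) sums e (\<Union>i. A i)" if A: "range A \<subseteq> sets borel" "disjoint_family A" for A :: "nat \<Rightarrow> 'a set"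
  proof -
    have A': "A i \<in> sets borel" for i using A by auto
    have [measurable]: "(\<Union>i<n. A i) \<in> sets borel" "(\<Union>i. A i) \<in> sets borel" for n using A' by auto
    have partial: "(\<Sum>i<n. e (A i)) = e (\<Union>i<n. A i)" for n
    proof (induction n)
      case (Suc n)
      have disj: "(\<Union>i<n. A i) \<inter> A n = {}"
      proof -
        have "A i \<inter> A n = {}" if "i < n" for i
          using that by (intro disjoint_family_onD[OF A(2)]) auto
        then show ?thesis by blast
      qed
      have "(\<lambda>x. indicator (\<Union>i<Suc n. A i) x * \<theta> x) = (\<lambda>x. indicator (\<Union>i<n. A i) x * \<theta> x + indicator (A n) x * \<theta> x)"
        using disj by (auto simp: fun_eq_iff indicator_def less_Suc_eq)
      then have "e (\<Union>i<Suc n. A i) = e (\<Union>i<n. A i) + e (A n)"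
        unfolding e_def using A' by (simp add: ext_add \<theta>A)
      with Suc show ?case by simp
    qed (simp add: e_empty)
    have "(\<lambda>n. e (\<Union>i<n. A i)) \<longlonglongrightarrow> e (\<Union>i. A i)"
      unfolding e_def
    proof (intro ext_tendsto \<theta>A L1_tendsto_dominated[where w=\<theta>])
      show "AE x in lborel. (\<lambda>n. indicator (\<Union>i<n. A i) x * \<theta> x) \<longlonglongrightarrow> indicator (\<Union>i. A i) x * \<theta> x"
        by (intro AE_I2 tendsto_mult tendsto_const LIMSEQ_indicator_UN)
      show "AE x in lborel. \<bar>indicator (\<Union>i<n. A i) x * \<theta> x\<bar> \<le> \<theta> x" for n
        using \<theta>_pos by (intro AE_I2) (auto simp: indicator_def less_imp_le)
    qed (use \<theta> in auto)
    then show ?thesis unfolding sums_def partial .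
  qed
  define N where "N = measure_of (UNIV :: 'a set) (sets borel) (\<lambda>A. ennreal (e A))"
  have sets_N: "sets N = sets borel"
    unfolding N_def using sets.sigma_sets_eq[of "borel :: 'a measure"] by simp
  have emeasure_N: "emeasure N A = ennreal (e A)" if "A \<in> sets borel" for A
  proof (rule emeasure_measure_of[OF N_def])
    show "positive (sets N) (\<lambda>A. ennreal (e A))" by (simp add: positive_def e_empty)
    show "countably_additive (sets N) (\<lambda>A. ennreal (e A))"
    proof (rule countably_additiveI)
      fix A :: "nat \<Rightarrow> 'a set"
      assume A: "range A \<subseteq> sets N" "disjoint_family A"
      then show "(\<Sum>i. ennreal (e (A i))) = ennreal (e (\<Union>i. A i))"
        using e e_sums[of A] by (intro suminf_ennreal_eq) (auto simp: sets_N)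
    qed
  qed (use that sets_N in auto)
  have "absolutely_continuous lborel N"
    unfolding absolutely_continuous_def
  proof
    fix A :: "'a set"
    assume A: "A \<in> null_sets lborel"
    then have A': "A \<in> sets borel" by auto
    have "(LINT x|lborel. indicator A x * \<theta> x) = 0"
      using AE_not_in[OF A] A' by (intro integral_eq_zero_AE) (auto elim!: eventually_mono)
    then have "e A = 0" using e[OF A'] by simp
    then show "A \<in> null_sets N" using emeasure_N[OF A'] A' by (auto simp: null_sets_def sets_N)
  qed
  then obtain g0 where g0: "g0 \<in> borel_measurable lborel" "density lborel g0 = N"
    using sigma_finite_measure.Radon_Nikodym[OF sigma_finite_lborel, of N] sets_N by auto
  have [measurable]: "g0 \<in> borel_measurable borel" using g0 by simp
  define g where "g x = enn2real (g0 x)" for x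
  have "(\<integral>\<^sup>+ x. g0 x \<partial>lborel) = emeasure (density lborel g0) UNIV"
    by (subst emeasure_density) auto
  also have "\<dots> < \<infinity>" by (simp add: g0 emeasure_N)
  finally have fin: "(\<integral>\<^sup>+ x. g0 x \<partial>lborel) < \<infinity>" .
  then have "AE x in lborel. g0 x \<noteq> \<infinity>"
    using g0(1) by (intro nn_integral_PInf_AE) auto
  then have g_eq: "AE x in lborel. g0 x = ennreal (g x)"
    by eventually_elim (simp add: g_def less_top)
  have [measurable]: "g \<in> borel_measurable borel" unfolding g_def by measurable
  have g_nonneg: "0 \<le> g x" for x by (simp add: g_def)
  have g: "integrable lborel g"
  proof (rule integrableI_bounded)
    have "(\<integral>\<^sup>+ x. ennreal (norm (g x)) \<partial>lborel) = (\<integral>\<^sup>+ x. g0 x \<partial>lborel)"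
      using g_eq g_nonneg by (intro nn_integral_cong_AE) (auto elim!: eventually_mono)
    then show "(\<integral>\<^sup>+ x. ennreal (norm (g x)) \<partial>lborel) < \<infinity>" using fin by simp
  qed simp
  have gA: "e A = (LINT x|lborel. indicator A x * g x)" if A: "A \<in> sets borel" for A
  proof -
    have int: "integrable lborel (\<lambda>x. indicator A x * g x)"
      using integrable_mult_indicator[of A lborel g] A g by simp
    have "ennreal (e A) = (\<integral>\<^sup>+ x. g0 x * indicator A x \<partial>lborel)"
      using A by (simp add: emeasure_N[symmetric] g0(2)[symmetric] emeasure_density)
    also have "\<dots> = (\<integral>\<^sup>+ x. ennreal (indicator A x * g x) \<partial>lborel)"
      using g_eq by (intro nn_integral_cong_AE) (auto elim!: eventually_mono simp: indicator_def)
    also have "\<dots> = ennreal (LINT x|lborel. indicator A x * g x)"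
      using g_nonneg by (intro nn_integral_eq_integral int) auto
    finally show ?thesis using e(1)[OF A] g_nonneg by (subst (asm) ennreal_inj) auto
  qed
  have g_le: "AE x in lborel. g x \<le> c * \<theta> x"
  proof (rule AE_le_of_integral_indicator_le)
    fix B :: "'a set"
    assume "B \<in> sets lborel"
    then have B: "B \<in> sets borel" by simp
    have "(LINT x|lborel. indicator B x * (c * \<theta> x)) = c * (LINT x|lborel. indicator B x * \<theta> x)"
      by (subst integral_mult_right_zero[symmetric]) (simp add: mult_ac)
    with e(2)[OF B] gA[OF B] show "(LINT x|lborel. indicator B x * g x) \<le> (LINT x|lborel. indicator B x * (c * \<theta> x))"
      by simp
  qed (use g \<theta> in auto)
  \<comment> \<open>The quotient is at most c almost everywhere; the minimum enforces this at every
    point and changes no integral.\<close>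
  define q where "q x = min c (g x / \<theta> x)" for x
  show ?thesis
  proof (rule that[of q])
    show "q \<in> borel_measurable borel" unfolding q_def by measurable
    show "0 \<le> q x" "q x \<le> c" for x
      using c g_nonneg[of x] \<theta>_pos[of x] by (auto simp: q_def)
    fix F :: "'a \<Rightarrow> real"
    assume F: "integrable lborel F"
    then have [measurable]: "F \<in> borel_measurable borel" by auto
    have "ext F = (LINT x|lborel. F x / \<theta> x * g x)"
      by (rule ext_density_weighted[OF \<theta> \<theta>_pos g g_nonneg g_le _ F]) (simp add: gA[symmetric] e_def)
    also have "\<dots> = (LINT x|lborel. F x * q x)"
    proof (rule integral_cong_AE)
      show "AE x in lborel. F x / \<theta> x * g x = F x * q x"
        using g_le
      proof eventually_elim
        case (elim x)
        then have "g x / \<theta> x \<le> c" using \<theta>_pos[of x] by (simp add: field_simps)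
        then show ?case by (simp add: q_def min_def)
      qed
    qed (auto simp: q_def)
    finally show "ext F = (LINT x|lborel. F x * q x)" .
  qed
qed

text \<open>Intersecting A with balls gives integrable indicators, on whose Borel subsets the bound
  for \<open>ext\<close> can be tested; countably many radii keep the exceptional set null.\<close>

lemma density_le_on:
  assumes q: "q \<in> borel_measurable borel" "\<And>x. 0 \<le> q x" "\<And>x. q x \<le> c"
    "\<And>F. integrable lborel F \<Longrightarrow> ext F = (LINT x|lborel. F x * q x)"
    and A: "A \<in> sets borel"
    and \<eta>: "continuous_on UNIV \<eta>" "\<And>x. 0 \<le> \<eta> x" "\<And>x. \<eta> x \<le> 1" "\<And>x. x \<in> A \<Longrightarrow> \<eta> x = 1"
    and c': "c' \<ge> 0" "\<And>\<phi>. (\<And>x. 0 \<le> apply_c_infty \<phi> x) \<Longrightarrow> integrable lborel (apply_c_infty \<phi>) \<Longrightarrow>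
      \<Lambda> (cutoff \<eta> \<phi>) \<le> c' * (LINT x|lborel. apply_c_infty (cutoff \<eta> \<phi>) x)"
  shows "AE x in lborel. x \<in> A \<longrightarrow> q x \<le> c'"
proof -
  have [measurable]: "q \<in> borel_measurable borel" by (rule q)
  have "AE x in lborel. indicator (A \<inter> ball 0 (real n)) x * q x \<le> indicator (A \<inter> ball 0 (real n)) x * c'" for n :: nat
  proof (rule AE_le_of_integral_indicator_le)
    let ?I = "indicator (A \<inter> ball 0 (real n)) :: 'a \<Rightarrow> real"
    have An: "A \<inter> ball 0 (real n) \<in> sets borel" using A by simp
    have "emeasure lborel (A \<inter> ball 0 (real n)) < \<infinity>"
      using emeasure_mono[of "A \<inter> ball 0 (real n)" "ball 0 (real n)" lborel] emeasure_lborel_ball_finite[of "0::'a" "real n"] by auto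
    then have I: "integrable lborel ?I" using An by (intro integrable_real_indicator) auto
    show "integrable lborel (\<lambda>x. ?I x * c')" using I by simp
    have "integrable lborel (\<lambda>x. ?I x * c)" using I by simp
    then show "integrable lborel (\<lambda>x. ?I x * q x)"
    proof (rule Bochner_Integration.integrable_bound)
      show "(\<lambda>x. ?I x * q x) \<in> borel_measurable lborel"
        using An by (intro borel_measurable_times borel_measurable_indicator) auto
    qed (use q c in \<open>auto simp: indicator_def\<close>)
    fix B :: "'a set"
    assume "B \<in> sets lborel"
    then have B: "B \<in> sets borel" by simp
    have F: "integrable lborel (\<lambda>x. indicator B x * ?I x)"
      using integrable_mult_indicator[of B lborel ?I] B I by simp
    have "ext (\<lambda>x. indicator B x * ?I x) \<le> c' * (LINT x|lborel. indicator B x * ?I x)"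
      by (rule ext_nonneg_le(2)[OF F _ \<eta>(1-3) _ c']) (auto simp: indicator_def \<eta>(4) split: if_splits)
    then show "(LINT x|lborel. indicator B x * (?I x * q x)) \<le> (LINT x|lborel. indicator B x * (?I x * c'))"
      unfolding q(4)[OF F] by (simp add: mult_ac flip: integral_mult_right_zero)
  qed
  then have "AE x in lborel. \<forall>n::nat. indicator (A \<inter> ball 0 (real n)) x * q x \<le> indicator (A \<inter> ball 0 (real n)) x * c'"
    by (simp add: AE_all_countable)
  then show ?thesis
  proof eventually_elim
    case (elim x)
    obtain n :: nat where "norm x < n" using reals_Archimedean2 by blast
    then show ?case using elim[rule_format, of n] by (auto simp: indicator_def)
  qed
qed

text \<open>\<open>ext\<close> reproduces \<Lambda> only on integrable functions. The supremum norm
  bound, tested on cutoffs increasing to 1, shows that q has integral at most 1. Then the cutoffs of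
  a general \<phi> converge in norm, and their integrals against q by dominated convergence.\<close>

lemma density_represents:
  assumes norm: "\<And>\<phi>. \<bar>\<Lambda> \<phi>\<bar> \<le> norm \<phi>"
    and q: "q \<in> borel_measurable borel" "\<And>x. 0 \<le> q x"
    "\<And>F. integrable lborel F \<Longrightarrow> ext F = (LINT x|lborel. F x * q x)" "\<And>x. q x \<le> c"
  shows "integrable lborel (\<lambda>x. apply_c_infty \<phi> x * q x)"
    and "\<Lambda> \<phi> = (LINT x|lborel. apply_c_infty \<phi> x * q x)"
proof -
  have [measurable]: "q \<in> borel_measurable borel" by (rule q)
  define \<eta> where "\<eta> n x = max 0 (min 1 (real n - norm x))" for n and x :: 'a
  have \<eta>: "continuous_on UNIV (\<eta> n)" "0 \<le> \<eta> n x" "\<eta> n x \<le> 1" for n x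
    unfolding \<eta>_def by (intro continuous_intros) auto
  have [measurable]: "\<eta> n \<in> borel_measurable borel" for n by (rule borel_measurable_continuous_onI[OF \<eta>(1)])
  have \<eta>_0: "\<eta> n x = 0" if "norm x \<ge> real n" for n x using that by (simp add: \<eta>_def)
  have \<eta>_1: "\<eta> n x = 1" if "norm x + 1 \<le> real n" for n x using that by (simp add: \<eta>_def)
  have \<eta>_lim: "(\<lambda>n. \<eta> n x) \<longlonglongrightarrow> 1" for x
  proof (rule tendsto_eventually)
    have "\<forall>\<^sub>F n in sequentially. norm x + 1 < real n"
      using filterlim_real_sequentially unfolding filterlim_at_top_dense by blast
    then show "\<forall>\<^sub>F n in sequentially. \<eta> n x = 1" by eventually_elim (simp add: \<eta>_1)
  qed
  have int: "integrable lborel (\<lambda>x. \<eta> n x * F x)" if [measurable]: "F \<in> borel_measurable borel" and "\<And>x. \<bar>F x\<bar> \<le> B" for n F B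
  proof -
    have "integrable lborel (indicator (ball (0::'a) (real n)) :: 'a \<Rightarrow> real)"
      using emeasure_lborel_ball_finite[of "0::'a" "real n"] by (intro integrable_real_indicator) auto
    then have "integrable lborel (\<lambda>x. B * indicator (ball (0::'a) (real n)) x)" by simp
    then show ?thesis
    proof (rule Bochner_Integration.integrable_bound)
      show "AE x in lborel. norm (\<eta> n x * F x) \<le> norm (B * indicator (ball 0 (real n)) x)"
      proof (rule AE_I2)
        fix x
        have "\<bar>F x\<bar> \<le> \<bar>B\<bar>" using that(2)[of x] by linarith
        then have "\<bar>\<eta> n x\<bar> * \<bar>F x\<bar> \<le> 1 * \<bar>B\<bar>" using \<eta>(2,3)[of n x] by (intro mult_mono) auto
        then show "norm (\<eta> n x * F x) \<le> norm (B * indicator (ball 0 (real n)) x)"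
          using \<eta>_0[of n x] by (cases "norm x < real n") (auto simp: abs_mult)
      qed
    qed measurable
  qed
  have q_int: "integrable lborel q"
  proof (rule integrableI_bounded)
    have bound: "(\<integral>\<^sup>+ x. ennreal (\<eta> n x * q x) \<partial>lborel) \<le> 1" for n
    proof -
      have "eventually (\<lambda>x. \<eta> n x = 0) at_infinity"
        unfolding eventually_at_infinity using \<eta>_0 by blast
      then have ap: "apply_c_infty (C_infty (\<eta> n)) = \<eta> n"
        by (intro apply_c_infty_C_infty \<eta> tendsto_eventually)
      have \<eta>_int: "integrable lborel (\<eta> n)" using int[of "\<lambda>_. 1" 1 n] by simp
      have "(LINT x|lborel. \<eta> n x * q x) = \<Lambda> (C_infty (\<eta> n))"
        using ext_c_infty[of "C_infty (\<eta> n)"] \<eta>_int by (simp add: ap q(3))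
      also have "\<dots> \<le> norm (C_infty (\<eta> n))" using norm[of "C_infty (\<eta> n)"] by linarith
      also have "\<dots> \<le> 1" using \<eta> by (intro norm_c_infty_le) (simp add: ap)
      finally have "(LINT x|lborel. \<eta> n x * q x) \<le> 1" .
      moreover have "(\<integral>\<^sup>+ x. ennreal (\<eta> n x * q x) \<partial>lborel) = ennreal (LINT x|lborel. \<eta> n x * q x)"
        using \<eta> q c by (intro nn_integral_eq_integral int[where B=c]) auto
      ultimately show ?thesis by (simp add: ennreal_le_1)
    qed
    have "(\<integral>\<^sup>+ x. ennreal (norm (q x)) \<partial>lborel) = (\<integral>\<^sup>+ x. liminf (\<lambda>n. ennreal (\<eta> n x * q x)) \<partial>lborel)"
    proof (intro nn_integral_cong)
      fix x
      have "(\<lambda>n. ennreal (\<eta> n x * q x)) \<longlonglongrightarrow> ennreal (1 * q x)"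
        by (intro tendsto_ennrealI tendsto_intros \<eta>_lim)
      from lim_imp_Liminf[OF _ this] show "ennreal (norm (q x)) = liminf (\<lambda>n. ennreal (\<eta> n x * q x))"
        using q(2)[of x] by simp
    qed
    also have "\<dots> \<le> liminf (\<lambda>n. \<integral>\<^sup>+ x. ennreal (\<eta> n x * q x) \<partial>lborel)"
      by (rule nn_integral_liminf) measurable
    also have "\<dots> \<le> 1" using bound by (intro Liminf_le) (auto intro: always_eventually)
    finally show "(\<integral>\<^sup>+ x. ennreal (norm (q x)) \<partial>lborel) < \<infinity>"
      by (rule le_less_trans) simp
  qed measurable
  show \<phi>q: "integrable lborel (\<lambda>x. apply_c_infty \<phi> x * q x)"
    using q_int abs_apply_c_infty_le_norm[of \<phi>]
    by (intro Bochner_Integration.integrable_bound[OF integrable_mult_right[OF q_int, of "norm \<phi>"]])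
      (auto simp: abs_mult intro!: mult_right_mono)
  have cut: "apply_c_infty (cutoff (\<eta> n) \<phi>) = (\<lambda>x. \<eta> n x * apply_c_infty \<phi> x)" for n
    by (rule apply_cutoff[OF \<eta>])
  have "(\<lambda>n. cutoff (\<eta> n) \<phi>) \<longlonglongrightarrow> \<phi>"
  proof (rule metric_LIMSEQ_I)
    fix e :: real
    assume "e > 0"
    then have "eventually (\<lambda>x. dist (apply_c_infty \<phi> x) 0 < e / 2) at_infinity"
      by (intro tendstoD[OF tendsto_apply_c_infty]) simp
    then obtain b where b: "\<And>x. norm x \<ge> b \<Longrightarrow> \<bar>apply_c_infty \<phi> x\<bar> < e / 2"
      by (auto simp: eventually_at_infinity)
    obtain N :: nat where N: "b + 1 < N" using reals_Archimedean2 by blast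
    have "dist (cutoff (\<eta> n) \<phi>) \<phi> < e" if "n \<ge> N" for n
    proof -
      have "norm (cutoff (\<eta> n) \<phi> - \<phi>) \<le> e / 2"
      proof (rule norm_c_infty_le)
        fix x
        have eq: "apply_c_infty (cutoff (\<eta> n) \<phi> - \<phi>) x = - ((1 - \<eta> n x) * apply_c_infty \<phi> x)"
          by (simp add: minus_c_infty.rep_eq cut algebra_simps)
        show "\<bar>apply_c_infty (cutoff (\<eta> n) \<phi> - \<phi>) x\<bar> \<le> e / 2"
        proof (cases "norm x \<ge> b")
          case True
          have "(1 - \<eta> n x) * \<bar>apply_c_infty \<phi> x\<bar> \<le> 1 * (e / 2)"
            using b[OF True] \<eta>(2,3)[of n x] by (intro mult_mono) auto
          then show ?thesis unfolding eq using \<eta>(3)[of n x] by (simp add: abs_mult)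
        next
          case False
          then have "\<eta> n x = 1" using N that by (intro \<eta>_1) simp
          then show ?thesis unfolding eq using \<open>e > 0\<close> by simp
        qed
      qed
      then show ?thesis using \<open>e > 0\<close> by (simp add: dist_norm)
    qed
    then show "\<exists>N. \<forall>n\<ge>N. dist (cutoff (\<eta> n) \<phi>) \<phi> < e" by blast
  qed
  then have "(\<lambda>n. norm (cutoff (\<eta> n) \<phi> - \<phi>)) \<longlonglongrightarrow> 0"
    by (intro tendsto_norm_zero LIM_zero)
  then have "(\<lambda>n. \<Lambda> (cutoff (\<eta> n) \<phi>) - \<Lambda> \<phi>) \<longlonglongrightarrow> 0"
    by (rule tendsto_0_le[where K=1]) (use norm in \<open>simp flip: linear_diff[OF linear]\<close>)
  then have 1: "(\<lambda>n. \<Lambda> (cutoff (\<eta> n) \<phi>)) \<longlonglongrightarrow> \<Lambda> \<phi>"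
    by (rule LIM_zero_cancel)
  have "(\<lambda>n. LINT x|lborel. \<eta> n x * apply_c_infty \<phi> x * q x) \<longlonglongrightarrow> (LINT x|lborel. apply_c_infty \<phi> x * q x)"
  proof (rule integral_dominated_convergence[where w="\<lambda>x. \<bar>apply_c_infty \<phi> x * q x\<bar>"])
    show "AE x in lborel. (\<lambda>n. \<eta> n x * apply_c_infty \<phi> x * q x) \<longlonglongrightarrow> apply_c_infty \<phi> x * q x"
    proof (rule AE_I2)
      fix x
      have "(\<lambda>n. \<eta> n x * apply_c_infty \<phi> x * q x) \<longlonglongrightarrow> 1 * apply_c_infty \<phi> x * q x"
        by (intro tendsto_intros \<eta>_lim)
      then show "(\<lambda>n. \<eta> n x * apply_c_infty \<phi> x * q x) \<longlonglongrightarrow> apply_c_infty \<phi> x * q x" by simp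
    qed
    show "AE x in lborel. norm (\<eta> n x * apply_c_infty \<phi> x * q x) \<le> \<bar>apply_c_infty \<phi> x * q x\<bar>" for n
      using \<eta> by (intro AE_I2) (simp add: abs_mult mult.assoc mult_left_le_one_le)
  qed (use \<phi>q in auto)
  moreover have "\<Lambda> (cutoff (\<eta> n) \<phi>) = (LINT x|lborel. \<eta> n x * apply_c_infty \<phi> x * q x)" for n
  proof -
    have "integrable lborel (apply_c_infty (cutoff (\<eta> n) \<phi>))"
      unfolding cut by (rule int[where B="norm \<phi>"]) (auto simp: abs_apply_c_infty_le_norm)
    then show ?thesis using ext_c_infty[of "cutoff (\<eta> n) \<phi>"] q(3) by (simp add: cut)
  qed
  ultimately have "(\<lambda>n. \<Lambda> (cutoff (\<eta> n) \<phi>)) \<longlonglongrightarrow> (LINT x|lborel. apply_c_infty \<phi> x * q x)"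
    by simp
  with 1 show "\<Lambda> \<phi> = (LINT x|lborel. apply_c_infty \<phi> x * q x)"
    by (rule LIMSEQ_unique)
qed

end


section \<open>The transition density\<close>

lemma mass_eq_integral:
  assumes "\<And>x. 0 \<le> apply_c_infty \<phi> x" "integrable lborel (apply_c_infty \<phi>)"
  shows "mass \<phi> = ennreal (LINT x|lborel. apply_c_infty \<phi> x)"
  unfolding mass_def using assms by (intro nn_integral_eq_integral) auto

text \<open>The factor 2^(\<alpha>+d) arises because the tail bound is applied with a radius known
  only to exceed |y - x|/2.\<close>

definition heat_const :: "'a::euclidean_space itself \<Rightarrow> real \<Rightarrow> real \<Rightarrow> real \<Rightarrow> real"
  where "heat_const T \<alpha> M a = diag_const T \<alpha> M a + 2 powr (\<alpha> + real DIM('a)) * tail_const T \<alpha> M a"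

context stable_like_semigroup
begin

lemma tail_const_pos: "tail_const TYPE('a) \<alpha> M a > 0"
  using diag_const_pos off_const_pos by (simp add: tail_const_def add_pos_pos)

lemma heat_kernel_density:
  assumes t: "t > 0"
  obtains p :: "'a \<Rightarrow> real" where "\<And>y. 0 \<le> p y"
    "\<And>\<phi>. integrable lborel (\<lambda>y. apply_c_infty \<phi> y * p y)"
    "\<And>\<phi>. apply_c_infty (P t \<phi>) x = (LINT y|lborel. apply_c_infty \<phi> y * p y)"
    "\<And>y. p y \<le> heat_const TYPE('a) \<alpha> M a *
      (if x = y then t powr (- real DIM('a) / \<alpha>)
       else min (t powr (- real DIM('a) / \<alpha>)) (t / norm (y - x) powr (\<alpha> + real DIM('a))))"
proof -
  define c where "c = diag_const TYPE('a) \<alpha> M a * t powr (- (real DIM('a) / \<alpha>))"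
  define \<Lambda> where "\<Lambda> \<phi> = apply_c_infty (P t \<phi>) x" for \<phi>
  interpret \<Lambda>: L1_bounded_functional \<Lambda> c
  proof
    show "\<Lambda> (\<phi> + \<psi>) = \<Lambda> \<phi> + \<Lambda> \<psi>" for \<phi> \<psi>
      by (simp add: \<Lambda>_def blinfun.add_right plus_c_infty.rep_eq)
    show "\<Lambda> (r *\<^sub>R \<phi>) = r *\<^sub>R \<Lambda> \<phi>" for r \<phi>
      by (simp add: \<Lambda>_def blinfun.scaleR_right scaleR_c_infty.rep_eq)
    show "0 \<le> \<Lambda> \<phi>" if "\<And>x. 0 \<le> apply_c_infty \<phi> x" for \<phi>
      unfolding \<Lambda>_def using P_positive[OF t that] by simp
    show "\<Lambda> \<phi> \<le> c * (LINT x|lborel. apply_c_infty \<phi> x)"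
      if "\<And>x. 0 \<le> apply_c_infty \<phi> x" "integrable lborel (apply_c_infty \<phi>)" for \<phi>
      unfolding \<Lambda>_def c_def using that mass_eq_integral[OF that] by (intro P_sup_le t) auto
    show "c > 0" unfolding c_def using diag_const_pos t by simp
  qed
  obtain q where q: "q \<in> borel_measurable borel" "\<And>y. 0 \<le> q y" "\<And>y. q y \<le> c"
    "\<And>F. integrable lborel F \<Longrightarrow> \<Lambda>.ext F = (LINT y|lborel. F y * q y)"
    using \<Lambda>.density_exists by metis
  have \<Lambda>_norm: "\<bar>\<Lambda> \<phi>\<bar> \<le> norm \<phi>" for \<phi>
    unfolding \<Lambda>_def using order_trans[OF abs_apply_c_infty_le_norm sg_norm_le[OF semigroup]] t by simp
  note repr = \<Lambda>.density_represents[OF \<Lambda>_norm q(1,2,4,3)]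
  \<comment> \<open>A continuous cutoff needs room between two radii: it vanishes inside R, as
    \<open>P_tail_le\<close> demands, and equals 1 beyond R'.\<close>
  have far: "AE y in lborel. norm (y - x) \<ge> R' \<longrightarrow> q y \<le> tail_const TYPE('a) \<alpha> M a * t * R powr (- \<alpha> - real DIM('a))"
    if R: "0 < R" "R < R'" for R R'
  proof -
    define \<eta> where "\<eta> y = max 0 (min 1 ((norm (y - x) - R) / (R' - R)))" for y
    have \<eta>: "continuous_on UNIV \<eta>" "0 \<le> \<eta> y" "\<eta> y \<le> 1" for y
      unfolding \<eta>_def using R by (intro continuous_intros) auto
    have "AE y in lborel. y \<in> {y. norm (y - x) \<ge> R'} \<longrightarrow> q y \<le> tail_const TYPE('a) \<alpha> M a * t * R powr (- \<alpha> - real DIM('a))"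
    proof (rule \<Lambda>.density_le_on[OF q _ \<eta>])
      show "{y. norm (y - x) \<ge> R'} \<in> sets borel"
        by (intro borel_closed closed_Collect_le continuous_intros)
      show "\<eta> y = 1" if "y \<in> {y. norm (y - x) \<ge> R'}" for y
        using that R by (simp add: \<eta>_def field_simps)
      show "0 \<le> tail_const TYPE('a) \<alpha> M a * t * R powr (- \<alpha> - real DIM('a))"
        using tail_const_pos t by (simp add: less_imp_le)
      fix \<phi> :: "'a c_infty"
      assume \<phi>: "\<And>y. 0 \<le> apply_c_infty \<phi> y" "integrable lborel (apply_c_infty \<phi>)"
      have cut: "apply_c_infty (cutoff \<eta> \<phi>) = (\<lambda>y. \<eta> y * apply_c_infty \<phi> y)" by (rule apply_cutoff[OF \<eta>])
      have [measurable]: "\<eta> \<in> borel_measurable borel" by (rule borel_measurable_continuous_onI[OF \<eta>(1)])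
      have nonneg: "0 \<le> apply_c_infty (cutoff \<eta> \<phi>) y" for y using \<eta>(2) \<phi>(1) by (simp add: cut)
      have int: "integrable lborel (apply_c_infty (cutoff \<eta> \<phi>))"
        by (rule Bochner_Integration.integrable_bound[OF \<phi>(2)])
          (use \<eta> in \<open>auto simp: cut abs_mult intro!: mult_left_le_one_le\<close>)
      show "\<Lambda> (cutoff \<eta> \<phi>) \<le> tail_const TYPE('a) \<alpha> M a * t * R powr (- \<alpha> - real DIM('a)) * (LINT y|lborel. apply_c_infty (cutoff \<eta> \<phi>) y)"
        unfolding \<Lambda>_def
      proof (rule P_tail_le[OF t R(1) _ nonneg])
        show "mass (cutoff \<eta> \<phi>) \<le> ennreal (LINT y|lborel. apply_c_infty (cutoff \<eta> \<phi>) y)"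
          using mass_eq_integral[OF nonneg int] by simp
        show "apply_c_infty (cutoff \<eta> \<phi>) y = 0" if "norm (y - x) < R" for y
        proof -
          have "(norm (y - x) - R) / (R' - R) \<le> 0" using that R by (intro divide_nonpos_pos) auto
          then have "\<eta> y = 0" by (simp add: \<eta>_def)
          then show ?thesis by (simp add: cut)
        qed
      qed (use nonneg in simp)
    qed
    then show ?thesis by simp
  qed
  \<comment> \<open>The exceptional null set of \<open>far\<close> depends on the radii. Rational
    pairs have a common one, and a pair with |y - x|/2 < R < R' < |y - x| serves the point
    y.\<close>
  have "AE y in lborel. \<forall>s\<in>\<rat> \<times> \<rat>. 0 < fst s \<and> fst s < snd s \<longrightarrow> norm (y - x) \<ge> snd s \<longrightarrow>
      q y \<le> tail_const TYPE('a) \<alpha> M a * t * fst s powr (- \<alpha> - real DIM('a))"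
    by (subst AE_ball_countable) (use far in \<open>auto simp: countable_rat\<close>)
  then have tail: "AE y in lborel. y \<noteq> x \<longrightarrow> q y \<le> tail_const TYPE('a) \<alpha> M a * t * (norm (y - x) / 2) powr (- \<alpha> - real DIM('a))"
  proof eventually_elim
    case (elim y)
    show ?case
    proof
      assume "y \<noteq> x"
      then have n: "norm (y - x) > 0" by simp
      obtain R where R: "R \<in> \<rat>" "norm (y - x) / 2 < R" "R < norm (y - x)"
        using Rats_dense_in_real[of "norm (y - x) / 2" "norm (y - x)"] n by auto
      obtain R' where R': "R' \<in> \<rat>" "R < R'" "R' < norm (y - x)"
        using Rats_dense_in_real[OF R(3)] by auto
      have "q y \<le> tail_const TYPE('a) \<alpha> M a * t * R powr (- \<alpha> - real DIM('a))"
        using elim[rule_format, of "(R, R')"] R R' n by simp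
      also have "\<dots> \<le> tail_const TYPE('a) \<alpha> M a * t * (norm (y - x) / 2) powr (- \<alpha> - real DIM('a))"
        using R n tail_const_pos t alpha by (intro mult_left_mono powr_mono2') (auto simp: less_imp_le)
      finally show "q y \<le> tail_const TYPE('a) \<alpha> M a * t * (norm (y - x) / 2) powr (- \<alpha> - real DIM('a))" .
    qed
  qed
  define B where "B y = heat_const TYPE('a) \<alpha> M a *
      (if x = y then t powr (- real DIM('a) / \<alpha>)
       else min (t powr (- real DIM('a) / \<alpha>)) (t / norm (y - x) powr (\<alpha> + real DIM('a))))" for y
  have [measurable]: "q \<in> borel_measurable borel" by (rule q)
  have [measurable]: "B \<in> borel_measurable borel" unfolding B_def by measurable
  have heat: "heat_const TYPE('a) \<alpha> M a \<ge> diag_const TYPE('a) \<alpha> M a"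
    "heat_const TYPE('a) \<alpha> M a \<ge> 2 powr (\<alpha> + real DIM('a)) * tail_const TYPE('a) \<alpha> M a"
    "heat_const TYPE('a) \<alpha> M a > 0"
    using diag_const_pos tail_const_pos by (auto simp: heat_const_def less_imp_le add_pos_pos)
  have B: "0 \<le> B y" for y
    using heat(3) t by (simp add: B_def)
  have q_le: "AE y in lborel. q y \<le> B y"
    using tail AE_lborel_singleton[of x]
  proof eventually_elim
    case (elim y)
    have "(norm (y - x) / 2) powr (- \<alpha> - real DIM('a)) = 2 powr (\<alpha> + real DIM('a)) / norm (y - x) powr (\<alpha> + real DIM('a))"
    proof -
      have "- \<alpha> - real DIM('a) = - (\<alpha> + real DIM('a))" by simp
      then show ?thesis by (simp only: powr_minus powr_divide) (simp add: divide_inverse)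
    qed
    with elim have "q y \<le> tail_const TYPE('a) \<alpha> M a * t * (2 powr (\<alpha> + real DIM('a)) / norm (y - x) powr (\<alpha> + real DIM('a)))"
      by simp
    also have "\<dots> = (2 powr (\<alpha> + real DIM('a)) * tail_const TYPE('a) \<alpha> M a) * (t / norm (y - x) powr (\<alpha> + real DIM('a)))"
      by simp
    also have "\<dots> \<le> heat_const TYPE('a) \<alpha> M a * (t / norm (y - x) powr (\<alpha> + real DIM('a)))"
      using heat t by (intro mult_right_mono) auto
    finally have 1: "q y \<le> heat_const TYPE('a) \<alpha> M a * (t / norm (y - x) powr (\<alpha> + real DIM('a)))" .
    have "q y \<le> c" by (rule q)
    also have "c \<le> heat_const TYPE('a) \<alpha> M a * t powr (- real DIM('a) / \<alpha>)"
      unfolding c_def using heat by (simp add: mult_right_mono)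
    finally show ?case using 1 elim heat(3) by (auto simp: B_def min_def)
  qed
  \<comment> \<open>The bound holds for q almost everywhere only; the minimum is a version that
    obeys it at every y, including y = x.\<close>
  define p where "p y = min (q y) (B y)" for y
  have [measurable]: "p \<in> borel_measurable borel" unfolding p_def by measurable
  have p_eq: "AE y in lborel. apply_c_infty \<phi> y * q y = apply_c_infty \<phi> y * p y" for \<phi>
    using q_le by eventually_elim (simp add: p_def)
  show ?thesis
  proof (rule that[of p])
    show "0 \<le> p y" for y using B q(2) by (simp add: p_def)
    show "integrable lborel (\<lambda>y. apply_c_infty \<phi> y * p y)" for \<phi>
      using repr(1)[of \<phi>] by (rule Bochner_Integration.integrable_cong_AE[THEN iffD1, rotated -1]) (use p_eq in auto)
    show "apply_c_infty (P t \<phi>) x = (LINT y|lborel. apply_c_infty \<phi> y * p y)" for \<phi>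
    proof -
      have "apply_c_infty (P t \<phi>) x = (LINT y|lborel. apply_c_infty \<phi> y * q y)"
        using repr(2)[of \<phi>] by (simp add: \<Lambda>_def)
      also have "\<dots> = (LINT y|lborel. apply_c_infty \<phi> y * p y)"
        by (rule integral_cong_AE) (use p_eq in auto)
      finally show ?thesis .
    qed
    show "p y \<le> heat_const TYPE('a) \<alpha> M a *
      (if x = y then t powr (- real DIM('a) / \<alpha>)
       else min (t powr (- real DIM('a) / \<alpha>)) (t / norm (y - x) powr (\<alpha> + real DIM('a))))" for y
      unfolding p_def B_def by (rule min.cobounded2)
  qed
qed

end

theorem theorem2:
  fixes \<alpha> M a :: real
  assumes "0 < \<alpha>" "\<alpha> < 2" "0 < M" "0 < a"
  shows "\<exists>C>0. \<forall>(f :: 'a::euclidean_space \<Rightarrow> 'a \<Rightarrow> ennreal) (P :: real \<Rightarrow> 'a c_infty \<Rightarrow>\<^sub>L 'a c_infty).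
    (\<lambda>(x, y). f x y) \<in> borel_measurable borel \<longrightarrow>
    (\<forall>x y. y \<noteq> x \<longrightarrow> f x y \<le> ennreal (M * norm (y - x) powr (- \<alpha> - real DIM('a)))) \<longrightarrow>
    ((\<forall>x h. f x (x + h) = f x (x - h)) \<or> \<alpha> < 1) \<longrightarrow>
    (\<forall>x y. f x y = f y x) \<longrightarrow>
    (\<forall>\<epsilon>>0. (INF x. \<integral>\<^sup>+ y\<in>{y. norm (y - x) > \<epsilon>}. f x y \<partial>lborel) \<ge> ennreal (a * \<epsilon> powr (- \<alpha>))) \<longrightarrow>
    (\<forall>y. continuous_on (- {y}) (\<lambda>x. f x y)) \<longrightarrow>
    closable (nonlocal_graph f) \<longrightarrow>
    contraction_semigroup P \<longrightarrow>
    closure (nonlocal_graph f) = generator P \<longrightarrow>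
    (\<exists>p :: real \<Rightarrow> 'a \<Rightarrow> 'a \<Rightarrow> real.
      (\<forall>t>0. \<forall>x y. 0 \<le> p t x y) \<and>
      (\<forall>t>0. \<forall>x. \<forall>\<phi> :: 'a c_infty.
        integrable lborel (\<lambda>y. apply_c_infty \<phi> y * p t x y) \<and>
        apply_c_infty (blinfun_apply (P t) \<phi>) x = (LINT y|lborel. apply_c_infty \<phi> y * p t x y)) \<and>
      (\<forall>t>0. \<forall>x y. p t x y \<le>
        C * (if x = y then t powr (- real DIM('a) / \<alpha>)
             else min (t powr (- real DIM('a) / \<alpha>)) (t / norm (y - x) powr (\<alpha> + real DIM('a))))))"
proof (intro exI[of _ "heat_const TYPE('a) \<alpha> M a"] conjI allI impI)
  have D: "diag_const TYPE('a) \<alpha> M a > 0" using assms by (simp add: diag_const_def)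
  have "trunc_ratio TYPE('a) \<alpha> > 0" using assms by (simp add: trunc_ratio_def add_pos_pos)
  then have "off_const TYPE('a) \<alpha> M > 0" using assms by (simp add: off_const_def add_pos_pos)
  with D show "heat_const TYPE('a) \<alpha> M a > 0" by (simp add: heat_const_def tail_const_def add_pos_pos)
next
  fix f :: "'a \<Rightarrow> 'a \<Rightarrow> ennreal" and P :: "real \<Rightarrow> 'a c_infty \<Rightarrow>\<^sub>L 'a c_infty"
  assume f: "(\<lambda>(x, y). f x y) \<in> borel_measurable borel"
    "\<forall>x y. y \<noteq> x \<longrightarrow> f x y \<le> ennreal (M * norm (y - x) powr (- \<alpha> - real DIM('a)))"
    "(\<forall>x h. f x (x + h) = f x (x - h)) \<or> \<alpha> < 1" "\<forall>x y. f x y = f y x"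
    and lower: "\<forall>\<epsilon>>0. (INF x. \<integral>\<^sup>+ y\<in>{y. norm (y - x) > \<epsilon>}. f x y \<partial>lborel) \<ge> ennreal (a * \<epsilon> powr (- \<alpha>))"
    and "\<forall>y. continuous_on (- {y}) (\<lambda>x. f x y)"
    and P: "contraction_semigroup P" "closure (nonlocal_graph f) = generator P"
  interpret stable_like_semigroup f \<alpha> M a P
  proof
    show "ennreal (a * \<epsilon> powr (- \<alpha>)) \<le> (\<integral>\<^sup>+ y\<in>{y. norm (y - x) > \<epsilon>}. f x y \<partial>lborel)" if "\<epsilon> > 0" for \<epsilon> x
      using lower[rule_format, OF that] by (rule order_trans) (rule INF_lower[OF UNIV_I])
    show "f x y = f y x" for x y
      using f(4) by blast
  qed (use assms f(1-3) P \<open>\<forall>y. continuous_on (- {y}) (\<lambda>x. f x y)\<close> in auto)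
  \<comment> \<open>The density is obtained for each t and x separately; collecting its properties
    in one predicate allows a single choice of p.\<close>
  define Q where "Q t x p \<longleftrightarrow> (\<forall>y. 0 \<le> p y) \<and>
      (\<forall>\<phi>. integrable lborel (\<lambda>y. apply_c_infty \<phi> y * p y) \<and>
        apply_c_infty (P t \<phi>) x = (LINT y|lborel. apply_c_infty \<phi> y * p y)) \<and>
      (\<forall>y. p y \<le> heat_const TYPE('a) \<alpha> M a * (if x = y then t powr (- real DIM('a) / \<alpha>)
             else min (t powr (- real DIM('a) / \<alpha>)) (t / norm (y - x) powr (\<alpha> + real DIM('a)))))"
    for t x and p :: "'a \<Rightarrow> real"
  have "\<exists>p. t > 0 \<longrightarrow> Q t x p" for t x
  proof (cases "t > 0")
    case True
    show ?thesis
      by (rule heat_kernel_density[OF True, of x], rule exI, rule impI, unfold Q_def, intro conjI allI) assumption+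
  qed simp
  then obtain p where "\<And>t x. t > 0 \<longrightarrow> Q t x (p t x)"
    by metis
  then show "\<exists>p :: real \<Rightarrow> 'a \<Rightarrow> 'a \<Rightarrow> real.
      (\<forall>t>0. \<forall>x y. 0 \<le> p t x y) \<and>
      (\<forall>t>0. \<forall>x. \<forall>\<phi> :: 'a c_infty.
        integrable lborel (\<lambda>y. apply_c_infty \<phi> y * p t x y) \<and>
        apply_c_infty (blinfun_apply (P t) \<phi>) x = (LINT y|lborel. apply_c_infty \<phi> y * p t x y)) \<and>
      (\<forall>t>0. \<forall>x y. p t x y \<le>
        heat_const TYPE('a) \<alpha> M a * (if x = y then t powr (- real DIM('a) / \<alpha>)
             else min (t powr (- real DIM('a) / \<alpha>)) (t / norm (y - x) powr (\<alpha> + real DIM('a)))))"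
    unfolding Q_def by (intro exI[of _ p]) blast
qed

end
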